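(* Let $S$ be a non-empty set and let $(a_1,b_1)^{u_1}\cdots(a_m,b_m)^{u_m}\equiv 1$ be an elementary commutator identity in the free group on $S$, where $a_i,b_i\in S$ and $u_i\in{\rm Word}(S\cup S^{-1})$. Then there exist an $S$-colored oriented doodle diagram $D$ in $S^2$ and a proper noose system ${\cal N}$ for $D$ such that $I(D,{\cal N})$ is the given elementary commutator identity.
   Context: We identify $S^2$ with $\mathbb{R}^2\cup\{\infty\}$. A doodle diagram is a finite collection of oriented immersed circles in $S^2$ whose multiple points are transverse double points (crossings). It is $S$-colored if each component is labelled by an element of $S$. ${\rm Word}(S\cup S^{-1})$ is the free monoid on $S$ and the formal inverses $S^{-1}$; $(u,v)=u^{-1}v^{-1}uv$ and $u^v=v^{-1}uv$. A commutator identity on $S$ is an expression $w_1\cdots w_m\equiv 1$ with each $w_i$ a word representing an element of the commutator subgroup of the free group on $S$ and $w_1\cdots w_m$ representing the identity; it is elementary if it has the form $(a_1,b_1)^{u_1}\cdots(a_m,b_m)^{u_m}\equiv 1$ with $a_i,b_i\in S$, $u_i$ words. A noose is the image $N$ of an embedding into $S^2$ of $X=D^2\cup I'$, $D^2$ the closed unit disk, $I'=[1,2]\times\{0\}$; head = image of $D^2$, loop = image of $\partial D^2$ (oriented counterclockwise), rope = image of $I'$, neck = image of $(1,0)$, root = image of $(2,0)$. A noose for $D$: root misses $D$, loop and rope transverse to $D$ and missing crossings. A noose system for $D$: a sequence $(N_1,\dots,N_m)$ of nooses for $D$, pairwise disjoint except for a common root (base point), ropes appearing counterclockwise in this order around the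 base point, every crossing of $D$ in some head. For a path $\alpha$ transverse to $D$, the intersection letter at $x\in\alpha\cap D$ is $a^{\epsilon}$, $a$ the label of the component through $x$, $\epsilon=+1$ if $\alpha$ crosses it from its right-hand side to its left-hand side, $-1$ otherwise; the intersection word along $\alpha$ is the product of letters in order. The intersection word of a noose is that along the path from the root along the rope, once counterclockwise around the loop, back to the root. $I(D,{\cal N})$ is $w_1\cdots w_m\equiv1$ with $w_i$ the intersection word of $N_i$. A noose for $D$ is proper if (P1) $D\cap$ head is a union of two embedded arcs meeting in a single point, and (P2) going around the loop it crosses one component from left to right, then another from left to right, then the first from right to left, then the second from right to left (with respect to the components' orientations). A noose system is proper if all its nooses are proper. *)

theory Defs
  imports "HOL-Analysis.Analysis"
begin

text \<open>A letter of Word(S \<union> S^-1) is a pair (a, e): (a, True) is a, (a, False) is a^-1.\<close>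
type_synonym 's letter = "'s \<times> bool"

definition winv :: "'s letter list \<Rightarrow> 's letter list" where
  "winv w = rev (map (\<lambda>(a, e). (a, \<not> e)) w)"

text \<open>Free reduction; a word represents the identity of the free group iff it reduces to [].\<close>
fun fred :: "'s letter list \<Rightarrow> 's letter list" where
  "fred [] = []"
| "fred (x # xs) = (case fred xs of
      [] \<Rightarrow> [x]
    | y # ys \<Rightarrow> (if fst y = fst x \<and> snd y \<noteq> snd x then ys else x # y # ys))"

fun comm_word :: "'s \<times> 's \<times> 's letter list \<Rightarrow> 's letter list" where
  "comm_word (a, b, u) = winv u @ [(a, False), (b, False), (a, True), (b, True)] @ u"

definition elementary_identity :: "'s set \<Rightarrow> ('s \<times> 's \<times> 's letter list) list \<Rightarrow> bool" where
  "elementary_identity S E \<longleftrightarrow>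
     (\<forall>(a, b, u) \<in> set E. a \<in> S \<and> b \<in> S \<and> (\<forall>l \<in> set u. fst l \<in> S))
     \<and> fred (concat (map comm_word E)) = []"

text \<open>S^2 is the unit sphere in R^3, oriented so that (v, w) is a positive basis of the
  tangent plane at p iff p \<bullet> (v \<times> w) > 0.  (This is the orientation making the stereographic
  projection from the south pole (the point \<infinity>) onto R^2 orientation preserving.)\<close>
definition S2 :: "(real^3) set" where
  "S2 = sphere 0 1"

definition immersed_circle :: "(real \<Rightarrow> real^3) \<Rightarrow> bool" where
  "immersed_circle \<gamma> \<longleftrightarrow>
     (\<forall>t. \<gamma> (t + 1) = \<gamma> t) \<and> (\<forall>t. \<gamma> t \<in> S2) \<and> (\<forall>t. \<gamma> differentiable (at t))
     \<and> continuous_on UNIV (\<lambda>t. vector_derivative \<gamma> (at t))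
     \<and> (\<forall>t. vector_derivative \<gamma> (at t) \<noteq> 0)"

text \<open>An S-colored diagram: a finite list of components (label, parametrisation).\<close>
type_synonym 's diagram = "('s \<times> (real \<Rightarrow> real^3)) list"

definition comp_vel :: "'s diagram \<Rightarrow> nat \<Rightarrow> real \<Rightarrow> real^3" where
  "comp_vel D i t = vector_derivative (snd (D ! i)) (at t)"

definition preim :: "'s diagram \<Rightarrow> real^3 \<Rightarrow> (nat \<times> real) set" where
  "preim D q = {(i, t). i < length D \<and> 0 \<le> t \<and> t < 1 \<and> snd (D ! i) t = q}"

definition dimage :: "'s diagram \<Rightarrow> (real^3) set" where
  "dimage D = {q. preim D q \<noteq> {}}"

definition crossing :: "'s diagram \<Rightarrow> real^3 \<Rightarrow> bool" where
  "crossing D q \<longleftrightarrow> card (preim D q) = 2"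

definition doodle :: "'s set \<Rightarrow> 's diagram \<Rightarrow> bool" where
  "doodle S D \<longleftrightarrow>
     (\<forall>i < length D. fst (D ! i) \<in> S \<and> immersed_circle (snd (D ! i)))
     \<and> (\<forall>q. finite (preim D q) \<and> card (preim D q) \<le> 2
          \<and> (\<forall>i s j t. (i, s) \<in> preim D q \<and> (j, t) \<in> preim D q \<and> (i, s) \<noteq> (j, t)
                \<longrightarrow> cross3 (comp_vel D i s) (comp_vel D j t) \<noteq> 0))"

text \<open>Intersection letter at a non-crossing point q of D for a path with velocity w at q:
  the label of the component through q, with exponent +1 (True) iff the path crosses the
  component from its right-hand side to its left-hand side.\<close>
definition dletter :: "'s diagram \<Rightarrow> real^3 \<Rightarrow> real^3 \<Rightarrow> 's letter" where
  "dletter D q w = (let (i, t) = (THE it. it \<in> preim D q)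
                    in (fst (D ! i), q \<bullet> cross3 (comp_vel D i t) w > 0))"

definition transverse_on :: "'s diagram \<Rightarrow> (real \<Rightarrow> real^3) \<Rightarrow> (real \<Rightarrow> real^3) \<Rightarrow> real set \<Rightarrow> bool" where
  "transverse_on D \<alpha> \<alpha>' T \<longleftrightarrow>
     finite {t \<in> T. \<alpha> t \<in> dimage D}
     \<and> (\<forall>t \<in> T. \<forall>i s. (i, s) \<in> preim D (\<alpha> t) \<longrightarrow>
          card (preim D (\<alpha> t)) = 1 \<and> \<alpha> t \<bullet> cross3 (comp_vel D i s) (\<alpha>' t) \<noteq> 0)"

definition iword :: "'s diagram \<Rightarrow> (real \<Rightarrow> real^3) \<Rightarrow> (real \<Rightarrow> real^3) \<Rightarrow> real set \<Rightarrow> 's letter list" where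
  "iword D \<alpha> \<alpha>' T = map (\<lambda>t. dletter D (\<alpha> t) (\<alpha>' t)) (sorted_list_of_set {t \<in> T. \<alpha> t \<in> dimage D})"

definition noose_dom :: "complex set" where
  "noose_dom = cball 0 1 \<union> of_real ` {1..2}"

definition Dn :: "(complex \<Rightarrow> real^3) \<Rightarrow> complex \<Rightarrow> complex \<Rightarrow> real^3" where
  "Dn f x = frechet_derivative f (at x)"

definition noose_embedding :: "(complex \<Rightarrow> real^3) \<Rightarrow> bool" where
  "noose_embedding f \<longleftrightarrow>
     inj_on f noose_dom \<and> f ` noose_dom \<subseteq> S2
     \<and> (\<forall>x \<in> noose_dom. f differentiable (at x))
     \<and> (\<forall>x \<in> cball 0 1. f x \<bullet> cross3 (Dn f x 1) (Dn f x \<i>) > 0)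
     \<and> (\<forall>s \<in> {1..2}. Dn f (of_real s) 1 \<noteq> 0)"

definition head :: "(complex \<Rightarrow> real^3) \<Rightarrow> (real^3) set" where
  "head f = f ` cball 0 1"

definition noose_set :: "(complex \<Rightarrow> real^3) \<Rightarrow> (real^3) set" where
  "noose_set f = f ` noose_dom"

definition root :: "(complex \<Rightarrow> real^3) \<Rightarrow> real^3" where
  "root f = f 2"

definition loop_path :: "(complex \<Rightarrow> real^3) \<Rightarrow> real \<Rightarrow> real^3" where
  "loop_path f \<theta> = f (cis \<theta>)"

definition loop_vel :: "(complex \<Rightarrow> real^3) \<Rightarrow> real \<Rightarrow> real^3" where
  "loop_vel f \<theta> = Dn f (cis \<theta>) (\<i> * cis \<theta>)"

definition rope_path :: "(complex \<Rightarrow> real^3) \<Rightarrow> real \<Rightarrow> real^3" where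
  "rope_path f t = f (of_real (2 - t))"

definition rope_vel :: "(complex \<Rightarrow> real^3) \<Rightarrow> real \<Rightarrow> real^3" where
  "rope_vel f t = - Dn f (of_real (2 - t)) 1"

definition noose_for :: "'s diagram \<Rightarrow> (complex \<Rightarrow> real^3) \<Rightarrow> bool" where
  "noose_for D f \<longleftrightarrow>
     noose_embedding f \<and> root f \<notin> dimage D
     \<and> transverse_on D (loop_path f) (loop_vel f) {0..2 * pi}
     \<and> transverse_on D (rope_path f) (rope_vel f) {0..1}"

definition loop_word :: "'s diagram \<Rightarrow> (complex \<Rightarrow> real^3) \<Rightarrow> 's letter list" where
  "loop_word D f = iword D (loop_path f) (loop_vel f) {0..<2 * pi}"

definition rope_word :: "'s diagram \<Rightarrow> (complex \<Rightarrow> real^3) \<Rightarrow> 's letter list" where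
  "rope_word D f = iword D (rope_path f) (rope_vel f) {0..<1}"

definition noose_word :: "'s diagram \<Rightarrow> (complex \<Rightarrow> real^3) \<Rightarrow> 's letter list" where
  "noose_word D f = rope_word D f @ loop_word D f @ winv (rope_word D f)"

definition proper_noose :: "'s diagram \<Rightarrow> (complex \<Rightarrow> real^3) \<Rightarrow> bool" where
  "proper_noose D f \<longleftrightarrow> noose_for D f \<and>
     (\<exists>g1 g2 c \<theta>1 \<theta>2 \<theta>3 \<theta>4.
        arc g1 \<and> arc g2
        \<and> dimage D \<inter> head f = path_image g1 \<union> path_image g2
        \<and> path_image g1 \<inter> path_image g2 = {c}
        \<and> sorted_list_of_set {\<theta> \<in> {0..<2 * pi}. loop_path f \<theta> \<in> dimage D} = [\<theta>1, \<theta>2, \<theta>3, \<theta>4]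
        \<and> loop_path f \<theta>1 \<in> path_image g1 \<and> loop_path f \<theta>3 \<in> path_image g1
        \<and> loop_path f \<theta>2 \<in> path_image g2 \<and> loop_path f \<theta>4 \<in> path_image g2
        \<and> \<not> snd (dletter D (loop_path f \<theta>1) (loop_vel f \<theta>1))
        \<and> \<not> snd (dletter D (loop_path f \<theta>2) (loop_vel f \<theta>2))
        \<and> snd (dletter D (loop_path f \<theta>3) (loop_vel f \<theta>3))
        \<and> snd (dletter D (loop_path f \<theta>4) (loop_vel f \<theta>4)))"

definition rope_dir :: "(complex \<Rightarrow> real^3) \<Rightarrow> real^3" where
  "rope_dir f = - Dn f 2 1"

definition noose_system :: "'s diagram \<Rightarrow> (complex \<Rightarrow> real^3) list \<Rightarrow> bool" where
  "noose_system D N \<longleftrightarrow>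
     (\<forall>k < length N. noose_for D (N ! k))
     \<and> (\<forall>k < length N. \<forall>j < length N. root (N ! k) = root (N ! j))
     \<and> (\<forall>k < length N. \<forall>j < length N. k \<noteq> j \<longrightarrow>
          noose_set (N ! k) \<inter> noose_set (N ! j) = {root (N ! k)})
     \<and> (\<exists>\<theta> :: nat \<Rightarrow> real. \<theta> 0 = 0
          \<and> (\<forall>k. Suc k < length N \<longrightarrow> \<theta> k < \<theta> (Suc k))
          \<and> (\<forall>k < length N. \<theta> k < 2 * pi \<and>
               sgn (rope_dir (N ! k)) = cos (\<theta> k) *\<^sub>R sgn (rope_dir (N ! 0))
                  + sin (\<theta> k) *\<^sub>R cross3 (root (N ! 0)) (sgn (rope_dir (N ! 0)))))
     \<and> (\<forall>q. crossing D q \<longrightarrow> (\<exists>k < length N. q \<in> head (N ! k)))"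

definition proper_noose_system :: "'s diagram \<Rightarrow> (complex \<Rightarrow> real^3) list \<Rightarrow> bool" where
  "proper_noose_system D N \<longleftrightarrow> noose_system D N \<and> (\<forall>k < length N. proper_noose D (N ! k))"

end

theory Submission
  imports Defs
begin

text \<open>Let \<open>w\<close> be the product of the given conjugated commutators. Put the letters of \<open>w\<close> in order on a short arc of the
  equator, with a strand going up at a letter with exponent \<open>-1\<close> and down at one with exponent \<open>1\<close>. In the
  upper hemisphere, join inside each factor the letters of \<open>u\<^sup>-\<^sup>1\<close> to their mirror images in \<open>u\<close>, and in the
  commutator join the two letters \<open>a\<close> and the two letters \<open>b\<close>; only the last two arcs cross. Since \<open>w\<close> reduces to
  the empty word, cancellation yields a noncrossing matching of its letters, which is realised in the lower
  hemisphere. All arcs are half circles orthogonal to the equator, so orthogonal projection to the equatorial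
  plane turns them into chords of the unit disc, which are disjoint unless their end points interleave.

  The root of all nooses is the north pole. In projection, the heads are small round discs centred at the
  crossings, and the ropes are radial segments, which meet exactly the chords of the conjugating words, in the
  order of \<open>u\<^sup>-\<^sup>1\<close>.\<close>

section \<open>Words and noncrossing matchings\<close>

text \<open>The points on the equator fill less than a quarter circle. All half angles that occur
  are then so small that a sine has the sign of its argument, and the affine function
  \<open>side\<close> turns every question of separation by a chord into a comparison of positions
  in the word. Half circles are used because they reach the equator vertically: once all have the
  same end speed, successive ones fit together to C^1 curves, whatever permutation the two matchings
  produce. An arc that leaves a point upwards arrives downwards, which is why partners must carry
  inverse letters. The nooses stay in the open upper hemisphere, where projection preserves
  orientation; there the triple products in the definitions are positive multiples of planar
  determinants. The definitions speak of components, the geometry of arcs: a bijection between their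
  parameters transfers counts of preimages, and velocities agree up to positive factors. Finally, a
  noose must be differentiable at its neck and its rope must have nonzero velocity up to the common
  root, which decides the shape of its planar model.\<close>

definition linv :: "'s letter \<Rightarrow> 's letter" where
  "linv x = (fst x, \<not> snd x)"

lemma fst_linv [simp]: "fst (linv x) = fst x" and snd_linv [simp]: "snd (linv x) = (\<not> snd x)"
  and linv_linv [simp]: "linv (linv x) = x"
  by (auto simp: linv_def)

lemma winv_eq: "winv w = rev (map linv w)"
  by (simp add: winv_def linv_def case_prod_unfold)

lemma length_winv [simp]: "length (winv w) = length w"
  by (simp add: winv_eq)

lemma winv_winv [simp]: "winv (winv w) = w"
  by (simp add: winv_eq rev_map o_def)

text \<open>The first letter is paired with one that cancels it, which splits the rest into the part
  enclosed by the pair and the part behind it; in this shape a matching can be built by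
  recursion.\<close>

inductive dyck :: "'s letter list \<Rightarrow> bool" where
  Nil: "dyck []"
| Cons: "dyck v \<Longrightarrow> dyck w \<Longrightarrow> dyck (x # v @ linv x # w)"

text \<open>The surviving letter \<open>y\<close> has an occurrence before which everything cancels
  among itself. If the first letter \<open>z\<close> of \<open>w\<close> is cancelled, induction is
  used twice: for the rest, whose reduced form begins with \<open>linv z\<close>, and for what
  follows that letter, whose reduced form begins with \<open>y\<close>.\<close>

lemma fred_Cons_split:
  "fred w = y # ys \<Longrightarrow> \<exists>v w'. w = v @ y # w' \<and> dyck v \<and> fred w' = ys"
proof (induction "length w" arbitrary: w y ys rule: less_induct)
  case less
  then obtain z zs where w: "w = z # zs" by (cases w) auto
  show ?case
  \<comment> \<open>The first alternative is impossible, as a letter does not cancel an equal one.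
    With the second excluded too, \<open>z\<close> cancels the head of
    \<open>fred zs\<close>.\<close>
  proof (cases "fred zs = z # fred w \<or> w = y # zs \<and> fred zs = ys")
    case True
    then show ?thesis
    proof
      assume "fred zs = z # fred w"
      then show ?thesis using less.prems w by (auto split: list.splits if_splits)
    next
      assume "w = y # zs \<and> fred zs = ys"
      then show ?thesis using dyck.Nil by (metis append_Nil)
    qed
  next
    case False
    with less.prems w have zs: "fred zs = linv z # y # ys"
      by (auto split: list.splits if_splits simp: linv_def prod_eq_iff)
    from less.hyps[OF _ zs] w obtain v1 w1 where 1: "zs = v1 @ linv z # w1" "dyck v1" "fred w1 = y # ys"
      by auto
    from less.hyps[OF _ 1(3)] w 1(1) obtain v2 w2 where 2: "w1 = v2 @ y # w2" "dyck v2" "fred w2 = ys"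
      by auto
    have "w = (z # v1 @ linv z # v2) @ y # w2" using w 1 2 by simp
    then show ?thesis using dyck.Cons[OF 1(2) 2(2), of z] 2(3) by blast
  qed
qed

lemma fred_Nil_imp_dyck: "fred w = [] \<Longrightarrow> dyck w"
proof (induction "length w" arbitrary: w rule: less_induct)
  case less
  show ?case
  proof (cases w)
    case Nil then show ?thesis by (simp add: dyck.Nil)
  next
    case (Cons z zs)
    with less.prems have zs: "fred zs = [linv z]"
      by (auto split: list.splits if_splits simp: linv_def prod_eq_iff)
    from fred_Cons_split[OF this] obtain v w' where
      v: "zs = v @ linv z # w'" "dyck v" "fred w' = []" by auto
    with less.hyps[of w'] Cons show ?thesis by (auto intro: dyck.Cons)
  qed
qed

text \<open>Symmetric in \<open>i\<close> and \<open>j\<close>, because the ends of a chord come in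
  either order.\<close>

definition btw :: "nat \<Rightarrow> nat \<Rightarrow> nat \<Rightarrow> bool" where
  "btw i j k \<longleftrightarrow> (i < k \<and> k < j) \<or> (j < k \<and> k < i)"

definition matching :: "'s letter list \<Rightarrow> (nat \<Rightarrow> nat) \<Rightarrow> bool" where
  "matching w V \<longleftrightarrow>
     (\<forall>i<length w. V i < length w \<and> V (V i) = i \<and> w ! V i = linv (w ! i))"

definition noncrossing :: "nat \<Rightarrow> (nat \<Rightarrow> nat) \<Rightarrow> bool" where
  "noncrossing n V \<longleftrightarrow>
     (\<forall>i<n. \<forall>j<n. j \<noteq> i \<and> j \<noteq> V i \<longrightarrow> (btw i (V i) j \<longleftrightarrow> btw i (V i) (V j)))"

text \<open>The outer pair becomes the arc from position \<open>0\<close> to \<open>Suc a\<close>;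
  the matchings of the two parts are shifted to its inside and behind it, so arcs of different parts
  are nested or disjoint.\<close>

lemma dyck_imp_matching: "dyck w \<Longrightarrow> \<exists>V. matching w V \<and> noncrossing (length w) V"
proof (induction rule: dyck.induct)
  case Nil
  show ?case by (auto simp: matching_def noncrossing_def)
next
  case (Cons v w x)
  then obtain V1 V2 where 1: "matching v V1" "noncrossing (length v) V1"
    and 2: "matching w V2" "noncrossing (length w) V2" by blast
  define a where "a = length v"
  define V where "V i = (if i = 0 then Suc a else if i \<le> a then Suc (V1 (i - 1))
     else if i = Suc a then 0 else a + 2 + V2 (i - (a + 2)))" for i
  let ?W = "x # v @ linv x # w"
  have cases_i: "i = 0 \<or> (\<exists>j<a. i = Suc j) \<or> i = Suc a \<or> (\<exists>j<length w. i = a + 2 + j)"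
    if "i < length ?W" for i
  proof -
    have "i = 0 \<or> i - 1 < a \<and> i = Suc (i - 1) \<or> i = Suc a \<or> i - (a + 2) < length w \<and> i = a + 2 + (i - (a + 2))"
      using that by (auto simp: a_def)
    then show ?thesis by blast
  qed
  have V1: "V1 j < a" "V1 (V1 j) = j" "v ! V1 j = linv (v ! j)" if "j < a" for j
    using 1(1) that by (auto simp: matching_def a_def)
  have V2: "V2 j < length w" "V2 (V2 j) = j" "w ! V2 j = linv (w ! j)" if "j < length w" for j
    using 2(1) that by (auto simp: matching_def a_def)
  have Vs: "V 0 = Suc a" "V (Suc a) = 0" "V (Suc j) = Suc (V1 j)" if "j < a" for j
    using that by (auto simp: V_def)
  have V0: "V 0 = Suc a" "V (Suc a) = 0" "V (a + 2 + j) = a + 2 + V2 j" for j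
    by (auto simp: V_def)
  have W: "?W ! 0 = x" "?W ! Suc a = linv x" "?W ! (a + 2 + j) = w ! j" for j
    by (auto simp: a_def nth_append)
  have W1: "?W ! Suc j = v ! j" if "j < a" for j
    using that by (auto simp: a_def nth_append)
  have len: "length ?W = a + 2 + length w" by (simp add: a_def)
  have "matching ?W V"
    unfolding matching_def
  proof (intro allI impI)
    fix i assume i: "i < length ?W"
    show "V i < length ?W \<and> V (V i) = i \<and> ?W ! V i = linv (?W ! i)"
      using cases_i[OF i]
    proof (elim disjE exE conjE)
      assume "i = 0" then show ?thesis using V0 W by (simp add: a_def)
    next
      fix j assume "j < a" "i = Suc j" then show ?thesis
        using V1[of j] W1[of j] W1[of "V1 j"] Vs(3)[of j] Vs(3)[of "V1 j"] by (auto simp: a_def)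
    next
      assume "i = Suc a" then show ?thesis using V0 W by (simp add: a_def)
    next
      fix j assume "j < length w" "i = a + 2 + j" then show ?thesis
        using V2[of j] W(3)[of j] W(3)[of "V2 j"] V0(3)[of j] V0(3)[of "V2 j"] by (auto simp: a_def)
    qed
  qed
  moreover have "noncrossing (length ?W) V"
    unfolding noncrossing_def
  proof (intro allI impI, elim conjE)
    fix i j assume i: "i < length ?W" and j: "j < length ?W" and ij: "j \<noteq> i" "j \<noteq> V i"
    have nc1: "btw i (V1 i) j \<longleftrightarrow> btw i (V1 i) (V1 j)" if "i < a" "j < a" "j \<noteq> i" "j \<noteq> V1 i" for i j
      using 1(2) that by (auto simp: noncrossing_def a_def)
    have nc2: "btw i (V2 i) j \<longleftrightarrow> btw i (V2 i) (V2 j)" if "i < length w" "j < length w" "j \<noteq> i" "j \<noteq> V2 i" for i j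
      using 2(2) that by (auto simp: noncrossing_def a_def)
    consider (inner) i' j' where "i' < a" "i = Suc i'" "j' < a" "j = Suc j'"
      | (outer) i' j' where "i' < length w" "i = a + 2 + i'" "j' < length w" "j = a + 2 + j'"
      | (inner_outer) i' where "i' < a" "i = Suc i'" "j = 0 \<or> j > a"
      | (outer_inner) i' where "i' < length w" "i = a + 2 + i'" "j < a + 2"
      | (ends) "i = 0 \<or> i = Suc a"
      using cases_i[OF i] cases_i[OF j] by fastforce
    then show "btw i (V i) j \<longleftrightarrow> btw i (V i) (V j)"
    proof cases
      case inner
      then show ?thesis using nc1[of i' j'] ij Vs(3) by (auto simp: btw_def)
    next
      case outer
      then show ?thesis using nc2[of i' j'] ij V0(3) by (auto simp: btw_def)
    next
      case inner_outer
      then have "V i \<le> a" "V j = 0 \<or> V j > a"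
        using Vs(3) V1(1)[of i'] V0 by (auto simp: V_def)
      with inner_outer show ?thesis by (auto simp: btw_def)
    next
      case outer_inner
      have "V i \<ge> a + 2" using outer_inner V0(3) by simp
      moreover have "V (Suc k) < a + 2" if "k < a" for k using Vs(3)[OF that] V1(1)[OF that] by simp
      then have "V j < a + 2" using cases_i[OF j] outer_inner(3) V0 by auto
      ultimately show ?thesis using outer_inner by (auto simp: btw_def)
    next
      case ends
      then have "{i, V i} = {0, Suc a}" using V0 by auto
      then have b: "btw i (V i) k \<longleftrightarrow> 0 < k \<and> k < Suc a" for k
        using ends V0 by (auto simp: btw_def doubleton_eq_iff)
      from cases_i[OF j] ij ends V0 have "(\<exists>j'<a. j = Suc j') \<or> j \<ge> a + 2" by auto
      then show ?thesis unfolding b using Vs(3) V1(1) by (auto simp: V_def)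
    qed
  qed
  ultimately show ?case by blast
qed

section \<open>The matching of the upper hemisphere\<close>

definition block_size :: "'s \<times> 's \<times> 's letter list \<Rightarrow> nat" where
  "block_size e = 2 * length (snd (snd e)) + 4"

text \<open>Inside a factor the letters of the two conjugating words are joined to their mirror images, and in the
  commutator the first letter is joined to the third and the second to the fourth; the latter two arcs
  produce the only crossing.\<close>

definition block_match :: "nat \<Rightarrow> nat \<Rightarrow> nat" where
  "block_match l x =
     (if x = l \<or> x = l + 1 then x + 2 else if x = l + 2 \<or> x = l + 3 then x - 2 else 2 * l + 3 - x)"

definition core :: "nat \<Rightarrow> nat \<Rightarrow> bool" where
  "core l x \<longleftrightarrow> l \<le> x \<and> x \<le> l + 3"

lemma length_comm_word [simp]: "length (comm_word e) = block_size e"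
  by (cases e) (simp add: block_size_def)

lemma block_match_less: "x < 2 * l + 4 \<Longrightarrow> block_match l x < 2 * l + 4"
  by (auto simp: block_match_def)

lemma block_match_invol: "x < 2 * l + 4 \<Longrightarrow> block_match l (block_match l x) = x"
  by (auto simp: block_match_def)

lemma core_block_match: "x < 2 * l + 4 \<Longrightarrow> core l (block_match l x) \<longleftrightarrow> core l x"
  by (auto simp: block_match_def core_def)

text \<open>The core is an interval that the matching maps to itself, and all other arcs are nested
  around it; only two letters of the core can interleave.\<close>

lemma block_match_noncrossing:
  assumes "x < 2 * l + 4" "y < 2 * l + 4" "y \<noteq> x" "y \<noteq> block_match l x" "\<not> (core l x \<and> core l y)"
  shows "btw x (block_match l x) y \<longleftrightarrow> btw x (block_match l x) (block_match l y)"
proof (cases "core l x")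
  case True
  then have "\<not> core l y" "core l (block_match l x)" "\<not> core l (block_match l y)"
    using assms core_block_match by auto
  moreover have "block_match l y = 2 * l + 3 - y"
    using \<open>\<not> core l y\<close> by (auto simp: block_match_def core_def)
  ultimately show ?thesis using True assms(1,2) unfolding core_def btw_def by linarith
next
  case False
  then have bx: "block_match l x = 2 * l + 3 - x" by (auto simp: block_match_def core_def)
  show ?thesis
  proof (cases "core l y")
    case True
    then have "core l (block_match l y)" using assms core_block_match by auto
    then show ?thesis using True False assms(1,2) unfolding core_def btw_def bx by linarith
  next
    case no: False
    then have "block_match l y = 2 * l + 3 - y" by (auto simp: block_match_def core_def)
    then show ?thesis using no False assms(1-4) unfolding core_def btw_def bx by linarith
  qed
qed

lemma comm_word_core:
  assumes "l = length u"
  shows "comm_word (a, b, u) ! l = (a, False)" "comm_word (a, b, u) ! (l + 1) = (b, False)"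
    "comm_word (a, b, u) ! (l + 2) = (a, True)" "comm_word (a, b, u) ! (l + 3) = (b, True)"
  by (simp_all add: assms nth_append)

lemma comm_word_outer:
  assumes "x < length u"
  shows "comm_word (a, b, u) ! x = winv u ! x"
    "comm_word (a, b, u) ! (2 * length u + 3 - x) = linv (winv u ! x)"
proof -
  show "comm_word (a, b, u) ! x = winv u ! x" using assms by (simp add: nth_append)
  \<comment> \<open>The copy of \<open>u\<close> starts at position \<open>length u + 4\<close>; in
    it the mirror image of \<open>x\<close> is letter \<open>length u - Suc x\<close>, the one whose
    inverse is letter \<open>x\<close> of \<open>winv u\<close>.\<close>
  have *: "2 * length u + 3 - x - length u - 4 = length u - Suc x" using assms by simp
  show "comm_word (a, b, u) ! (2 * length u + 3 - x) = linv (winv u ! x)"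
    using assms * by (auto simp: nth_append winv_eq rev_nth nth_Cons' Suc_diff_le split: nat.splits)
qed

lemma comm_word_block_match:
  assumes "e = (a, b, u)" "l = length u" "x < 2 * l + 4"
  shows "comm_word e ! block_match l x = linv (comm_word e ! x)"
proof -
  consider "x < l" | "x = l" | "x = l + 1" | "x = l + 2" | "x = l + 3" | y where "y < l" "x = 2 * l + 3 - y"
  proof (cases "x \<le> l + 3")
    case False
    then have "2 * l + 3 - x < l" "x = 2 * l + 3 - (2 * l + 3 - x)" using assms(3) by auto
    then show ?thesis using that(6) by blast
  qed (use that in linarith)
  then show ?thesis
  proof cases
    case 6
    then have "block_match l x = y" by (auto simp: block_match_def)
    then show ?thesis using 6 comm_word_outer[of y u a b] assms by simp
  next
    case 1
    then show ?thesis using comm_word_outer[of x u a b] assms by (simp add: block_match_def)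
  qed (use comm_word_core[OF assms(2), of a b] assms in
      \<open>simp_all add: block_match_def linv_def eval_nat_numeral del: comm_word.simps\<close>)
qed

definition block_start :: "('s \<times> 's \<times> 's letter list) list \<Rightarrow> nat \<Rightarrow> nat" where
  "block_start E k = length (concat (map comm_word (take k E)))"

lemma block_start_Suc: "k < length E \<Longrightarrow> block_start E (Suc k) = block_start E k + block_size (E ! k)"
  by (simp add: block_start_def take_Suc_conv_app_nth)

lemma block_start_length: "block_start E (length E) = length (concat (map comm_word E))"
  by (simp add: block_start_def)

lemma block_start_mono: "j \<le> k \<Longrightarrow> block_start E j \<le> block_start E k"
proof -
  assume "j \<le> k"
  then have "take k E = take j E @ take (k - j) (drop j E)"
    by (metis le_add_diff_inverse take_add)
  then show ?thesis by (simp add: block_start_def)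
qed

lemma block_before:
  assumes "j < k" "k \<le> length E"
  shows "block_start E j + block_size (E ! j) \<le> block_start E k"
  using block_start_mono[of "Suc j" k E] block_start_Suc[of j E] assms by simp

lemma block_pos_less:
  assumes "k < length E" "x < block_size (E ! k)"
  shows "block_start E k + x < length (concat (map comm_word E))"
  using block_before[of k "length E" E] assms by (simp add: block_start_length)

lemma concat_comm_word_nth:
  assumes "k < length E" "x < block_size (E ! k)"
  shows "concat (map comm_word E) ! (block_start E k + x) = comm_word (E ! k) ! x"
proof -
  have "E = take k E @ E ! k # drop (Suc k) E" using assms(1) by (simp add: id_take_nth_drop)
  then have "concat (map comm_word E) = concat (map comm_word (take k E)) @ comm_word (E ! k) @
      concat (map comm_word (drop (Suc k) E))"
    by (metis concat.simps(2) concat_append list.simps(9) map_append)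
  then show ?thesis using assms by (simp add: block_start_def nth_append del: length_concat)
qed

lemma block_pos_exhaust:
  assumes "i < length (concat (map comm_word E))"
  obtains k x where "k < length E" "x < block_size (E ! k)" "i = block_start E k + x"
proof -
  define k where "k = (LEAST k. i < block_start E (Suc k))"
  have ne: "E \<noteq> []" using assms by auto
  have ex: "i < block_start E (Suc (length E - 1))" using assms ne by (simp add: block_start_length)
  have 1: "i < block_start E (Suc k)" unfolding k_def by (rule LeastI) (rule ex)
  have "k \<le> length E - 1" unfolding k_def by (rule Least_le) (rule ex)
  then have k: "k < length E" using ne by (cases E) auto
  have "block_start E k \<le> i"
  proof (cases k)
    case 0 then show ?thesis by (simp add: block_start_def)
  next
    case (Suc k')
    then have "\<not> i < block_start E (Suc k')" unfolding k_def using not_less_Least by (metis lessI)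
    then show ?thesis using Suc by simp
  qed
  then show thesis using that[of k "i - block_start E k"] k 1 block_start_Suc[OF k] by simp
qed

lemma block_pos_unique:
  assumes "k < length E" "x < block_size (E ! k)" "k' < length E" "x' < block_size (E ! k')"
    and "block_start E k + x = block_start E k' + x'"
  shows "k = k'" "x = x'"
proof -
  show "k = k'"
    using block_before[of k k' E] block_before[of k' k E] assms by (cases k k' rule: linorder_cases) auto
  then show "x = x'" using assms by simp
qed

definition upper_match :: "('s \<times> 's \<times> 's letter list) list \<Rightarrow> nat \<Rightarrow> nat" where
  "upper_match E i = (let k = (THE k. k < length E \<and> block_start E k \<le> i \<and> i < block_start E k + block_size (E ! k))
     in block_start E k + block_match (length (snd (snd (E ! k)))) (i - block_start E k))"

lemma upper_match_eq:
  assumes "k < length E" "x < block_size (E ! k)"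
  shows "upper_match E (block_start E k + x) = block_start E k + block_match (length (snd (snd (E ! k)))) x"
proof -
  let ?i = "block_start E k + x"
  have "(THE k. k < length E \<and> block_start E k \<le> ?i \<and> ?i < block_start E k + block_size (E ! k)) = k"
  proof (rule the_equality)
    fix k' assume k': "k' < length E \<and> block_start E k' \<le> ?i \<and> ?i < block_start E k' + block_size (E ! k')"
    then show "k' = k"
      using block_pos_unique(1)[of k' E "?i - block_start E k'" k x] assms by auto
  qed (use assms in auto)
  then show ?thesis by (simp add: upper_match_def)
qed

lemma upper_matching: "matching (concat (map comm_word E)) (upper_match E)"
  unfolding matching_def
proof (intro allI impI)
  fix i assume "i < length (concat (map comm_word E))"
  then obtain k x where k: "k < length E" "x < block_size (E ! k)" and i: "i = block_start E k + x"
    by (rule block_pos_exhaust)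
  let ?l = "length (snd (snd (E ! k)))"
  have x: "x < 2 * ?l + 4" using k(2) by (simp add: block_size_def)
  then have y: "block_match ?l x < block_size (E ! k)"
    using block_match_less by (simp add: block_size_def)
  show "upper_match E i < length (concat (map comm_word E)) \<and> upper_match E (upper_match E i) = i \<and>
      concat (map comm_word E) ! upper_match E i = linv (concat (map comm_word E) ! i)"
    using block_pos_less[OF k(1) y] upper_match_eq[OF k] upper_match_eq[OF k(1) y]
      block_match_invol[OF x] concat_comm_word_nth[OF k] concat_comm_word_nth[OF k(1) y]
      comm_word_block_match[of "E ! k" "fst (E ! k)" "fst (snd (E ! k))" "snd (snd (E ! k))" ?l x] x i
    by simp
qed

text \<open>The positions of the four letters of the commutator in the \<open>k\<close>-th factor, as opposed to those of the
  conjugating words.\<close>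

definition core_pos :: "('s \<times> 's \<times> 's letter list) list \<Rightarrow> nat \<Rightarrow> nat \<Rightarrow> bool" where
  "core_pos E k i \<longleftrightarrow> k < length E \<and> block_start E k + length (snd (snd (E ! k))) \<le> i
     \<and> i \<le> block_start E k + length (snd (snd (E ! k))) + 3"

lemma btw_add [simp]: "btw (s + x) (s + y) (s + z) \<longleftrightarrow> btw x y z"
  by (auto simp: btw_def)

text \<open>Arcs of different factors occupy disjoint intervals, and inside one factor the claim is
  that for \<open>block_match\<close>. The exception is exactly where a crossing is wanted.\<close>

lemma upper_match_noncrossing:
  assumes n: "n = length (concat (map comm_word E))" and "i < n" "j < n"
    and ij: "j \<noteq> i" "j \<noteq> upper_match E i"
    and nc: "\<not> (\<exists>k. core_pos E k i \<and> core_pos E k j)"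
  shows "btw i (upper_match E i) j \<longleftrightarrow> btw i (upper_match E i) (upper_match E j)"
proof -
  obtain k x where k: "k < length E" "x < block_size (E ! k)" and i: "i = block_start E k + x"
    using \<open>i < n\<close> unfolding n by (rule block_pos_exhaust)
  obtain k' x' where k': "k' < length E" "x' < block_size (E ! k')" and j: "j = block_start E k' + x'"
    using \<open>j < n\<close> unfolding n by (rule block_pos_exhaust)
  let ?l = "length (snd (snd (E ! k)))" and ?l' = "length (snd (snd (E ! k')))"
  have x: "x < 2 * ?l + 4" "x' < 2 * ?l' + 4" using k(2) k'(2) by (simp_all add: block_size_def)
  have U: "upper_match E i = block_start E k + block_match ?l x"
    "upper_match E j = block_start E k' + block_match ?l' x'"
    using upper_match_eq[OF k] upper_match_eq[OF k'] i j by auto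
  have m: "block_match ?l x < 2 * ?l + 4" "block_match ?l' x' < 2 * ?l' + 4"
    using x block_match_less by auto
  show ?thesis
  proof (cases "k = k'")
    case True
    have "\<not> (core ?l x \<and> core ?l x')"
    proof
      assume "core ?l x \<and> core ?l x'"
      then have "core_pos E k i \<and> core_pos E k j"
        using k(1) i j True by (auto simp: core_pos_def core_def)
      with nc show False by blast
    qed
    moreover have "x' \<noteq> x" "x' \<noteq> block_match ?l x" using ij U i j True by auto
    ultimately have "btw x (block_match ?l x) x' \<longleftrightarrow> btw x (block_match ?l x) (block_match ?l x')"
      using block_match_noncrossing[of x ?l x'] x True by blast
    then show ?thesis using i j U True by simp
  next
    case False
    then have "block_start E k + (2 * ?l + 4) \<le> block_start E k' \<or> block_start E k' + (2 * ?l' + 4) \<le> block_start E k"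
      using block_before[of k k' E] block_before[of k' k E] k k' unfolding block_size_def
      by (cases k k' rule: linorder_cases) auto
    then show ?thesis using x m i j U unfolding btw_def by linarith
  qed
qed

section \<open>Closing up smooth arcs along a permutation\<close>

lemma has_vector_derivative_glue:
  fixes f :: "real \<Rightarrow> 'a::real_normed_vector"
  assumes "(h1 has_vector_derivative d) (at s)" "(h2 has_vector_derivative d) (at s)"
    and f1: "\<And>t. s - 1 < t \<Longrightarrow> t \<le> s \<Longrightarrow> f t = h1 t"
    and f2: "\<And>t. s \<le> t \<Longrightarrow> t < s + 1 \<Longrightarrow> f t = h2 t"
  shows "(f has_vector_derivative d) (at s)"
proof -
  have "(f has_vector_derivative d) (at s within {..s})"
    by (rule has_vector_derivative_transform_within[OF has_vector_derivative_at_within[OF assms(1)], of 1])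
      (auto simp: f1 dist_real_def)
  moreover have "(f has_vector_derivative d) (at s within {s..})"
    by (rule has_vector_derivative_transform_within[OF has_vector_derivative_at_within[OF assms(2)], of 1])
      (auto simp: f2 dist_real_def)
  moreover have "at s = sup (at s within {..s}) (at s within {s..})"
    unfolding at_within_union[symmetric] by (rule arg_cong[where f = "at_within s"]) auto
  ultimately show ?thesis
    unfolding has_vector_derivative_def has_derivative_within by (auto intro: filterlim_sup)
qed

lemma isCont_glue:
  fixes f :: "real \<Rightarrow> 'a::real_normed_vector"
  assumes "isCont h1 s" "isCont h2 s"
    and f1: "\<And>t. s - 1 < t \<Longrightarrow> t \<le> s \<Longrightarrow> f t = h1 t"
    and f2: "\<And>t. s \<le> t \<Longrightarrow> t < s + 1 \<Longrightarrow> f t = h2 t"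
  shows "isCont f s"
proof -
  have "continuous (at s within {..s}) f"
    by (rule continuous_transform_within[OF continuous_at_imp_continuous_at_within[OF assms(1)], of 1])
      (auto simp: f1 dist_real_def)
  moreover have "continuous (at s within {s..}) f"
    by (rule continuous_transform_within[OF continuous_at_imp_continuous_at_within[OF assms(2)], of 1])
      (auto simp: f2 dist_real_def)
  moreover have "at s = sup (at s within {..s}) (at s within {s..})"
    unfolding at_within_union[symmetric] by (rule arg_cong[where f = "at_within s"]) auto
  ultimately show ?thesis
    unfolding continuous_within by (auto intro: filterlim_sup)
qed

text \<open>Each piece is differentiable on the whole line, so at an integer both one-sided
  derivatives are restrictions of ordinary ones, and \<open>glue\<close> makes them equal.\<close>

lemma floor_glue_has_vector_derivative:
  fixes g :: "int \<Rightarrow> real \<Rightarrow> 'a::real_normed_vector"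
  assumes g: "\<And>k t. (g k has_vector_derivative g' k t) (at t)"
    and glue: "\<And>k. g k 1 = g (k + 1) 0" "\<And>k. g' k 1 = g' (k + 1) 0"
  shows "((\<lambda>s. g \<lfloor>s\<rfloor> (frac s)) has_vector_derivative g' \<lfloor>s\<rfloor> (frac s)) (at s)"
proof -
  have shift: "((\<lambda>t. g k (t - of_int k)) has_vector_derivative g' k (t - of_int k)) (at t)" for k t
  proof -
    have "((\<lambda>t. t - of_int k) has_vector_derivative 1) (at t)"
      by (auto intro!: derivative_eq_intros simp: has_real_derivative_iff_has_vector_derivative[symmetric])
    from vector_diff_chain_at[OF this g] show ?thesis by (simp add: o_def)
  qed
  have eq: "g \<lfloor>t\<rfloor> (frac t) = g k (t - of_int k)" if "of_int k \<le> t" "t < of_int k + 1" for k t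
  proof -
    have "\<lfloor>t\<rfloor> = k" using that by linarith
    then show ?thesis by (simp add: frac_def)
  qed
  \<comment> \<open>By \<open>glue\<close> the formula of piece \<open>k\<close> remains valid at
    its right end, where the floor has already jumped.\<close>
  have eq': "g \<lfloor>t\<rfloor> (frac t) = g k (t - of_int k)" if "of_int k \<le> t" "t \<le> of_int k + 1" for k t
    using eq[of k t] eq[of "k + 1" t] that glue by (cases "t = of_int k + 1") auto
  show ?thesis
  proof (cases "frac s = 0")
    case True
    define k where "k = \<lfloor>s\<rfloor>"
    have s: "s = of_int k" using True by (simp add: frac_def k_def)
    show ?thesis
    proof (rule has_vector_derivative_glue)
      show "((\<lambda>t. g (k - 1) (t - of_int (k - 1))) has_vector_derivative g' \<lfloor>s\<rfloor> (frac s)) (at s)"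
        using shift[of "k - 1" s] glue(2)[of "k - 1"] by (simp add: s)
      show "((\<lambda>t. g k (t - of_int k)) has_vector_derivative g' \<lfloor>s\<rfloor> (frac s)) (at s)"
        using shift[of k s] by (simp add: s)
      show "g \<lfloor>t\<rfloor> (frac t) = g (k - 1) (t - of_int (k - 1))" if "s - 1 < t" "t \<le> s" for t
        using eq'[of "k - 1" t] that s by simp
      show "g \<lfloor>t\<rfloor> (frac t) = g k (t - of_int k)" if "s \<le> t" "t < s + 1" for t
        using eq[of k t] that s by simp
    qed
  next
    case False
    define k where "k = \<lfloor>s\<rfloor>"
    have "s \<in> {of_int k<..<of_int k + 1}" using False floor_correct[of s]
      by (auto simp: frac_def k_def less_le)
    then show ?thesis
      using has_vector_derivative_transform_within_open[OF shift[of k s], of "{of_int k<..<of_int k + 1}"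
          "\<lambda>s. g \<lfloor>s\<rfloor> (frac s)"] eq[of k, symmetric]
      by (simp add: frac_def k_def)
  qed
qed

lemma floor_glue_isCont:
  fixes g :: "int \<Rightarrow> real \<Rightarrow> 'a::real_normed_vector"
  assumes g: "\<And>k t. isCont (g k) t"
    and glue: "\<And>k. g k 1 = g (k + 1) 0"
  shows "isCont (\<lambda>s. g \<lfloor>s\<rfloor> (frac s)) s"
proof -
  have shift: "isCont (\<lambda>t. g k (t - of_int k)) t" for k t
    using isCont_o2[where f = "\<lambda>t. t - of_int k" and a = t and g = "g k"] g by simp
  have eq: "g \<lfloor>t\<rfloor> (frac t) = g k (t - of_int k)" if "of_int k \<le> t" "t < of_int k + 1" for k t
  proof -
    have "\<lfloor>t\<rfloor> = k" using that by linarith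
    then show ?thesis by (simp add: frac_def)
  qed
  have eq': "g \<lfloor>t\<rfloor> (frac t) = g k (t - of_int k)" if "of_int k \<le> t" "t \<le> of_int k + 1" for k t
    using eq[of k t] eq[of "k + 1" t] that glue by (cases "t = of_int k + 1") auto
  define k where "k = \<lfloor>s\<rfloor>"
  show ?thesis
  proof (cases "frac s = 0")
    case True
    have s: "s = of_int k" using True by (simp add: frac_def k_def)
    show ?thesis
    proof (rule isCont_glue)
      show "isCont (\<lambda>t. g (k - 1) (t - of_int (k - 1))) s" "isCont (\<lambda>t. g k (t - of_int k)) s"
        by (rule shift)+
      show "g \<lfloor>t\<rfloor> (frac t) = g (k - 1) (t - of_int (k - 1))" if "s - 1 < t" "t \<le> s" for t
        using eq'[of "k - 1" t] that s by simp
      show "g \<lfloor>t\<rfloor> (frac t) = g k (t - of_int k)" if "s \<le> t" "t < s + 1" for t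
        using eq[of k t] that s by simp
    qed
  next
    case False
    have s: "s \<in> {of_int k<..<of_int k + 1}" using False floor_correct[of s]
      by (auto simp: frac_def k_def less_le)
    show ?thesis
    proof -
      have "eventually (\<lambda>t. t \<in> {of_int k<..<of_int k + 1}) (nhds s)"
        using s by (intro eventually_nhds_in_open) auto
      then have "eventually (\<lambda>t. g \<lfloor>t\<rfloor> (frac t) = g k (t - of_int k)) (nhds s)"
        by eventually_elim (auto intro: eq)
      from isCont_cong[OF this] show ?thesis using shift[where k = k and t = s] by simp
    qed
  qed
qed

text \<open>Components arise by following the arcs \<open>A j\<close> along the cycles of
  \<open>nx\<close>. The arcs are extended to all real \<open>t\<close> for the sake of gluing, but
  their velocity need be nonzero only on the part that is used.\<close>

locale closed_curves =
  fixes n :: nat and nx :: "nat \<Rightarrow> nat"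
    and A A' :: "nat \<Rightarrow> real \<Rightarrow> real^3" and lab :: "nat \<Rightarrow> 's" and S :: "'s set"
  assumes nx: "bij_betw nx {..<n} {..<n}"
    and A: "\<And>j t. j < n \<Longrightarrow> (A j has_vector_derivative A' j t) (at t)"
    and A'_cont: "\<And>j t. j < n \<Longrightarrow> isCont (A' j) t"
    and A'_nz: "\<And>j t. j < n \<Longrightarrow> 0 \<le> t \<Longrightarrow> t \<le> 1 \<Longrightarrow> A' j t \<noteq> 0"
    and A_S2: "\<And>j t. j < n \<Longrightarrow> A j t \<in> S2"
    and glue: "\<And>j. j < n \<Longrightarrow> A j 1 = A (nx j) 0" "\<And>j. j < n \<Longrightarrow> A' j 1 = A' (nx j) 0"
    and lab: "\<And>j. j < n \<Longrightarrow> lab j \<in> S" "\<And>j. j < n \<Longrightarrow> lab (nx j) = lab j"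
begin

definition period :: "nat \<Rightarrow> nat" where
  "period c = (LEAST p. p > 0 \<and> (nx ^^ p) c = c)"

text \<open>Each cycle of \<open>nx\<close>, hence each component, is represented by its least
  element.\<close>

definition reps :: "nat set" where
  "reps = {c. c < n \<and> (\<forall>k. c \<le> (nx ^^ k) c)}"

text \<open>The index is an integer because a component is defined on the whole real line, where the
  floor of the parameter may be negative.\<close>

definition idx :: "nat \<Rightarrow> int \<Rightarrow> nat" where
  "idx c k = (nx ^^ nat (k mod int (period c))) c"

definition curve :: "nat \<Rightarrow> real \<Rightarrow> real^3" where
  "curve c t = A (idx c \<lfloor>real (period c) * t\<rfloor>) (frac (real (period c) * t))"

definition curves :: "'s diagram" where
  "curves = map (\<lambda>c. (lab c, curve c)) (sorted_list_of_set reps)"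

text \<open>The change of coordinates from parameters of components to parameters of arcs; through
  it all later computations take place on arcs.\<close>

definition loc :: "nat \<times> real \<Rightarrow> nat \<times> real" where
  "loc it = (let c = sorted_list_of_set reps ! fst it; s = real (period c) * snd it
     in (idx c \<lfloor>s\<rfloor>, frac s))"

lemma nx_less [simp]: "j < n \<Longrightarrow> nx j < n"
  using nx by (auto simp: bij_betw_def)

lemma nx_pow_less [simp]: "j < n \<Longrightarrow> (nx ^^ k) j < n"
  by (induction k) auto

lemma nx_pow_inj: "i < n \<Longrightarrow> j < n \<Longrightarrow> (nx ^^ k) i = (nx ^^ k) j \<Longrightarrow> i = j"
proof (induction k)
  case (Suc k)
  then have "(nx ^^ k) i = (nx ^^ k) j"
    using inj_onD[OF bij_betw_imp_inj_on[OF nx], of "(nx ^^ k) i" "(nx ^^ k) j"] by simp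
  with Suc show ?case by blast
qed auto

text \<open>Two of the first \<open>n + 1\<close> iterates coincide by the pigeonhole principle, and
  injectivity cancels their common part.\<close>

lemma period_ex:
  assumes "c < n"
  shows "\<exists>p>0. (nx ^^ p) c = c"
proof -
  have "\<not> inj_on (\<lambda>k. (nx ^^ k) c) {..n}"
  proof
    assume "inj_on (\<lambda>k. (nx ^^ k) c) {..n}"
    moreover have "(\<lambda>k. (nx ^^ k) c) ` {..n} \<subseteq> {..<n}" using assms by auto
    ultimately have "card {..n} \<le> card {..<n}" by (intro card_inj_on_le) auto
    then show False by simp
  qed
  then obtain a b where "a < b" "(nx ^^ a) c = (nx ^^ b) c"
    unfolding inj_on_def by (metis linorder_neqE_nat)
  then have "(nx ^^ a) ((nx ^^ (b - a)) c) = (nx ^^ a) c"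
    by (metis add_diff_inverse_nat comp_apply funpow_add not_less_iff_gr_or_eq)
  then have "(nx ^^ (b - a)) c = c" using nx_pow_inj[of "(nx ^^ (b - a)) c" c a] assms by simp
  then show ?thesis using \<open>a < b\<close> by (intro exI[of _ "b - a"]) auto
qed

lemma period: "c < n \<Longrightarrow> period c > 0" "c < n \<Longrightarrow> (nx ^^ period c) c = c"
proof -
  assume "c < n"
  from LeastI_ex[OF period_ex[OF this]] show "period c > 0" "(nx ^^ period c) c = c"
    unfolding period_def by simp_all
qed

lemma period_min: "0 < p \<Longrightarrow> p < period c \<Longrightarrow> (nx ^^ p) c \<noteq> c"
  unfolding period_def using not_less_Least by blast

lemma nx_pow_mod:
  assumes "c < n"
  shows "(nx ^^ k) c = (nx ^^ (k mod period c)) c"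
proof -
  have "(nx ^^ (period c * q)) c = c" for q
    by (induction q) (use period(2)[OF assms] in \<open>auto simp: funpow_add\<close>)
  moreover have "(nx ^^ k) c = (nx ^^ (k mod period c)) ((nx ^^ (period c * (k div period c))) c)"
    by (metis comp_apply funpow_add mod_mult_div_eq)
  ultimately show ?thesis by simp
qed

lemma nx_pow_back:
  assumes "c < n" "j = (nx ^^ k) c"
  shows "\<exists>k'. c = (nx ^^ k') j"
proof -
  \<comment> \<open>The exponent \<open>k * period c\<close> is a multiple of the period and at
    least \<open>k\<close>, so the missing iterations lead back to \<open>c\<close>.\<close>
  have "(nx ^^ (k * period c - k)) j = (nx ^^ (k * period c)) c"
  proof -
    have "k \<le> k * period c" using period(1)[OF assms(1)] by simp
    then show ?thesis unfolding assms(2) by (metis comp_apply funpow_add le_add_diff_inverse2)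
  qed
  also have "\<dots> = c" using nx_pow_mod[OF assms(1), of "k * period c"] by simp
  finally show ?thesis by metis
qed

lemma idx_less [simp]: "c < n \<Longrightarrow> idx c k < n"
  by (simp add: idx_def)

lemma idx_Suc:
  assumes "c < n"
  shows "idx c (k + 1) = nx (idx c k)"
proof -
  let ?p = "int (period c)"
  have p: "?p > 0" using period(1)[OF assms] by simp
  have "int ((nat (k mod ?p) + 1) mod period c) = (k + 1) mod ?p"
    using p by (simp add: zmod_int mod_simps add.commute)
  then have m: "nat ((k + 1) mod ?p) = (nat (k mod ?p) + 1) mod period c" by linarith
  have "nx (idx c k) = (nx ^^ (nat (k mod ?p) + 1)) c" by (simp add: idx_def)
  then show ?thesis
    unfolding idx_def m using nx_pow_mod[OF assms, of "nat (k mod ?p) + 1"] by metis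
qed

lemma idx_shift: "idx c (k + int (period c)) = idx c k"
  by (simp add: idx_def)

lemma lab_pow: "c < n \<Longrightarrow> lab ((nx ^^ k) c) = lab c"
  by (induction k) (auto simp: lab)

lemma finite_reps: "finite reps"
  by (rule finite_subset[of _ "{..<n}"]) (auto simp: reps_def)

lemma curve_has_vector_derivative:
  assumes "c < n"
  shows "(curve c has_vector_derivative
     real (period c) *\<^sub>R A' (idx c \<lfloor>real (period c) * t\<rfloor>) (frac (real (period c) * t))) (at t)"
proof -
  let ?p = "real (period c)"
  have 1: "((\<lambda>s. A (idx c \<lfloor>s\<rfloor>) (frac s)) has_vector_derivative A' (idx c \<lfloor>s\<rfloor>) (frac s)) (at s)" for s
    by (rule floor_glue_has_vector_derivative[where g = "\<lambda>k. A (idx c k)" and g' = "\<lambda>k. A' (idx c k)"])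
      (use assms A glue in \<open>auto simp: idx_Suc\<close>)
  have 2: "((\<lambda>t. ?p * t) has_vector_derivative ?p) (at t)"
    unfolding has_real_derivative_iff_has_vector_derivative[symmetric]
    by (auto intro!: derivative_eq_intros)
  show ?thesis using vector_diff_chain_at[OF 2 1] unfolding curve_def o_def .
qed

lemma immersed_circle_curve:
  assumes "c < n"
  shows "immersed_circle (curve c)"
proof -
  let ?p = "real (period c)"
  have v: "vector_derivative (curve c) (at t) = ?p *\<^sub>R A' (idx c \<lfloor>?p * t\<rfloor>) (frac (?p * t))" for t
    using curve_has_vector_derivative[OF assms] by (rule vector_derivative_at)
  have "curve c (t + 1) = curve c t" for t
  proof -
    have p: "?p * (t + 1) = ?p * t + of_int (int (period c))" by (simp add: algebra_simps)
    have f: "\<lfloor>?p * (t + 1)\<rfloor> = \<lfloor>?p * t\<rfloor> + int (period c)" unfolding p by linarith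
    then have "frac (?p * (t + 1)) = frac (?p * t)" unfolding frac_def p by simp
    then show ?thesis unfolding curve_def f by (simp only: idx_shift)
  qed
  moreover have "curve c t \<in> S2" for t unfolding curve_def using A_S2 assms by simp
  moreover have "curve c differentiable (at t)" for t
    using curve_has_vector_derivative[OF assms] by (auto intro: differentiableI_vector)
  moreover have "continuous_on UNIV (\<lambda>t. vector_derivative (curve c) (at t))"
  proof -
    have "isCont (\<lambda>s. A' (idx c \<lfloor>s\<rfloor>) (frac s)) s" for s
      by (rule floor_glue_isCont[where g = "\<lambda>k. A' (idx c k)"])
        (use assms A'_cont glue in \<open>auto simp: idx_Suc\<close>)
    then have "isCont (\<lambda>t. A' (idx c \<lfloor>?p * t\<rfloor>) (frac (?p * t))) t" for t
      using isCont_o2[where f = "\<lambda>t. ?p * t" and a = t and g = "\<lambda>s. A' (idx c \<lfloor>s\<rfloor>) (frac s)"] by simp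
    then show ?thesis unfolding v by (auto intro!: continuous_at_imp_continuous_on continuous_intros)
  qed
  moreover have "vector_derivative (curve c) (at t) \<noteq> 0" for t
    unfolding v using A'_nz[OF idx_less[OF assms], of "frac (?p * t)"] period(1)[OF assms] frac_lt_1[of "?p * t"]
    by (simp add: less_imp_le)
  ultimately show ?thesis unfolding immersed_circle_def by blast
qed

lemma length_curves [simp]: "length curves = card reps"
  by (simp add: curves_def)

lemma rep_nth:
  assumes "i < card reps"
  shows "sorted_list_of_set reps ! i \<in> reps" "sorted_list_of_set reps ! i < n"
proof -
  show "sorted_list_of_set reps ! i \<in> reps"
    using assms finite_reps by (metis length_sorted_list_of_set nth_mem set_sorted_list_of_set)
  then show "sorted_list_of_set reps ! i < n" by (simp add: reps_def)
qed

lemma curves_component: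
  assumes "i < length curves"
  shows "fst (curves ! i) \<in> S" "immersed_circle (snd (curves ! i))"
proof -
  have "sorted_list_of_set reps ! i < n" using rep_nth assms by simp
  then show "fst (curves ! i) \<in> S" "immersed_circle (snd (curves ! i))"
    using assms immersed_circle_curve lab(1) by (simp_all add: curves_def)
qed

lemma curves_loc:
  assumes "i < length curves" "loc (i, t) = (j, \<tau>)"
  shows "snd (curves ! i) t = A j \<tau>" "fst (curves ! i) = lab j"
    "\<exists>c>0. comp_vel curves i t = c *\<^sub>R A' j \<tau>"
proof -
  let ?c = "sorted_list_of_set reps ! i"
  have c: "?c < n" using rep_nth assms by simp
  have eq: "curves ! i = (lab ?c, curve ?c)" using assms by (simp add: curves_def)
  have jt: "j = idx ?c \<lfloor>real (period ?c) * t\<rfloor>" "\<tau> = frac (real (period ?c) * t)"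
    using assms(2) by (auto simp: loc_def Let_def)
  show "snd (curves ! i) t = A j \<tau>" by (simp add: eq jt curve_def)
  show "fst (curves ! i) = lab j" by (simp add: eq jt idx_def lab_pow[OF c])
  show "\<exists>c>0. comp_vel curves i t = c *\<^sub>R A' j \<tau>"
    using vector_derivative_at[OF curve_has_vector_derivative[OF c, of t]] period(1)[OF c]
    by (auto simp: eq jt comp_vel_def intro!: exI[of _ "real (period ?c)"])
qed

lemma rep_exists:
  assumes "j < n"
  shows "\<exists>c\<in>reps. \<exists>k<period c. j = (nx ^^ k) c"
proof -
  let ?O = "range (\<lambda>k. (nx ^^ k) j)"
  define c where "c = (LEAST c. c \<in> ?O)"
  have "c \<in> ?O" unfolding c_def by (rule LeastI[of _ j]) (auto intro: range_eqI[of _ _ 0])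
  then obtain k where k: "c = (nx ^^ k) j" by auto
  have c: "c < n" using k assms by simp
  have "c \<le> (nx ^^ k') c" for k'
    unfolding c_def by (rule Least_le) (auto simp: k[unfolded c_def] funpow_add[symmetric, THEN fun_cong, unfolded o_def])
  then have "c \<in> reps" using c by (simp add: reps_def)
  moreover from nx_pow_back[OF assms k] obtain k' where "j = (nx ^^ k') c" by auto
  then have "j = (nx ^^ (k' mod period c)) c" using nx_pow_mod[OF c] by simp
  ultimately show ?thesis using period(1)[OF c] mod_less_divisor by blast
qed

lemma rep_unique:
  assumes "c \<in> reps" "c' \<in> reps" "(nx ^^ k) c = (nx ^^ k') c'"
  shows "c = c'"
proof -
  have *: "c \<le> c'" if "c \<in> reps" "c' \<in> reps" "(nx ^^ k) c = (nx ^^ k') c'" for c c' k k'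
  proof -
    have n: "c < n" "c' < n" using that by (auto simp: reps_def)
    obtain a where "c' = (nx ^^ a) ((nx ^^ k') c')" using nx_pow_back[OF n(2) refl] by blast
    then have "c' = (nx ^^ (a + k)) c" using that(3) by (simp add: funpow_add)
    then show ?thesis using that(1) unfolding reps_def by blast
  qed
  show ?thesis using *[OF assms] *[OF assms(2,1) assms(3)[symmetric]] by simp
qed

lemma power_unique:
  assumes "c < n" "k < period c" "k' < period c" "(nx ^^ k) c = (nx ^^ k') c"
  shows "k = k'"
proof -
  have *: "\<not> a < b" if "a < period c" "b < period c" "(nx ^^ a) c = (nx ^^ b) c" for a b
  proof
    assume "a < b"
    then have "(nx ^^ a) ((nx ^^ (b - a)) c) = (nx ^^ a) c"
      by (metis that(3) add_diff_inverse_nat comp_apply funpow_add not_less_iff_gr_or_eq)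
    then have "(nx ^^ (b - a)) c = c" using nx_pow_inj[of "(nx ^^ (b - a)) c" c a] assms(1) by simp
    then show False using period_min[of "b - a" c] that \<open>a < b\<close> by auto
  qed
  show ?thesis using *[of k k'] *[of k' k] assms by (metis linorder_neqE_nat)
qed

text \<open>A component runs through \<open>period c\<close> arcs in unit time, and every arc occurs
  in exactly one component, once per turn. Half-open intervals on both sides count each junction
  once.\<close>

lemma bij_loc:
  "bij_betw loc {(i, t). i < length curves \<and> 0 \<le> t \<and> t < 1} {(j, \<tau>). j < n \<and> 0 \<le> \<tau> \<and> \<tau> < 1}"
  unfolding bij_betw_def
proof
  let ?L = "sorted_list_of_set reps"
  have range: "nat (\<lfloor>real (period (?L ! i)) * t\<rfloor> mod int (period (?L ! i))) = nat \<lfloor>real (period (?L ! i)) * t\<rfloor>"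
      "\<lfloor>real (period (?L ! i)) * t\<rfloor> \<ge> 0" "nat \<lfloor>real (period (?L ! i)) * t\<rfloor> < period (?L ! i)"
    if "i < card reps" "0 \<le> t" "t < 1" for i t
  proof -
    let ?p = "period (?L ! i)"
    have p: "?p > 0" using period(1) rep_nth(2)[OF that(1)] by blast
    have "real ?p * t < real ?p" using that p by simp
    then have "\<lfloor>real ?p * t\<rfloor> < int ?p" by (simp add: floor_less_iff)
    moreover show 0: "\<lfloor>real ?p * t\<rfloor> \<ge> 0" using that by simp
    ultimately show "nat (\<lfloor>real ?p * t\<rfloor> mod int ?p) = nat \<lfloor>real ?p * t\<rfloor>"
      "nat \<lfloor>real ?p * t\<rfloor> < ?p" by (simp_all add: nat_less_iff)
  qed
  show "inj_on loc {(i, t). i < length curves \<and> 0 \<le> t \<and> t < 1}"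
  proof (rule inj_onI, clarsimp)
    fix i t i' t' assume i: "i < card reps" "0 \<le> t" "t < 1" and i': "i' < card reps" "0 \<le> t'" "t' < 1"
      and eq: "loc (i, t) = loc (i', t')"
    then have 1: "idx (?L ! i) \<lfloor>real (period (?L ! i)) * t\<rfloor> = idx (?L ! i') \<lfloor>real (period (?L ! i')) * t'\<rfloor>"
      and 2: "frac (real (period (?L ! i)) * t) = frac (real (period (?L ! i')) * t')"
      by (auto simp: loc_def Let_def)
    have "?L ! i = ?L ! i'"
      using rep_unique[OF rep_nth(1)[OF i(1)] rep_nth(1)[OF i'(1)]] 1 unfolding idx_def by blast
    then have ii: "i = i'" using i(1) i'(1) by (simp add: nth_eq_iff_index_eq)
    let ?p = "period (?L ! i)"
    have p: "?p > 0" using period(1) rep_nth(2)[OF i(1)] by blast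
    have "nat \<lfloor>real ?p * t\<rfloor> = nat \<lfloor>real ?p * t'\<rfloor>"
      using power_unique[OF rep_nth(2)[OF i(1)]] 1 range[OF i] range[OF i'] unfolding idx_def ii by metis
    moreover have "\<lfloor>real ?p * t\<rfloor> \<ge> 0" "\<lfloor>real ?p * t'\<rfloor> \<ge> 0"
      using range(2)[OF i] range(2)[OF i'] ii by auto
    ultimately have "\<lfloor>real ?p * t\<rfloor> = \<lfloor>real ?p * t'\<rfloor>" by (metis int_nat_eq)
    with 2 ii have "real ?p * t = real ?p * t'" by (simp add: frac_def)
    then show "i = i' \<and> t = t'" using ii p by simp
  qed
  show "loc ` {(i, t). i < length curves \<and> 0 \<le> t \<and> t < 1} = {(j, \<tau>). j < n \<and> 0 \<le> \<tau> \<and> \<tau> < 1}"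
  proof (intro set_eqI iffI; clarify)
    fix i :: nat and t :: real and j \<tau> assume "i < length curves" "(j, \<tau>) = loc (i, t)"
    then show "j < n \<and> 0 \<le> \<tau> \<and> \<tau> < 1"
      using rep_nth(2) by (auto simp: loc_def Let_def frac_lt_1)
  next
    fix j :: nat and \<tau> :: real assume j: "j < n" "0 \<le> \<tau>" "\<tau> < 1"
    from rep_exists[OF j(1)] obtain c k where c: "c \<in> reps" "k < period c" "j = (nx ^^ k) c" by blast
    then obtain i where i: "i < card reps" "?L ! i = c"
      using finite_reps by (metis in_set_conv_nth length_sorted_list_of_set set_sorted_list_of_set)
    have p: "period c > 0" using c(2) by simp
    let ?t = "(real k + \<tau>) / real (period c)"
    have s: "real (period c) * ?t = real k + \<tau>" using p by simp
    have fl: "\<lfloor>real k + \<tau>\<rfloor> = int k" "frac (real k + \<tau>) = \<tau>"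
      using j by (auto simp: floor_eq_iff frac_def)
    have "loc (i, ?t) = (j, \<tau>)"
      using fl c i unfolding loc_def Let_def fst_conv snd_conv i(2) s by (simp add: idx_def)
    moreover have "real k + \<tau> < real (period c)" using c(2) j by linarith
    then have "0 \<le> ?t" "?t < 1" using p j by (simp_all add: field_simps)
    ultimately show "(j, \<tau>) \<in> loc ` {(i, t). i < length curves \<and> 0 \<le> t \<and> t < 1}"
      using i by (intro image_eqI[of _ _ "(i, ?t)"]) auto
  qed
qed

definition arc_preim :: "real^3 \<Rightarrow> (nat \<times> real) set" where
  "arc_preim q = {(j, \<tau>). j < n \<and> 0 \<le> \<tau> \<and> \<tau> < 1 \<and> A j \<tau> = q}"

lemma bij_preim: "bij_betw loc (preim curves q) (arc_preim q)"
proof -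
  have "arc_preim q = loc ` preim curves q"
  proof (intro set_eqI iffI; clarify)
    fix j \<tau> assume "(j, \<tau>) \<in> arc_preim q"
    then have "(j, \<tau>) \<in> {(j, \<tau>). j < n \<and> 0 \<le> \<tau> \<and> \<tau> < 1}" and q: "A j \<tau> = q"
      by (auto simp: arc_preim_def)
    then have "(j, \<tau>) \<in> loc ` {(i, t). i < length curves \<and> 0 \<le> t \<and> t < 1}"
      using bij_betw_imp_surj_on[OF bij_loc] by simp
    then obtain i t where it: "i < length curves" "0 \<le> t" "t < 1" and l: "loc (i, t) = (j, \<tau>)"
      by (elim imageE) auto
    with q curves_loc(1)[OF it(1) l] show "(j, \<tau>) \<in> loc ` preim curves q"
      by (intro image_eqI[of _ _ "(i, t)"]) (auto simp: preim_def)
  next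
    fix j \<tau> i t assume l: "(j, \<tau>) = loc (i, t)" and p: "(i, t) \<in> preim curves q"
    then have "(i, t) \<in> {(i, t). i < length curves \<and> 0 \<le> t \<and> t < 1}" by (auto simp: preim_def)
    from imageI[OF this, of loc] have "loc (i, t) \<in> {(j, \<tau>). j < n \<and> 0 \<le> \<tau> \<and> \<tau> < 1}"
      using bij_betw_imp_surj_on[OF bij_loc] by simp
    then show "(j, \<tau>) \<in> arc_preim q"
      using curves_loc(1)[of i t j \<tau>] l p by (auto simp: preim_def arc_preim_def)
  qed
  moreover have "inj_on loc (preim curves q)"
    using bij_betw_imp_inj_on[OF bij_loc] by (rule inj_on_subset) (auto simp: preim_def)
  ultimately show ?thesis by (simp add: bij_betw_def)
qed

lemma card_preim: "card (preim curves q) = card (arc_preim q)"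
  and finite_preim: "finite (preim curves q) \<longleftrightarrow> finite (arc_preim q)"
  using bij_preim[of q] by (auto simp: bij_betw_same_card bij_betw_finite)

lemma dimage_curves: "q \<in> dimage curves \<longleftrightarrow> arc_preim q \<noteq> {}"
  using bij_betw_imp_surj_on[OF bij_preim[of q]] by (auto simp: dimage_def)

text \<open>The factor \<open>c\<close> comes from scaling time by the period. Its positivity
  suffices, since transversality and letters depend only on signs.\<close>

lemma preim_velocity:
  assumes "(i, t) \<in> preim curves q"
  obtains j \<tau> c where "loc (i, t) = (j, \<tau>)" "(j, \<tau>) \<in> arc_preim q" "c > 0" "comp_vel curves i t = c *\<^sub>R A' j \<tau>"
    "fst (curves ! i) = lab j"
proof -
  obtain j \<tau> where l: "loc (i, t) = (j, \<tau>)" by (cases "loc (i, t)")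
  have "i < length curves" using assms by (simp add: preim_def)
  from curves_loc(2,3)[OF this l] that l bij_betw_imp_surj_on[OF bij_preim[of q]] assms
  show thesis by (metis imageI)
qed

lemma doodle_curves:
  assumes "\<And>q. finite (arc_preim q) \<and> card (arc_preim q) \<le> 2"
    and transversal: "\<And>q i s j t. (i, s) \<in> arc_preim q \<Longrightarrow> (j, t) \<in> arc_preim q \<Longrightarrow> (i, s) \<noteq> (j, t)
      \<Longrightarrow> cross3 (A' i s) (A' j t) \<noteq> 0"
  shows "doodle S curves"
  unfolding doodle_def
proof (intro conjI allI impI)
  fix q i s j t
  assume *: "(i, s) \<in> preim curves q \<and> (j, t) \<in> preim curves q \<and> (i, s) \<noteq> (j, t)"
  then obtain i' s' c where 1: "loc (i, s) = (i', s')" "(i', s') \<in> arc_preim q" "c > 0" "comp_vel curves i s = c *\<^sub>R A' i' s'"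
    by (metis preim_velocity)
  obtain j' t' d where 2: "loc (j, t) = (j', t')" "(j', t') \<in> arc_preim q" "d > 0" "comp_vel curves j t = d *\<^sub>R A' j' t'"
    using * by (metis preim_velocity)
  have "(i', s') \<noteq> (j', t')"
    using * 1 2 bij_betw_imp_inj_on[OF bij_preim[of q]] unfolding inj_on_def by metis
  from transversal[OF 1(2) 2(2) this] 1 2 show "cross3 (comp_vel curves i s) (comp_vel curves j t) \<noteq> 0"
    by (simp add: cross_mult_left cross_mult_right)
qed (use curves_component assms card_preim finite_preim in auto)

lemma dletter_curves:
  assumes "arc_preim q = {(j, \<tau>)}"
  shows "dletter curves q w = (lab j, q \<bullet> cross3 (A' j \<tau>) w > 0)"
proof -
  have "card (preim curves q) = 1" using assms by (simp add: card_preim)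
  then obtain i t where it: "preim curves q = {(i, t)}" by (auto simp: card_1_singleton_iff)
  then have "(i, t) \<in> preim curves q" by simp
  then obtain j' \<tau>' c where "(j', \<tau>') \<in> arc_preim q" and c: "c > 0"
    "comp_vel curves i t = c *\<^sub>R A' j' \<tau>'" "fst (curves ! i) = lab j'" by (rule preim_velocity)
  then have "j' = j" "\<tau>' = \<tau>" using assms by auto
  with c it show ?thesis by (simp add: dletter_def cross_mult_left zero_less_mult_iff)
qed

lemma transverse_on_curves:
  assumes "finite {t \<in> T. arc_preim (\<alpha> t) \<noteq> {}}"
    and "\<And>t. t \<in> T \<Longrightarrow> arc_preim (\<alpha> t) \<noteq> {} \<Longrightarrow>
      \<exists>j \<tau>. arc_preim (\<alpha> t) = {(j, \<tau>)} \<and> \<alpha> t \<bullet> cross3 (A' j \<tau>) (\<alpha>' t) \<noteq> 0"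
  shows "transverse_on curves \<alpha> \<alpha>' T"
  unfolding transverse_on_def dimage_curves
proof (intro conjI ballI allI impI)
  fix t i s assume t: "t \<in> T" and p: "(i, s) \<in> preim curves (\<alpha> t)"
  then obtain j \<tau> c where 1: "(j, \<tau>) \<in> arc_preim (\<alpha> t)" "c > 0" "comp_vel curves i s = c *\<^sub>R A' j \<tau>"
    by (metis preim_velocity)
  moreover from 1(1) assms(2)[OF t] obtain j0 \<tau>0
    where "arc_preim (\<alpha> t) = {(j0, \<tau>0)}" "\<alpha> t \<bullet> cross3 (A' j0 \<tau>0) (\<alpha>' t) \<noteq> 0" by blast
  ultimately have 2: "arc_preim (\<alpha> t) = {(j, \<tau>)}" "\<alpha> t \<bullet> cross3 (A' j \<tau>) (\<alpha>' t) \<noteq> 0" by auto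
  then show "card (preim curves (\<alpha> t)) = 1" by (simp add: card_preim)
  show "\<alpha> t \<bullet> cross3 (comp_vel curves i s) (\<alpha>' t) \<noteq> 0" using 1 2 by (simp add: cross_mult_left)
qed (use assms in auto)

end

section \<open>Half circles orthogonal to the equator\<close>

definition emb :: "complex \<Rightarrow> real \<Rightarrow> real^3" where
  "emb w z = vector [Re w, Im w, z]"

lemma emb_nth [simp]: "emb w z $ 1 = Re w" "emb w z $ 2 = Im w" "emb w z $ 3 = z"
  by (simp_all add: emb_def)

lemma emb_eq_iff [simp]: "emb w z = emb w' z' \<longleftrightarrow> w = w' \<and> z = z'"
  by (auto simp: vec_eq_iff forall_3 complex_eq_iff)

lemma emb_0 [simp]: "emb w z = 0 \<longleftrightarrow> w = 0 \<and> z = 0"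
  by (auto simp: vec_eq_iff forall_3 complex_eq_iff)

lemma inner_emb [simp]: "emb w z \<bullet> emb w' z' = w \<bullet> w' + z * z'"
  by (simp add: inner_vec_def sum_3 inner_complex_def)

lemma norm_emb: "(norm (emb w z))\<^sup>2 = (cmod w)\<^sup>2 + z\<^sup>2"
  by (simp add: power2_norm_eq_inner dot_square_norm[symmetric] flip: power2_eq_square)

lemma emb_S2 [simp]: "emb w z \<in> S2 \<longleftrightarrow> (cmod w)\<^sup>2 + z\<^sup>2 = 1"
proof -
  have "emb w z \<in> S2 \<longleftrightarrow> (norm (emb w z))\<^sup>2 = 1" by (simp add: S2_def power2_eq_1_iff)
    (metis norm_ge_zero le_minus_one_simps(3) order_trans zero_le_one not_one_le_zero)
  then show ?thesis by (simp add: norm_emb)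
qed

lemma scaleR_emb: "a *\<^sub>R emb w z = emb (a *\<^sub>R w) (a * z)"
  by (simp add: vec_eq_iff forall_3)

lemma minus_emb: "- emb w z = emb (- w) (- z)"
  by (simp add: vec_eq_iff forall_3)

lemma add_emb: "emb w z + emb w' z' = emb (w + w') (z + z')"
  by (simp add: vec_eq_iff forall_3)

lemma cross3_emb:
  "cross3 (emb w z) (emb w' z') = emb (Complex (Im w * z' - z * Im w') (z * Re w' - Re w * z')) (Im (cnj w * w'))"
  by (simp add: cross3_def emb_def)

lemma bounded_linear_emb: "bounded_linear (\<lambda>p. emb (fst p) (snd p))"
proof -
  have "linear (\<lambda>p. emb (fst p) (snd p))"
    by (auto intro!: linearI simp: scaleR_emb add_emb)
  then show ?thesis by (simp add: linear_conv_bounded_linear)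
qed

lemma has_vector_derivative_emb:
  assumes "(f has_vector_derivative f') (at x within X)" "(g has_vector_derivative g') (at x within X)"
  shows "((\<lambda>t. emb (f t) (g t)) has_vector_derivative emb f' g') (at x within X)"
  using bounded_linear.has_vector_derivative[OF bounded_linear_emb has_vector_derivative_Pair[OF assms]]
  by simp

lemma has_derivative_emb:
  assumes "(f has_derivative f') (at x within X)" "(g has_derivative g') (at x within X)"
  shows "((\<lambda>t. emb (f t) (g t)) has_derivative (\<lambda>v. emb (f' v) (g' v))) (at x within X)"
  using bounded_linear.has_derivative[OF bounded_linear_emb has_derivative_Pair[OF assms]]
  by simp

lemma continuous_emb:
  assumes "continuous F f" "continuous F g"
  shows "continuous F (\<lambda>t. emb (f t) (g t))"
  using bounded_linear.continuous[OF bounded_linear_emb continuous_Pair[OF assms]] by simp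

text \<open>Projecting the tangent plane at height \<open>z\<close> to the equatorial plane
  multiplies oriented areas by \<open>z\<close>. In the computation, tangency eliminates
  \<open>z * z1\<close> and \<open>z * z2\<close>, and the squared norm of the point comes out as a
  factor.\<close>

lemma triple_emb:
  assumes "(cmod w)\<^sup>2 + z\<^sup>2 = 1" "z \<noteq> 0" "emb w z \<bullet> emb w1 z1 = 0" "emb w z \<bullet> emb w2 z2 = 0"
  shows "emb w z \<bullet> cross3 (emb w1 z1) (emb w2 z2) = Im (cnj w1 * w2) / z"
proof -
  obtain x y where w: "w = Complex x y" by (cases w)
  obtain x1 y1 where w1: "w1 = Complex x1 y1" by (cases w1)
  obtain x2 y2 where w2: "w2 = Complex x2 y2" by (cases w2)
  have n: "x\<^sup>2 + y\<^sup>2 + z\<^sup>2 = 1" using assms(1) by (simp add: w cmod_power2)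
  have 1: "z * z1 = - (x * x1 + y * y1)" and 2: "z * z2 = - (x * x2 + y * y2)"
    using assms(3,4) by (simp_all add: w w1 w2 inner_complex_def)
  have "z * (emb w z \<bullet> cross3 (emb w1 z1) (emb w2 z2)) =
      x * (y1 * (z * z2) - (z * z1) * y2) + y * ((z * z1) * x2 - x1 * (z * z2)) + z\<^sup>2 * (x1 * y2 - y1 * x2)"
    by (simp add: cross3_emb w w1 w2 inner_complex_def algebra_simps power2_eq_square)
  also have "\<dots> = (x\<^sup>2 + y\<^sup>2 + z\<^sup>2) * (x1 * y2 - y1 * x2)"
    unfolding 1 2 by (simp add: algebra_simps power2_eq_square)
  also have "\<dots> = Im (cnj w1 * w2)" unfolding n by (simp add: w1 w2)
  finally show ?thesis using assms(2) by (simp add: field_simps)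
qed

definition lift :: "complex \<Rightarrow> real^3" where
  "lift w = emb w (sqrt (1 - (cmod w)\<^sup>2))"

lemma lift_eq_iff [simp]: "lift w = lift w' \<longleftrightarrow> w = w'"
  by (auto simp: lift_def)

lemma lift_S2: "cmod w \<le> 1 \<Longrightarrow> lift w \<in> S2"
  by (simp add: lift_def power_le_one)

lemma norm_less_1_sq: "cmod w < 1 \<Longrightarrow> 0 < 1 - (cmod w)\<^sup>2"
  by (simp add: abs_square_less_1)

lemma emb_eq_lift:
  assumes "emb w z \<in> S2" "z \<ge> 0"
  shows "emb w z = lift w"
proof -
  have "z\<^sup>2 = 1 - (cmod w)\<^sup>2" using assms(1) by simp
  then show ?thesis using assms(2) by (simp add: lift_def real_sqrt_unique)
qed

lemma lift_has_derivative:
  assumes "cmod w < 1"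
  shows "(lift has_derivative (\<lambda>v. emb v (- (w \<bullet> v) / sqrt (1 - (cmod w)\<^sup>2)))) (at w)"
proof -
  have sq: "(cmod v)\<^sup>2 = v \<bullet> v" for v by (simp add: power2_norm_eq_inner)
  have "0 < 1 - w \<bullet> w" using norm_less_1_sq[OF assms] by (simp add: sq)
  then have "((\<lambda>w. sqrt (1 - w \<bullet> w)) has_derivative (\<lambda>v. - (w \<bullet> v) / sqrt (1 - w \<bullet> w))) (at w)"
    by (auto intro!: derivative_eq_intros simp: inner_commute field_simps)
  then show ?thesis unfolding lift_def[abs_def] sq
    by (intro has_derivative_emb) (auto intro: derivative_eq_intros)
qed

lemma continuous_on_lift: "continuous_on S lift"
  unfolding lift_def[abs_def] by (intro continuous_at_imp_continuous_on ballI continuous_emb continuous_intros)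

lemma triple_lift:
  assumes "cmod w < 1" "lift w \<bullet> emb w1 z1 = 0" "lift w \<bullet> emb w2 z2 = 0"
  shows "lift w \<bullet> cross3 (emb w1 z1) (emb w2 z2) = Im (cnj w1 * w2) / sqrt (1 - (cmod w)\<^sup>2)"
  using norm_less_1_sq[OF assms(1)] assms(2,3) unfolding lift_def by (intro triple_emb) auto

text \<open>For \<open>\<bar>\<kappa>\<bar> < pi\<close> an increasing map of the unit interval onto
  the angles from \<open>0\<close> to \<open>pi\<close>; the sine term vanishes at the ends but
  changes the slope there from \<open>pi\<close> to \<open>pi + \<kappa>\<close>.\<close>

definition warp :: "real \<Rightarrow> real \<Rightarrow> real" where
  "warp \<kappa> t = pi * t + \<kappa> * sin (2 * pi * t) / (2 * pi)"

definition warp' :: "real \<Rightarrow> real \<Rightarrow> real" where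
  "warp' \<kappa> t = pi + \<kappa> * cos (2 * pi * t)"

lemma warp_deriv: "(warp \<kappa> has_real_derivative warp' \<kappa> t) (at t)"
  unfolding warp_def[abs_def] warp'_def by (auto intro!: derivative_eq_intros)

lemma warp_ends [simp]: "warp \<kappa> 0 = 0" "warp \<kappa> 1 = pi" "warp' \<kappa> 0 = pi + \<kappa>" "warp' \<kappa> 1 = pi + \<kappa>"
  by (simp_all add: warp_def warp'_def)

lemma warp'_pos:
  assumes "\<bar>\<kappa>\<bar> < pi"
  shows "warp' \<kappa> t > 0"
proof -
  have "\<bar>\<kappa> * cos (2 * pi * t)\<bar> \<le> \<bar>\<kappa>\<bar> * 1" unfolding abs_mult by (intro mult_left_mono) auto
  then show ?thesis using assms unfolding warp'_def by linarith
qed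

lemma warp_strict_mono:
  assumes "\<bar>\<kappa>\<bar> < pi" "s < t"
  shows "warp \<kappa> s < warp \<kappa> t"
  using DERIV_pos_imp_increasing[OF assms(2), of "warp \<kappa>"] warp_deriv warp'_pos[OF assms(1)] by blast

lemma warp_inj: "\<bar>\<kappa>\<bar> < pi \<Longrightarrow> warp \<kappa> s = warp \<kappa> t \<Longrightarrow> s = t"
  using warp_strict_mono[of \<kappa> s t] warp_strict_mono[of \<kappa> t s] by linarith

lemma warp_range:
  assumes "\<bar>\<kappa>\<bar> < pi"
  shows "0 < t \<Longrightarrow> 0 < warp \<kappa> t" "t < 1 \<Longrightarrow> warp \<kappa> t < pi" "0 \<le> t \<Longrightarrow> 0 \<le> warp \<kappa> t" "t \<le> 1 \<Longrightarrow> warp \<kappa> t \<le> pi"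
  using warp_strict_mono[OF assms, of 0 t] warp_strict_mono[OF assms, of t 1]
  by (auto simp: order_le_less)

lemma warp_surj:
  assumes "\<bar>\<kappa>\<bar> < pi" "0 \<le> y" "y \<le> pi"
  shows "\<exists>t. 0 \<le> t \<and> t \<le> 1 \<and> warp \<kappa> t = y"
proof (rule IVT')
  show "continuous_on {0..1} (warp \<kappa>)"
    unfolding warp_def[abs_def] by (intro continuous_intros) auto
qed (use assms in auto)

text \<open>The half circle orthogonal to the equator from \<open>emb P 0\<close> to \<open>emb Q 0\<close>, in the upper
  (\<open>s = 1\<close>) or lower (\<open>s = -1\<close>) hemisphere. The angle is reparametrised so that the speed at both ends is
  \<open>c\<close>, independently of the radius; this makes consecutive half circles fit together smoothly.\<close>

definition strand :: "real \<Rightarrow> real \<Rightarrow> complex \<Rightarrow> complex \<Rightarrow> real \<Rightarrow> real^3" where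
  "strand s c P Q t = (let r = cmod (P - Q) / 2; \<phi> = warp (c / r - pi) t in
     emb ((P + Q) /\<^sub>R 2 + cos \<phi> *\<^sub>R ((P - Q) /\<^sub>R 2)) (s * r * sin \<phi>))"

definition strand' :: "real \<Rightarrow> real \<Rightarrow> complex \<Rightarrow> complex \<Rightarrow> real \<Rightarrow> real^3" where
  "strand' s c P Q t = (let r = cmod (P - Q) / 2; \<phi> = warp (c / r - pi) t; \<phi>' = warp' (c / r - pi) t in
     emb (- (\<phi>' * sin \<phi>) *\<^sub>R ((P - Q) /\<^sub>R 2)) (s * r * cos \<phi> * \<phi>'))"

lemma strand_has_vector_derivative: "(strand s c P Q has_vector_derivative strand' s c P Q t) (at t)"
proof -
  let ?\<kappa> = "c / (cmod (P - Q) / 2) - pi"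
  have 1: "((\<lambda>t. cos (warp ?\<kappa> t)) has_real_derivative - (warp' ?\<kappa> t * sin (warp ?\<kappa> t))) (at t)"
    using warp_deriv[of ?\<kappa> t] by (auto intro!: derivative_eq_intros)
  have 2: "((\<lambda>t. s * (cmod (P - Q) / 2) * sin (warp ?\<kappa> t)) has_real_derivative
      s * (cmod (P - Q) / 2) * cos (warp ?\<kappa> t) * warp' ?\<kappa> t) (at t)"
    using warp_deriv[of ?\<kappa> t] by (auto intro!: derivative_eq_intros)
  have 3: "((\<lambda>t. (P + Q) /\<^sub>R 2 + cos (warp ?\<kappa> t) *\<^sub>R ((P - Q) /\<^sub>R 2)) has_vector_derivative
      0 + - (warp' ?\<kappa> t * sin (warp ?\<kappa> t)) *\<^sub>R ((P - Q) /\<^sub>R 2)) (at t)"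
    using has_vector_derivative_scaleR[OF 1 has_vector_derivative_const[of "(P - Q) /\<^sub>R 2"]]
    by (intro has_vector_derivative_add has_vector_derivative_const) simp
  show ?thesis
    using has_vector_derivative_emb[OF 3 2[unfolded has_real_derivative_iff_has_vector_derivative]]
    unfolding strand_def[abs_def] strand'_def Let_def by simp
qed

lemma isCont_strand': "isCont (strand' s c P Q) t"
  unfolding strand'_def[abs_def] Let_def warp_def warp'_def
  by (intro continuous_emb continuous_intros) auto

text \<open>The upper bound on \<open>c\<close> gives \<open>0 < c / r \<le> 1\<close>, hence
  \<open>\<bar>\<kappa>\<bar> < pi\<close>, so that the change of angle is increasing.\<close>

locale chord =
  fixes P Q :: complex and c :: real
  assumes P: "cmod P = 1" and Q: "cmod Q = 1" and PQ: "P \<noteq> Q" and c: "0 < c" "c \<le> cmod (P - Q) / 2"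
begin

definition r :: real where "r = cmod (P - Q) / 2"
definition \<kappa> :: real where "\<kappa> = c / r - pi"

lemma r: "r > 0" using PQ by (simp add: r_def)

lemma \<kappa>: "\<bar>\<kappa>\<bar> < pi"
proof -
  have "0 < c / r" "c / r \<le> 1" using c r by (simp_all add: r_def)
  then show ?thesis using pi_gt3 unfolding \<kappa>_def by linarith
qed

lemma strand_eq: "strand s c P Q t = emb ((P + Q) /\<^sub>R 2 + cos (warp \<kappa> t) *\<^sub>R ((P - Q) /\<^sub>R 2)) (s * r * sin (warp \<kappa> t))"
  by (simp add: strand_def \<kappa>_def r_def Let_def)

lemma strand'_eq: "strand' s c P Q t =
   emb (- (warp' \<kappa> t * sin (warp \<kappa> t)) *\<^sub>R ((P - Q) /\<^sub>R 2)) (s * r * cos (warp \<kappa> t) * warp' \<kappa> t)"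
  by (simp add: strand'_def \<kappa>_def r_def Let_def)

lemma strand_ends: "strand s c P Q 0 = emb P 0" "strand s c P Q 1 = emb Q 0"
  by (simp_all add: strand_eq complex_eq_iff field_simps)

text \<open>The arrival velocity is the departure velocity of a strand in the opposite hemisphere.
  This is why strands that alternate between the hemispheres fit together to first order.\<close>

lemma strand'_ends: "strand' s c P Q 0 = emb 0 (s * c)" "strand' s c P Q 1 = emb 0 (- s * c)"
  using r by (simp_all add: strand'_eq \<kappa>_def)

text \<open>The midpoint of a chord is orthogonal to the chord, and Pythagoras gives its distance
  from the centre.\<close>

lemma inner_mid:
  "((P + Q) /\<^sub>R 2) \<bullet> ((P - Q) /\<^sub>R 2) = 0" "((P - Q) /\<^sub>R 2) \<bullet> ((P - Q) /\<^sub>R 2) = r\<^sup>2"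
  "((P + Q) /\<^sub>R 2) \<bullet> ((P + Q) /\<^sub>R 2) = 1 - r\<^sup>2"
proof -
  have PQ1: "P \<bullet> P = 1" "Q \<bullet> Q = 1" using P Q by (simp_all add: dot_square_norm)
  then have "(P + Q) \<bullet> (P - Q) = 0"
    unfolding inner_add_left inner_diff_right by (simp add: inner_commute)
  then show "((P + Q) /\<^sub>R 2) \<bullet> ((P - Q) /\<^sub>R 2) = 0" by simp
  have r2: "r\<^sup>2 = (P - Q) \<bullet> (P - Q) / 4"
    unfolding dot_square_norm by (simp add: r_def power_divide)
  then show "((P - Q) /\<^sub>R 2) \<bullet> ((P - Q) /\<^sub>R 2) = r\<^sup>2"
    unfolding inner_scaleR_left inner_scaleR_right by simp
  show "((P + Q) /\<^sub>R 2) \<bullet> ((P + Q) /\<^sub>R 2) = 1 - r\<^sup>2"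
    unfolding r2 inner_scaleR_left inner_scaleR_right inner_add_left inner_add_right inner_diff_left inner_diff_right
    by (simp add: PQ1 inner_commute[of Q P] field_simps)
qed

lemma strand_S2:
  assumes "s\<^sup>2 = 1"
  shows "strand s c P Q t \<in> S2"
proof -
  let ?x = "cos (warp \<kappa> t)" and ?y = "sin (warp \<kappa> t)"
  have "(cmod ((P + Q) /\<^sub>R 2 + ?x *\<^sub>R ((P - Q) /\<^sub>R 2)))\<^sup>2 = 1 - r\<^sup>2 + ?x\<^sup>2 * r\<^sup>2"
    unfolding dot_square_norm[symmetric] inner_add_left inner_add_right inner_scaleR_left[of ?x]
      inner_scaleR_right[of _ ?x] inner_mid inner_commute[of "(P - Q) /\<^sub>R 2" "(P + Q) /\<^sub>R 2"]
    by (simp add: power2_eq_square)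
  also have "?x\<^sup>2 = 1 - ?y\<^sup>2" by (simp add: cos_squared_eq)
  finally show ?thesis unfolding strand_eq emb_S2 using assms by (simp add: power_mult_distrib algebra_simps)
qed

lemma strand_tangent:
  assumes "s\<^sup>2 = 1"
  shows "strand s c P Q t \<bullet> strand' s c P Q t = 0"
proof -
  let ?x = "cos (warp \<kappa> t)" and ?y = "sin (warp \<kappa> t)" and ?d = "warp' \<kappa> t"
  have "((P + Q) /\<^sub>R 2 + ?x *\<^sub>R ((P - Q) /\<^sub>R 2)) \<bullet> (- (?d * ?y) *\<^sub>R ((P - Q) /\<^sub>R 2)) = - ?d * ?y * ?x * r\<^sup>2"
    unfolding inner_add_left inner_scaleR_left[of ?x] inner_scaleR_right[of _ "- (?d * ?y)"] inner_mid by simp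
  then show ?thesis unfolding strand_eq strand'_eq inner_emb using assms
    by (simp only: power2_eq_square) algebra
qed

lemma strand'_nz:
  assumes "s\<^sup>2 = 1"
  shows "strand' s c P Q t \<noteq> 0"
proof
  assume "strand' s c P Q t = 0"
  then have "sin (warp \<kappa> t) = 0" "cos (warp \<kappa> t) = 0"
    using warp'_pos[OF \<kappa>, of t] r assms PQ by (auto simp: strand'_eq)
  then show False using sin_cos_squared_add[of "warp \<kappa> t"] by simp
qed

lemma strand_height:
  assumes "0 < t" "t < 1" "s \<noteq> 0"
  shows "sgn (strand s c P Q t $ 3) = sgn s"
proof -
  have "sin (warp \<kappa> t) > 0" using warp_range[OF \<kappa>, of t] assms by (intro sin_gt_zero) auto
  then show ?thesis using r by (simp add: strand_eq sgn_mult)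
qed

lemma strand_proj:
  assumes "0 < t" "t < 1" "strand s c P Q t = emb w z"
  shows "w \<in> open_segment P Q"
proof -
  have "cos pi < cos (warp \<kappa> t)" "cos (warp \<kappa> t) < cos 0"
    using warp_range[OF \<kappa>, of t] assms by (intro cos_monotone_0_pi; simp)+
  moreover have "w = (1 - (1 - cos (warp \<kappa> t)) / 2) *\<^sub>R P + ((1 - cos (warp \<kappa> t)) / 2) *\<^sub>R Q"
    using assms(3) unfolding strand_eq emb_eq_iff by (auto simp: complex_eq_iff field_simps)
  ultimately show ?thesis using PQ unfolding in_segment
    by (intro conjI exI[of _ "(1 - cos (warp \<kappa> t)) / 2"]) auto
qed

lemma strand_inj:
  assumes "0 \<le> t" "t \<le> 1" "0 \<le> t'" "t' \<le> 1" "strand s c P Q t = strand s c P Q t'"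
  shows "t = t'"
proof -
  have "cos (warp \<kappa> t) = cos (warp \<kappa> t')" using assms(5) PQ by (simp add: strand_eq)
  then have "warp \<kappa> t = warp \<kappa> t'"
    using warp_range(3,4)[OF \<kappa>, of t] warp_range(3,4)[OF \<kappa>, of t'] assms(1-4) by (simp add: cos_inj_pi)
  then show ?thesis by (rule warp_inj[OF \<kappa>])
qed

lemma strand_surj:
  assumes "w \<in> open_segment P Q"
  shows "\<exists>t. 0 < t \<and> t < 1 \<and> strand 1 c P Q t = lift w"
proof -
  obtain u where u: "0 < u" "u < 1" "w = (1 - u) *\<^sub>R P + u *\<^sub>R Q" using assms by (auto simp: in_segment)
  obtain t where t: "0 \<le> t" "t \<le> 1" "warp \<kappa> t = arccos (1 - 2 * u)"
    using warp_surj[OF \<kappa>, of "arccos (1 - 2 * u)"] arccos_lbound[of "1 - 2 * u"] arccos_ubound[of "1 - 2 * u"] u by auto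
  then have x: "cos (warp \<kappa> t) = 1 - 2 * u" using u by simp
  have "t \<noteq> 0" "t \<noteq> 1" using x u by auto
  then have t': "0 < t" "t < 1" using t by auto
  have "strand 1 c P Q t = emb w (r * sin (warp \<kappa> t))"
    by (simp add: strand_eq x u(3) complex_eq_iff field_simps)
  moreover have "r * sin (warp \<kappa> t) \<ge> 0"
    using r warp_range[OF \<kappa>, of t] t by (auto intro!: mult_nonneg_nonneg sin_ge_zero)
  ultimately have "strand 1 c P Q t = lift w"
    using emb_eq_lift[of w "r * sin (warp \<kappa> t)"] strand_S2[of 1 t] by simp
  then show ?thesis using t' by blast
qed

lemma strand'_proj:
  assumes "0 < t" "t < 1"
  shows "\<exists>d>0. \<exists>z. strand' s c P Q t = emb (d *\<^sub>R (Q - P)) z"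
proof -
  have "sin (warp \<kappa> t) > 0" using warp_range[OF \<kappa>, of t] assms by (intro sin_gt_zero) auto
  then show ?thesis using warp'_pos[OF \<kappa>, of t]
    by (intro exI[of _ "warp' \<kappa> t * sin (warp \<kappa> t) / 2"])
      (auto simp: strand'_eq complex_eq_iff field_simps)
qed

end

text \<open>The affine function vanishing on the line through \<open>cis a\<close> and \<open>cis b\<close>.\<close>

definition side :: "real \<Rightarrow> real \<Rightarrow> complex \<Rightarrow> real" where
  "side a b w = Re (w * cis (- (a + b) / 2)) - cos ((b - a) / 2)"

lemma side_commute: "side a b = side b a"
proof -
  have "cos ((b - a) / 2) = cos ((a - b) / 2)" by (metis cos_minus minus_diff_eq minus_divide_left)
  then show ?thesis unfolding side_def by (simp add: add.commute)
qed

text \<open>The product-to-sum formula for the two half angles. In product form the sign at a point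
  of the circle can be read off from its position relative to \<open>a\<close> and
  \<open>b\<close>.\<close>

lemma side_cis: "side a b (cis x) = 2 * sin ((x - a) / 2) * sin ((b - x) / 2)"
proof -
  have "side a b (cis x) = cos ((x - a) / 2 - (b - x) / 2) - cos ((x - a) / 2 + (b - x) / 2)"
  proof -
    have "x + - (a + b) / 2 = (x - a) / 2 - (b - x) / 2" "(b - a) / 2 = (x - a) / 2 + (b - x) / 2"
      by (simp_all add: field_simps)
    then show ?thesis unfolding side_def cis_mult by (simp only: cis.simps)
  qed
  then show ?thesis by (simp add: cos_diff cos_add)
qed

lemma side_affine: "side a b ((1 - u) *\<^sub>R w + u *\<^sub>R w') = (1 - u) * side a b w + u * side a b w'"
  by (simp add: side_def algebra_simps)

lemma side_open_segment:
  assumes "w \<in> open_segment P Q" "side a b P * side a b Q > 0"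
  shows "side a b w \<noteq> 0"
proof -
  obtain u where u: "0 < u" "u < 1" "w = (1 - u) *\<^sub>R P + u *\<^sub>R Q" using assms(1) by (auto simp: in_segment)
  from assms(2) consider "side a b P > 0" "side a b Q > 0" | "side a b P < 0" "side a b Q < 0"
    by (auto simp: zero_less_mult_iff)
  then show ?thesis
  proof cases
    case 1
    then have "(1 - u) * side a b P + u * side a b Q > 0" using u by (intro add_pos_pos) auto
    then show ?thesis by (simp add: u(3) side_affine)
  next
    case 2
    then have "(1 - u) * side a b P + u * side a b Q < 0" using u by (intro add_neg_neg mult_pos_neg) auto
    then show ?thesis by (simp add: u(3) side_affine)
  qed
qed

text \<open>A rotation makes the chord vertical with ends \<open>cis (- h)\<close> and
  \<open>cis h\<close>. A point of the open disc with real part \<open>cos h\<close> has imaginary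
  part below \<open>\<bar>sin h\<bar>\<close> in absolute value, hence lies strictly between
  them.\<close>

lemma open_segment_iff_side:
  assumes "cmod w < 1" "cis a \<noteq> cis b"
  shows "w \<in> open_segment (cis a) (cis b) \<longleftrightarrow> side a b w = 0"
proof
  assume "w \<in> open_segment (cis a) (cis b)"
  then show "side a b w = 0" by (auto simp: in_segment side_affine side_cis)
next
  assume s: "side a b w = 0"
  define m h where "m = (a + b) / 2" and "h = (b - a) / 2"
  define w' where "w' = w * cis (- m)"
  have ab: "a = m - h" "b = m + h" by (simp_all add: m_def h_def field_simps)
  have w: "w = cis m * w'" by (simp add: w'_def cis_mult mult.commute mult.left_commute)
  have re: "Re w' = cos h" using s by (simp add: side_def w'_def m_def h_def minus_divide_left)
  have "(cmod w')\<^sup>2 < 1" using assms(1) norm_less_1_sq[of w] by (simp add: w'_def norm_mult)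
  then have im: "(Im w')\<^sup>2 < (sin h)\<^sup>2" by (simp add: cmod_power2 re sin_squared_eq)
  then have nz: "sin h \<noteq> 0" by auto
  have "\<bar>Im w'\<bar> < \<bar>sin h\<bar>" using im by (simp add: abs_le_square_iff flip: not_le)
  then have "\<bar>Im w' / sin h\<bar> < 1" using nz by (simp add: abs_divide)
  then have u: "0 < (1 + Im w' / sin h) / 2" "(1 + Im w' / sin h) / 2 < 1"
    using abs_less_iff[of "Im w' / sin h" 1] by simp_all
  define u where "u = (1 + Im w' / sin h) / 2"
  have w': "w' = (1 - u) *\<^sub>R cis (- h) + u *\<^sub>R cis h"
    using nz by (simp add: complex_eq_iff re u_def field_simps)
  have "w = (1 - u) *\<^sub>R (cis m * cis (- h)) + u *\<^sub>R (cis m * cis h)"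
    unfolding w by (subst w') (simp only: distrib_left mult_scaleR_right)
  then have "w = (1 - u) *\<^sub>R cis a + u *\<^sub>R cis b"
    by (simp add: cis_mult ab)
  then show "w \<in> open_segment (cis a) (cis b)" using u assms(2) unfolding in_segment u_def by blast
qed

lemma open_segment_norm:
  assumes "cmod P = 1" "cmod Q = 1" "w \<in> open_segment P Q"
  shows "cmod w < 1"
  using dist_decreases_open_segment[OF assms(3), of 0] assms(1,2) by simp

text \<open>Chord directions enter the planar determinants in this form: a signed length times the
  perpendicular to the ray at the mean angle.\<close>

lemma cis_diff: "cis b - cis a = (2 * sin ((b - a) / 2)) *\<^sub>R (\<i> * cis ((a + b) / 2))"
proof -
  define m h where "m = (a + b) / 2" and "h = (b - a) / 2"
  have ab: "a = m - h" "b = m + h" by (simp_all add: m_def h_def field_simps)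
  have "cis (m + h) - cis (m - h) = (2 * sin h) *\<^sub>R (\<i> * cis m)"
    by (simp add: complex_eq_iff cos_add cos_diff sin_add sin_diff)
  then show ?thesis unfolding ab[symmetric] by (simp add: m_def h_def)
qed

section \<open>The diagram\<close>

lemma sgn_sin:
  assumes "\<bar>y\<bar> < pi"
  shows "sgn (sin y) = (sgn y :: real)"
proof (cases y "0::real" rule: linorder_cases)
  case less
  then have "sin (- y) > 0" using assms by (intro sin_gt_zero) auto
  then show ?thesis using less by simp
next
  case greater
  then show ?thesis using assms sin_gt_zero[of y] by simp
qed simp

lemma abs_half_less_pi: "\<bar>y :: real\<bar> < pi / 2 \<Longrightarrow> \<bar>y / 2\<bar> < pi"
  using pi_gt_zero abs_ge_self[of y] by (simp only: abs_divide abs_numeral)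

lemma btw_iff: "btw i j k \<longleftrightarrow> (real k - real i) * (real j - real k) > 0"
  by (auto simp: btw_def zero_less_mult_iff)

locale identity =
  fixes S :: "'s set" and E :: "('s \<times> 's \<times> 's letter list) list" and V :: "nat \<Rightarrow> nat"
  assumes colours: "\<And>x. x \<in> set (concat (map comm_word E)) \<Longrightarrow> fst x \<in> S"
    and V: "matching (concat (map comm_word E)) V" "noncrossing (length (concat (map comm_word E))) V"
begin

definition W :: "'s letter list" where "W = concat (map comm_word E)"
definition n :: nat where "n = length W"
text \<open>With this step the angles \<open>real i * \<epsilon>\<close> stay below
  \<open>pi / 2\<close> for all \<open>i \<le> n\<close>.\<close>

definition \<epsilon> :: real where "\<epsilon> = pi / (2 * (real n + 1))"
definition pt :: "nat \<Rightarrow> complex" where "pt i = cis (real i * \<epsilon>)"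
definition up :: "nat \<Rightarrow> bool" where "up i \<longleftrightarrow> \<not> snd (W ! i)"
definition hs :: "nat \<Rightarrow> real" where "hs i = (if up i then 1 else -1)"
text \<open>A strand that leaves an up letter in the upper hemisphere reaches its partner from
  above; the partner is a down letter, so the curve continues below. The two matchings are thus used
  alternately.\<close>

definition nx :: "nat \<Rightarrow> nat" where "nx i = (if up i then upper_match E i else V i)"
text \<open>Half the distance of neighbouring points, hence at most the radius of any half circle in
  use, as \<open>chord\<close> requires.\<close>

definition speed :: real where "speed = sin (\<epsilon> / 2)"
definition A :: "nat \<Rightarrow> real \<Rightarrow> real^3" where "A i = strand (hs i) speed (pt i) (pt (nx i))"
definition A' :: "nat \<Rightarrow> real \<Rightarrow> real^3" where "A' i = strand' (hs i) speed (pt i) (pt (nx i))"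
definition lab :: "nat \<Rightarrow> 's" where "lab i = fst (W ! i)"

abbreviation "U \<equiv> upper_match E"

lemma eps: "0 < \<epsilon>" "real n * \<epsilon> < pi / 2" "\<epsilon> \<le> pi / 2"
proof -
  show "0 < \<epsilon>" by (simp add: \<epsilon>_def)
  have "(real n + 1) * \<epsilon> = pi / 2" by (simp add: \<epsilon>_def field_simps)
  then show "real n * \<epsilon> < pi / 2" using \<open>0 < \<epsilon>\<close> by (simp add: distrib_right)
  have "1 * \<epsilon> \<le> (real n + 1) * \<epsilon>" using \<open>0 < \<epsilon>\<close> by (intro mult_right_mono) auto
  then show "\<epsilon> \<le> pi / 2" using \<open>(real n + 1) * \<epsilon> = pi / 2\<close> by simp
qed

lemma eps_bound:
  assumes "\<bar>x\<bar> \<le> real n"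
  shows "\<bar>x * \<epsilon>\<bar> < pi / 2"
proof -
  have "\<bar>x * \<epsilon>\<bar> \<le> real n * \<epsilon>" unfolding abs_mult using assms eps(1) by (simp add: mult_right_mono)
  then show ?thesis using eps(2) by linarith
qed

lemma U: "i < n \<Longrightarrow> U i < n" "i < n \<Longrightarrow> U (U i) = i" "i < n \<Longrightarrow> W ! U i = linv (W ! i)"
  using upper_matching[of E] unfolding matching_def W_def n_def by auto

lemma Vm: "i < n \<Longrightarrow> V i < n" "i < n \<Longrightarrow> V (V i) = i" "i < n \<Longrightarrow> W ! V i = linv (W ! i)"
  using V(1) unfolding matching_def W_def n_def by auto

lemma up_match [simp]: "i < n \<Longrightarrow> up (U i) \<longleftrightarrow> \<not> up i" "i < n \<Longrightarrow> up (V i) \<longleftrightarrow> \<not> up i"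
  by (simp_all add: up_def U Vm)

lemma nx_props: "i < n \<Longrightarrow> nx i < n" "i < n \<Longrightarrow> up (nx i) \<longleftrightarrow> \<not> up i" "i < n \<Longrightarrow> lab (nx i) = lab i"
  "i < n \<Longrightarrow> nx i \<noteq> i"
proof -
  assume i: "i < n"
  then show "nx i < n" "up (nx i) \<longleftrightarrow> \<not> up i" "lab (nx i) = lab i" by (auto simp: nx_def U Vm lab_def)
  then show "nx i \<noteq> i" by auto
qed

lemma nx_bij: "bij_betw nx {..<n} {..<n}"
proof -
  have "inj_on nx {..<n}"
  proof (rule inj_onI)
    fix i j assume ij: "i \<in> {..<n}" "j \<in> {..<n}" and eq: "nx i = nx j"
    then have i: "i < n" and j: "j < n" by auto
    have same: "up i = up j" using nx_props(2)[OF i] nx_props(2)[OF j] unfolding eq by blast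
    show "i = j"
    proof (cases "up i")
      case True
      then have "U i = U j" using eq same by (simp add: nx_def)
      then show ?thesis using U(2)[OF i] U(2)[OF j] by metis
    next
      case False
      then have "V i = V j" using eq same by (simp add: nx_def)
      then show ?thesis using Vm(2)[OF i] Vm(2)[OF j] by metis
    qed
  qed
  moreover have "nx ` {..<n} \<subseteq> {..<n}" using nx_props(1) by auto
  ultimately show ?thesis unfolding bij_betw_def using endo_inj_surj[of "{..<n}" nx] by auto
qed

text \<open>All half differences of angles are below \<open>pi\<close> in absolute value, so their
  sines have the signs of the differences. The position \<open>x\<close> is real because the axis of
  a factor lies at a half-integer position.\<close>

lemma side_sgn:
  assumes "i < n" "j < n" "0 \<le> x" "x \<le> real n"
  shows "sgn (side (real i * \<epsilon>) (real j * \<epsilon>) (cis (x * \<epsilon>))) = sgn ((x - real i) * (real j - x))"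
proof -
  have 1: "\<bar>(x * \<epsilon> - real i * \<epsilon>) / 2\<bar> < pi"
  proof -
    have "\<bar>x - real i\<bar> \<le> real n" using assms by auto
    from abs_half_less_pi[OF eps_bound[OF this]] show ?thesis unfolding left_diff_distrib .
  qed
  have 2: "\<bar>(real j * \<epsilon> - x * \<epsilon>) / 2\<bar> < pi"
  proof -
    have "\<bar>real j - x\<bar> \<le> real n" using assms by auto
    from abs_half_less_pi[OF eps_bound[OF this]] show ?thesis unfolding left_diff_distrib .
  qed
  have "sgn ((x * \<epsilon> - real i * \<epsilon>) / 2) = sgn (x - real i)" "sgn ((real j * \<epsilon> - x * \<epsilon>) / 2) = sgn (real j - x)"
    using eps(1) by (simp_all add: sgn_mult flip: left_diff_distrib)
  then show ?thesis unfolding side_cis sgn_mult sgn_sin[OF 1] sgn_sin[OF 2] by simp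
qed

lemma side_pt:
  assumes "i < n" "j < n" "k < n"
  shows "side (real i * \<epsilon>) (real j * \<epsilon>) (pt k) > 0 \<longleftrightarrow> btw i j k"
    "k \<noteq> i \<Longrightarrow> k \<noteq> j \<Longrightarrow> side (real i * \<epsilon>) (real j * \<epsilon>) (pt k) \<noteq> 0"
proof -
  have s: "sgn (side (real i * \<epsilon>) (real j * \<epsilon>) (pt k)) = sgn ((real k - real i) * (real j - real k))"
    unfolding pt_def using assms by (intro side_sgn) auto
  show "side (real i * \<epsilon>) (real j * \<epsilon>) (pt k) > 0 \<longleftrightarrow> btw i j k"
    unfolding btw_iff using s by (metis sgn_greater)
  show "side (real i * \<epsilon>) (real j * \<epsilon>) (pt k) \<noteq> 0" if "k \<noteq> i" "k \<noteq> j"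
    using s that by (auto simp: sgn_if split: if_splits)
qed

lemma pt_inj: "i < n \<Longrightarrow> j < n \<Longrightarrow> pt i = pt j \<Longrightarrow> i = j"
proof (rule ccontr)
  assume "i < n" "j < n" "pt i = pt j" "i \<noteq> j"
  then have "side (real i * \<epsilon>) (real i * \<epsilon>) (pt i) \<noteq> 0" using side_pt(2)[of i i j] by metis
  then show False by (simp add: pt_def side_cis)
qed

lemma norm_pt [simp]: "cmod (pt i) = 1"
  by (simp add: pt_def)

lemma chord:
  assumes "i < n" "j < n" "i \<noteq> j"
  shows "chord (pt i) (pt j) speed"
proof
  show "pt i \<noteq> pt j" using pt_inj assms by blast
  show "0 < speed" unfolding speed_def using eps by (intro sin_gt_zero) auto
  let ?d = "\<bar>real i - real j\<bar>"
  have "cmod (pt i - pt j) / 2 = \<bar>sin ((real i * \<epsilon> - real j * \<epsilon>) / 2)\<bar>"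
    unfolding pt_def cis_diff by (simp add: norm_mult)
  also have "\<dots> = \<bar>sin (?d * \<epsilon> / 2)\<bar>"
  proof (cases "real i \<ge> real j")
    case False
    then have d: "?d = real j - real i" by simp
    have "(real i * \<epsilon> - real j * \<epsilon>) / 2 = - ((real j - real i) * \<epsilon> / 2)"
      by (simp add: left_diff_distrib diff_divide_distrib)
    then have "(real i * \<epsilon> - real j * \<epsilon>) / 2 = - (?d * \<epsilon> / 2)" unfolding d .
    then show ?thesis by simp
  qed (simp add: left_diff_distrib)
  finally have eq: "cmod (pt i - pt j) / 2 = \<bar>sin (?d * \<epsilon> / 2)\<bar>" .
  have "1 \<le> ?d" using assms(3) by linarith
  then have "\<epsilon> \<le> ?d * \<epsilon>" using eps(1) by simp
  moreover have "?d * \<epsilon> < pi / 2" using eps_bound[of "real i - real j"] assms eps(1) by (simp add: abs_mult)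
  ultimately have "sin (\<epsilon> / 2) \<le> sin (?d * \<epsilon> / 2)" using eps(1) pi_gt_zero by (intro sin_monotone_2pi_le) linarith+
  then show "speed \<le> cmod (pt i - pt j) / 2" unfolding eq speed_def by linarith
qed simp_all

lemma chord_nx: "i < n \<Longrightarrow> chord (pt i) (pt (nx i)) speed"
  using chord nx_props by metis

lemma hs: "(hs i)\<^sup>2 = 1" "hs i \<noteq> 0" "sgn (hs i) = hs i"
  by (auto simp: hs_def)

sublocale closed_curves n nx A A' lab S
proof
  show "bij_betw nx {..<n} {..<n}" by (rule nx_bij)
  fix j t assume j: "j < n"
  interpret chord "pt j" "pt (nx j)" speed by (rule chord_nx[OF j])
  interpret succ: chord "pt (nx j)" "pt (nx (nx j))" speed by (rule chord_nx) (rule nx_props(1)[OF j])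
  show "(A j has_vector_derivative A' j t) (at t)" "isCont (A' j) t"
    unfolding A_def A'_def by (rule strand_has_vector_derivative isCont_strand')+
  show "A' j t \<noteq> 0" "A j t \<in> S2" unfolding A_def A'_def by (intro strand'_nz strand_S2 hs(1))+
  show "A j 1 = A (nx j) 0" unfolding A_def by (simp add: strand_ends succ.strand_ends)
  show "A' j 1 = A' (nx j) 0" unfolding A'_def strand'_ends succ.strand'_ends using nx_props(2)[OF j] by (simp add: hs_def)
  show "lab j \<in> S" unfolding lab_def 
    using colours nth_mem[of j W] j unfolding n_def W_def by blast
  show "lab (nx j) = lab j" by (rule nx_props(3)[OF j])
qed

text \<open>The function \<open>side\<close> of the first chord has the same strict sign at both
  ends of the second, so it cannot vanish on it, whereas it vanishes on the first.\<close>

lemma chords_disjoint: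
  assumes "i < n" "i' < n" "j < n" "j' < n" "j \<noteq> i" "j \<noteq> i'" "j' \<noteq> i" "j' \<noteq> i'" "i \<noteq> i'"
    and "btw i i' j \<longleftrightarrow> btw i i' j'" "w \<in> open_segment (pt i) (pt i')"
  shows "w \<notin> open_segment (pt j) (pt j')"
proof
  assume w: "w \<in> open_segment (pt j) (pt j')"
  have "cmod w < 1" using open_segment_norm[OF _ _ assms(11)] by simp
  then have "side (real i * \<epsilon>) (real i' * \<epsilon>) w = 0"
    using open_segment_iff_side[of w "real i * \<epsilon>" "real i' * \<epsilon>"] assms(11) pt_inj[OF assms(1,2)] assms(9)
    unfolding pt_def by auto
  moreover have "side (real i * \<epsilon>) (real i' * \<epsilon>) (pt j) * side (real i * \<epsilon>) (real i' * \<epsilon>) (pt j') > 0"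
  proof (cases "btw i i' j")
    case True
    then show ?thesis using side_pt(1)[of i i' j] side_pt(1)[of i i' j'] assms by simp
  next
    case False
    then have "side (real i * \<epsilon>) (real i' * \<epsilon>) (pt j) < 0" "side (real i * \<epsilon>) (real i' * \<epsilon>) (pt j') < 0"
      using side_pt[of i i' j] side_pt[of i i' j'] assms by force+
    then show ?thesis by (rule mult_neg_neg)
  qed
  ultimately show False using side_open_segment[OF w] by blast
qed

lemma arc_point:
  assumes "(j, \<tau>) \<in> arc_preim (emb w z)"
  shows "j < n" "\<tau> = 0 \<Longrightarrow> w = pt j \<and> z = 0"
    "0 \<le> \<tau>" "\<tau> < 1" "0 < \<tau> \<Longrightarrow> w \<in> open_segment (pt j) (pt (nx j))" "0 < \<tau> \<Longrightarrow> sgn z = hs j"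
proof -
  have j: "j < n" "0 \<le> \<tau>" "\<tau> < 1" and eq: "A j \<tau> = emb w z" using assms by (auto simp: arc_preim_def)
  then show "j < n" "0 \<le> \<tau>" "\<tau> < 1" by auto
  interpret chord "pt j" "pt (nx j)" speed by (rule chord_nx[OF j(1)])
  show "w = pt j \<and> z = 0" if "\<tau> = 0" using eq unfolding that A_def strand_ends by simp
  show "w \<in> open_segment (pt j) (pt (nx j))" if "0 < \<tau>"
    using strand_proj[OF that j(3)] eq unfolding A_def by blast
  show "sgn z = hs j" if "0 < \<tau>"
    using strand_height[OF that j(3) hs(2)[of j]] eq hs(3) unfolding A_def by simp
qed

lemma arc_preim_unique:
  assumes "(j, \<tau>) \<in> arc_preim q" "(j, \<tau>') \<in> arc_preim q"
  shows "\<tau> = \<tau>'"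
proof -
  have j: "j < n" using assms by (auto simp: arc_preim_def)
  interpret chord "pt j" "pt (nx j)" speed by (rule chord_nx[OF j])
  show ?thesis using assms strand_inj[of \<tau> \<tau>'] by (auto simp: arc_preim_def A_def)
qed

lemma emb_surj: "\<exists>w z. q = emb w z"
  by (intro exI[of _ "Complex (q $ 1) (q $ 2)"] exI[of _ "q $ 3"]) (simp add: vec_eq_iff forall_3)

text \<open>The equator is met only at the starting points of strands, which are distinct. Elsewhere
  both strands lie in one hemisphere, so their chords interleave: this never happens below, and
  above only inside a commutator.\<close>

lemma double_point:
  assumes "(i, s) \<in> arc_preim q" "(j, t) \<in> arc_preim q" "(i, s) \<noteq> (j, t)"
  shows "i \<noteq> j" "0 < s" "0 < t" "up i" "up j" "\<exists>k. core_pos E k i \<and> core_pos E k j"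
proof -
  obtain w z where q: "q = emb w z" using emb_surj by blast
  note 1 = arc_point[OF assms(1)[unfolded q]] and 2 = arc_point[OF assms(2)[unfolded q]]
  show ij: "i \<noteq> j" using arc_preim_unique[of i s q t] assms by auto
  have "s \<noteq> 0"
  proof
    assume "s = 0"
    then have z: "z = 0" "w = pt i" using 1(2) by auto
    then have "t = 0" using 2(3,6) hs(2)[of j] by force
    then show False using z 2(2) pt_inj[OF 1(1) 2(1)] ij by auto
  qed
  then show s: "0 < s" using 1(3) by simp
  have "t \<noteq> 0"
  proof
    assume "t = 0"
    then have "z = 0" using 2(2) by auto
    then show False using 1(6)[OF s] hs(2)[of i] by simp
  qed
  then show t: "0 < t" using 2(3) by simp
  have "hs i = hs j" using 1(6)[OF s] 2(6)[OF t] by simp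
  then have same: "up i = up j" by (auto simp: hs_def split: if_splits)
  then have dist: "j \<noteq> nx i" "nx j \<noteq> i" "nx j \<noteq> nx i"
    using nx_props(2)[OF 1(1)] nx_props(2)[OF 2(1)] inj_onD[OF bij_betw_imp_inj_on[OF nx_bij], of j i] 1(1) 2(1) ij by auto
  have nb: "\<not> (btw i (nx i) j \<longleftrightarrow> btw i (nx i) (nx j))"
    using chords_disjoint[of i "nx i" j "nx j" w] 1(5)[OF s] 2(5)[OF t] 1(1) 2(1) nx_props dist ij by metis
  show up: "up i"
  proof (rule ccontr)
    assume d: "\<not> up i"
    then have nV: "nx i = V i" "nx j = V j" using same by (simp_all add: nx_def)
    have "\<forall>i<n. \<forall>j<n. j \<noteq> i \<and> j \<noteq> V i \<longrightarrow> (btw i (V i) j \<longleftrightarrow> btw i (V i) (V j))"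
      using V(2) unfolding noncrossing_def n_def W_def .
    then have "btw i (V i) j \<longleftrightarrow> btw i (V i) (V j)"
      using 1(1) 2(1) dist(1) ij unfolding nV by blast
    then show False using nb unfolding nV by blast
  qed
  then show upj: "up j" using same by simp
  have nU: "nx i = U i" "nx j = U j" using up upj by (simp_all add: nx_def)
  show "\<exists>k. core_pos E k i \<and> core_pos E k j"
  proof (rule ccontr)
    assume "\<not> (\<exists>k. core_pos E k i \<and> core_pos E k j)"
    from upper_match_noncrossing[OF _ 1(1) 2(1) ij[symmetric] _ this] dist(1) nb
    show False unfolding nU by (simp add: n_def W_def)
  qed
qed

section \<open>Position and transversality of the crossings\<close>

definition base :: "nat \<Rightarrow> nat" where
  "base k = block_start E k + length (snd (snd (E ! k)))"

lemma core_pos_base: "core_pos E k i \<longleftrightarrow> k < length E \<and> base k \<le> i \<and> i \<le> base k + 3"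
  by (auto simp: core_pos_def base_def)

lemma base_less:
  assumes "k < length E"
  shows "base k + 3 < n"
  using block_pos_less[OF assms, of "length (snd (snd (E ! k))) + 3"] unfolding n_def W_def base_def
  by (simp add: block_size_def add.assoc)

lemma W_base:
  assumes "k < length E" "E ! k = (a, b, u)"
  shows "W ! base k = (a, False)" "W ! (base k + 1) = (b, False)" "W ! (base k + 2) = (a, True)" "W ! (base k + 3) = (b, True)"
proof -
  have *: "W ! (base k + d) = comm_word (a, b, u) ! (length u + d)" if "d < 4" for d
    using concat_comm_word_nth[OF assms(1), of "length u + d"] that assms(2)
    unfolding W_def base_def by (simp add: block_size_def add.assoc del: comm_word.simps)
  show "W ! base k = (a, False)" "W ! (base k + 1) = (b, False)" "W ! (base k + 2) = (a, True)" "W ! (base k + 3) = (b, True)"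
    using *[of 0] *[of 1] *[of 2] *[of 3] comm_word_core[OF refl, where u = u and a = a and b = b] by (simp_all del: comm_word.simps)
qed

lemma up_base:
  assumes "k < length E"
  shows "up (base k)" "up (base k + 1)" "\<not> up (base k + 2)" "\<not> up (base k + 3)"
  using W_base[OF assms, of "fst (E ! k)" "fst (snd (E ! k))" "snd (snd (E ! k))"] by (auto simp: up_def)

lemma U_base:
  assumes "k < length E"
  shows "U (base k) = base k + 2" "U (base k + 1) = base k + 3"
  using upper_match_eq[OF assms, of "length (snd (snd (E ! k)))"] upper_match_eq[OF assms, of "length (snd (snd (E ! k))) + 1"]
  by (simp_all add: base_def block_match_def block_size_def add.assoc)

lemma core_up:
  assumes "core_pos E k i" "up i"
  shows "i = base k \<or> i = base k + 1"
proof -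
  have "i = base k \<or> i = base k + 1 \<or> i = base k + 2 \<or> i = base k + 3" and k: "k < length E"
    using assms(1) by (auto simp: core_pos_base)
  then show ?thesis using up_base[OF k] assms(2) by auto
qed

lemma core_pos_unique:
  assumes "core_pos E k i" "core_pos E k' i"
  shows "k = k'"
proof -
  have *: "i = block_start E k + (i - block_start E k)" "i - block_start E k < block_size (E ! k)" "k < length E"
    if "core_pos E k i" for k
    using that by (auto simp: core_pos_def block_size_def)
  show ?thesis using block_pos_unique(1)[OF *(3,2)[OF assms(1)] *(3,2)[OF assms(2)]] *(1)[OF assms(1)] *(1)[OF assms(2)]
    by metis
qed

text \<open>Any further strand through the point shares a core with the first, but a core has only
  two up letters, and a strand passes through a point at most once.\<close>

lemma arc_preim_double:
  assumes "(i, s) \<in> arc_preim q" "(j, t) \<in> arc_preim q" "(i, s) \<noteq> (j, t)"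
  obtains k s' t' where "k < length E" "arc_preim q = {(base k, s'), (base k + 1, t')}"
    "{(i, s), (j, t)} = {(base k, s'), (base k + 1, t')}"
proof -
  note d = double_point[OF assms]
  then obtain k where k: "core_pos E k i" "core_pos E k j" by blast
  have ij: "{i, j} = {base k, base k + 1}" using core_up[OF k(1) d(4)] core_up[OF k(2) d(5)] d(1) by auto
  have sub: "l = base k \<or> l = base k + 1" if l: "(l, u) \<in> arc_preim q" for l u
  proof (cases "l = i")
    case False
    then obtain k' where k': "core_pos E k' i" "core_pos E k' l" using double_point(6)[OF assms(1) l] by auto
    then have "k' = k" using core_pos_unique k(1) by blast
    then show ?thesis using core_up[OF k'(2) double_point(5)[OF assms(1) l]] False by auto
  qed (use ij in auto)
  obtain s' t' where st: "(base k, s') \<in> arc_preim q" "(base k + 1, t') \<in> arc_preim q"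
    using assms(1,2) ij by (auto simp: doubleton_eq_iff)
  have ar: "arc_preim q = {(base k, s'), (base k + 1, t')}"
  proof (intro set_eqI iffI)
    fix p assume p: "p \<in> arc_preim q"
    obtain l u where lu: "p = (l, u)" by (cases p)
    then have l: "(l, u) \<in> arc_preim q" using p by simp
    then show "p \<in> {(base k, s'), (base k + 1, t')}"
      using sub[OF l] arc_preim_unique[OF st(1), of u] arc_preim_unique[OF st(2), of u] unfolding lu by blast
  qed (use st in auto)
  have "(i, s) \<in> {(base k, s'), (base k + 1, t')}" "(j, t) \<in> {(base k, s'), (base k + 1, t')}"
    using assms(1,2) unfolding ar by blast+
  then have "{(i, s), (j, t)} = {(base k, s'), (base k + 1, t')}" using assms(3) by blast
  moreover have "k < length E" using k(1) by (simp add: core_pos_base)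
  ultimately show thesis using that ar by blast
qed

text \<open>The axis of the \<open>k\<close>-th factor has angle \<open>\<beta> k\<close>, and its crossing projects to the point at distance \<open>X\<close>
  from the centre on this axis.\<close>

definition \<beta> :: "nat \<Rightarrow> real" where "\<beta> k = (real (base k) + 3 / 2) * \<epsilon>"
definition X :: real where "X = cos \<epsilon> / cos (\<epsilon> / 2)"

text \<open>Rotated to the axis, the two chords of a commutator are mirror images of each other;
  equating both expressions to zero leaves only the real point \<open>X\<close>.\<close>

lemma side_A:
  "side (real (base k) * \<epsilon>) (real (base k + 2) * \<epsilon>) (cis (\<beta> k) * w) = Re (w * cis (\<epsilon> / 2)) - cos \<epsilon>"
  "side (real (base k + 1) * \<epsilon>) (real (base k + 3) * \<epsilon>) (cis (\<beta> k) * w) = Re (w * cis (- (\<epsilon> / 2))) - cos \<epsilon>"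
proof -
  have m: "cis (\<beta> k) * w * cis x = w * cis (\<beta> k + x)" for x by (simp add: cis_mult[symmetric])
  have "\<beta> k + - (real (base k) * \<epsilon> + real (base k + 2) * \<epsilon>) / 2 = \<epsilon> / 2"
    "\<beta> k + - (real (base k + 1) * \<epsilon> + real (base k + 3) * \<epsilon>) / 2 = - (\<epsilon> / 2)"
    "(real (base k + 2) * \<epsilon> - real (base k) * \<epsilon>) / 2 = \<epsilon>" "(real (base k + 3) * \<epsilon> - real (base k + 1) * \<epsilon>) / 2 = \<epsilon>"
    by (simp_all add: \<beta>_def field_simps)
  then show "side (real (base k) * \<epsilon>) (real (base k + 2) * \<epsilon>) (cis (\<beta> k) * w) = Re (w * cis (\<epsilon> / 2)) - cos \<epsilon>"
    "side (real (base k + 1) * \<epsilon>) (real (base k + 3) * \<epsilon>) (cis (\<beta> k) * w) = Re (w * cis (- (\<epsilon> / 2))) - cos \<epsilon>"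
    unfolding side_def m by (simp_all only:)
qed

lemma eps_half: "0 < \<epsilon> / 2" "\<epsilon> / 2 < pi / 2" "cos (\<epsilon> / 2) > 0" "sin (\<epsilon> / 2) > 0"
proof -
  show "0 < \<epsilon> / 2" "\<epsilon> / 2 < pi / 2" using eps by auto
  then show "cos (\<epsilon> / 2) > 0" "sin (\<epsilon> / 2) > 0" by (auto intro!: cos_gt_zero sin_gt_zero)
qed

lemma chord_diff:
  "pt (base k + 2) - pt (base k) = (2 * sin \<epsilon>) *\<^sub>R (\<i> * cis (\<beta> k - \<epsilon> / 2))"
  "pt (base k + 3) - pt (base k + 1) = (2 * sin \<epsilon>) *\<^sub>R (\<i> * cis (\<beta> k + \<epsilon> / 2))"
proof -
  have "(real (base k + 2) * \<epsilon> - real (base k) * \<epsilon>) / 2 = \<epsilon>" "(real (base k + 3) * \<epsilon> - real (base k + 1) * \<epsilon>) / 2 = \<epsilon>"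
    "(real (base k) * \<epsilon> + real (base k + 2) * \<epsilon>) / 2 = \<beta> k - \<epsilon> / 2"
    "(real (base k + 1) * \<epsilon> + real (base k + 3) * \<epsilon>) / 2 = \<beta> k + \<epsilon> / 2"
    by (simp_all add: \<beta>_def algebra_simps)
  then show "pt (base k + 2) - pt (base k) = (2 * sin \<epsilon>) *\<^sub>R (\<i> * cis (\<beta> k - \<epsilon> / 2))"
    "pt (base k + 3) - pt (base k + 1) = (2 * sin \<epsilon>) *\<^sub>R (\<i> * cis (\<beta> k + \<epsilon> / 2))"
    unfolding pt_def cis_diff by (simp_all only:)
qed

text \<open>The two chord directions differ by the angle \<open>\<epsilon>\<close>, whose sine is
  not zero.\<close>

lemma chord_det:
  "Im (cnj (pt (base k + 2) - pt (base k)) * (pt (base k + 3) - pt (base k + 1))) \<noteq> 0"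
  "Im (cnj (pt (base k + 3) - pt (base k + 1)) * (pt (base k + 2) - pt (base k))) \<noteq> 0"
proof -
  have m: "cnj ((2 * sin \<epsilon>) *\<^sub>R (\<i> * cis x)) * ((2 * sin \<epsilon>) *\<^sub>R (\<i> * cis y)) = (4 * (sin \<epsilon>)\<^sup>2) *\<^sub>R cis (y - x)" for x y
    by (simp add: complex_eq_iff cos_diff sin_diff power2_eq_square algebra_simps)
  have "sin \<epsilon> \<noteq> 0" using eps sin_gt_zero[of \<epsilon>] by auto
  then show "Im (cnj (pt (base k + 2) - pt (base k)) * (pt (base k + 3) - pt (base k + 1))) \<noteq> 0"
    "Im (cnj (pt (base k + 3) - pt (base k + 1)) * (pt (base k + 2) - pt (base k))) \<noteq> 0"
    unfolding chord_diff m by simp_all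
qed

text \<open>The velocity of the strand projects to a positive multiple of the direction of its
  chord, and projection of the upper hemisphere preserves orientation. So the exponent of a letter
  is decided by a planar determinant.\<close>

lemma velocity_sign:
  assumes "(j, \<tau>) \<in> arc_preim (lift w)" "cmod w < 1" "up j" "lift w \<bullet> emb v z = 0"
  shows "\<exists>d>0. lift w \<bullet> cross3 (A' j \<tau>) (emb v z) = d * Im (cnj (pt (U j) - pt j) * v)"
proof -
  note p = arc_point[OF assms(1)[unfolded lift_def]]
  have "\<tau> \<noteq> 0" using p(2) assms(2) by auto
  then have \<tau>: "0 < \<tau>" using p(3) by simp
  interpret chord "pt j" "pt (nx j)" speed by (rule chord_nx[OF p(1)])
  obtain d z' where d: "d > 0" "A' j \<tau> = emb (d *\<^sub>R (pt (U j) - pt j)) z'"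
    using strand'_proj[OF \<tau> p(4), of "hs j"] assms(3) unfolding A'_def nx_def by auto
  have "A j \<tau> = lift w" using assms(1) by (simp add: arc_preim_def)
  then have "lift w \<bullet> A' j \<tau> = 0" using strand_tangent[OF hs(1), of j \<tau>] unfolding A_def A'_def by simp
  then have "lift w \<bullet> cross3 (A' j \<tau>) (emb v z) = Im (cnj (d *\<^sub>R (pt (U j) - pt j)) * v) / sqrt (1 - (cmod w)\<^sup>2)"
    unfolding d(2) by (intro triple_lift assms)
  also have "cnj (d *\<^sub>R (pt (U j) - pt j)) * v = d *\<^sub>R (cnj (pt (U j) - pt j) * v)" by simp
  also have "Im \<dots> / sqrt (1 - (cmod w)\<^sup>2) = (d / sqrt (1 - (cmod w)\<^sup>2)) * Im (cnj (pt (U j) - pt j) * v)"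
    by (simp only: scaleR_complex.sel times_divide_eq_left)
  finally show ?thesis using d(1) norm_less_1_sq[OF assms(2)] by (intro exI[of _ "d / sqrt (1 - (cmod w)\<^sup>2)"]) auto
qed

lemma arc_preim_upper:
  assumes "z > 0" "(j, \<tau>) \<in> arc_preim (emb w z)"
  shows "up j" "cmod w < 1" "emb w z = lift w" "side (real j * \<epsilon>) (real (U j) * \<epsilon>) w = 0"
proof -
  note p = arc_point[OF assms(2)]
  have "\<tau> \<noteq> 0" using p(2) assms(1) by auto
  then have \<tau>: "0 < \<tau>" using p(3) by simp
  show up: "up j" using p(6)[OF \<tau>] assms(1) by (auto simp: hs_def split: if_splits)
  then have seg: "w \<in> open_segment (pt j) (pt (U j))" using p(5)[OF \<tau>] by (simp add: nx_def)
  then show n: "cmod w < 1" using open_segment_norm[OF _ _ seg] by simp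
  have "emb w z \<in> S2" using assms(2) A_S2[OF p(1), of \<tau>] by (simp add: arc_preim_def)
  then show "emb w z = lift w" using emb_eq_lift assms(1) by simp
  have "pt j \<noteq> pt (U j)" using pt_inj[of j "U j"] nx_props(4)[OF p(1)] up p(1) U(1) by (auto simp: nx_def)
  then show "side (real j * \<epsilon>) (real (U j) * \<epsilon>) w = 0"
    using open_segment_iff_side[OF n] seg unfolding pt_def by blast
qed

lemma lift_arc_preim:
  assumes "cmod w < 1" "(j, \<tau>) \<in> arc_preim (lift w)"
  shows "up j" "j < n" "side (real j * \<epsilon>) (real (U j) * \<epsilon>) w = 0"
  using arc_preim_upper[of "sqrt (1 - (cmod w)\<^sup>2)" j \<tau> w] assms norm_less_1_sq[OF assms(1)] arc_point(1)
  by (auto simp: lift_def)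

text \<open>Together with \<open>lift_arc_preim\<close> this reduces incidence with an upper strand
  over the open disc to one affine equation.\<close>

lemma arc_preim_lift_exists:
  assumes "cmod w < 1" "j < n" "up j" "side (real j * \<epsilon>) (real (U j) * \<epsilon>) w = 0"
  shows "\<exists>\<tau>. (j, \<tau>) \<in> arc_preim (lift w)"
proof -
  interpret chord "pt j" "pt (nx j)" speed by (rule chord_nx[OF assms(2)])
  have "w \<in> open_segment (pt j) (pt (nx j))"
    using open_segment_iff_side[OF assms(1)] assms(3,4) PQ unfolding pt_def nx_def by auto
  from strand_surj[OF this] obtain t where "0 < t" "t < 1" "strand 1 speed (pt j) (pt (nx j)) t = lift w" by blast
  then show ?thesis using assms(2,3) by (intro exI[of _ t]) (auto simp: arc_preim_def A_def hs_def)
qed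

lemma double_upper:
  assumes "(i, s) \<in> arc_preim q" "(j, t) \<in> arc_preim q" "(i, s) \<noteq> (j, t)"
  obtains k where "k < length E" "q = lift (cis (\<beta> k) * X)" "cmod (cis (\<beta> k) * X) < 1" "{i, j} = {base k, base k + 1}"
proof -
  obtain k s' t' where k: "k < length E" and ar: "arc_preim q = {(base k, s'), (base k + 1, t')}"
    and ij: "{(i, s), (j, t)} = {(base k, s'), (base k + 1, t')}"
    using arc_preim_double[OF assms] by blast
  obtain w z where q: "q = emb w z" using emb_surj by blast
  have "sgn z = 1"
    using arc_point(6)[OF assms(1)[unfolded q]] double_point(2,4)[OF assms] by (simp add: hs_def)
  then have z: "z > 0" by (simp add: sgn_1_pos)
  note 1 = arc_preim_upper[OF z, of "base k" s' w] and 2 = arc_preim_upper[OF z, of "base k + 1" t' w]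
  have in1: "(base k, s') \<in> arc_preim (emb w z)" and in2: "(base k + 1, t') \<in> arc_preim (emb w z)"
    using ar q by auto
  define w' where "w' = cis (- \<beta> k) * w"
  have w: "w = cis (\<beta> k) * w'" by (simp add: w'_def cis_mult flip: mult.assoc)
  have eqs: "Re (w' * cis (\<epsilon> / 2)) = cos \<epsilon>" "Re (w' * cis (- (\<epsilon> / 2))) = cos \<epsilon>"
    using 1(4)[OF in1] 2(4)[OF in2] side_A[of k w'] unfolding U_base[OF k] w by auto
  have "Re w' * cos (\<epsilon> / 2) = cos \<epsilon>" "Im w' * sin (\<epsilon> / 2) = 0"
    using eqs unfolding times_complex.sel cis.sel cos_minus sin_minus by (simp_all only: mult_minus_right)
  then have "w' = X" using eps_half by (simp add: complex_eq_iff X_def field_simps)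
  then show thesis using that[OF k] 1(2,3)[OF in1] ij w q by (auto simp: doubleton_eq_iff)
qed

lemma doodle: "doodle S curves"
proof (rule doodle_curves)
  fix q
  show "finite (arc_preim q) \<and> card (arc_preim q) \<le> 2"
  proof (cases "\<exists>a b. a \<in> arc_preim q \<and> b \<in> arc_preim q \<and> a \<noteq> b")
    case True
    then obtain i s j t where "(i, s) \<in> arc_preim q" "(j, t) \<in> arc_preim q" "(i, s) \<noteq> (j, t)" by auto
    then obtain a b where "arc_preim q = {a, b}" using arc_preim_double by metis
    then show ?thesis by (simp add: card_insert_if)
  next
    case False
    then have "arc_preim q = {} \<or> (\<exists>a. arc_preim q = {a})" by blast
    then show ?thesis by auto
  qed
next
  fix q i s j t assume *: "(i, s) \<in> arc_preim q" "(j, t) \<in> arc_preim q" "(i, s) \<noteq> (j, t)"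
  obtain k where k: "k < length E" "q = lift (cis (\<beta> k) * X)" and n: "cmod (cis (\<beta> k) * X) < 1"
    and ij: "{i, j} = {base k, base k + 1}"
    by (rule double_upper[OF *])
  note d = double_point[OF *]
  let ?w = "cis (\<beta> k) * complex_of_real X"
  have jn: "j < n" using *(2) by (simp add: arc_preim_def)
  interpret chord "pt j" "pt (nx j)" speed by (rule chord_nx[OF jn])
  have t: "t < 1" using *(2) by (simp add: arc_preim_def)
  obtain c z' where c: "c > 0" "A' j t = emb (c *\<^sub>R (pt (U j) - pt j)) z'"
    using strand'_proj[OF d(3) t, of "hs j"] d(5) unfolding A'_def nx_def by auto
  have "A j t = q" using *(2) by (simp add: arc_preim_def)
  then have "q \<bullet> A' j t = 0" using strand_tangent[OF hs(1), of j t] unfolding A_def A'_def by simp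
  \<comment> \<open>The second strand takes the place of the path, so transversality follows from
    the determinant of the two chords.\<close>
  then have "lift ?w \<bullet> emb (c *\<^sub>R (pt (U j) - pt j)) z' = 0" using c k(2) by simp
  from velocity_sign[OF *(1)[unfolded k(2)] n d(4) this] obtain e where e: "e > 0"
    "q \<bullet> cross3 (A' i s) (A' j t) = e * Im (cnj (pt (U i) - pt i) * (c *\<^sub>R (pt (U j) - pt j)))"
    using c k(2) by auto
  have "Im (cnj (pt (U i) - pt i) * (pt (U j) - pt j)) \<noteq> 0"
    using chord_det[of k] ij unfolding doubleton_eq_iff by (auto simp only: U_base[OF k(1)])
  then have "q \<bullet> cross3 (A' i s) (A' j t) \<noteq> 0" using e c(1) by simp
  then show "cross3 (A' i s) (A' j t) \<noteq> 0" by auto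
qed

end

section \<open>The nooses\<close>

text \<open>This function sets in with slope zero, which lets the stretching of the rope begin at
  the neck without a kink.\<close>

lemma max_sq_deriv: "((\<lambda>t. (max 0 t)\<^sup>2) has_real_derivative 2 * max 0 t) (at t)"
proof -
  have "((\<lambda>t. if t \<in> {0..} then t\<^sup>2 else 0) has_vector_derivative (if t \<in> {0..} then 2 * t else 0)) (at t)"
    by (rule has_vector_derivative_If_within_closures[of t "{0..}" "{..0}"])
      (auto intro!: derivative_eq_intros simp: closure_closed has_real_derivative_iff_has_vector_derivative[symmetric])
  moreover have "(\<lambda>t::real. if t \<in> {0..} then t\<^sup>2 else 0) = (\<lambda>t. (max 0 t)\<^sup>2)" by auto
  moreover have "(if t \<in> {0..} then 2 * t else 0) = 2 * max 0 t" by auto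
  ultimately show ?thesis by (simp add: has_real_derivative_iff_has_vector_derivative)
qed

text \<open>The bounds leave a margin of \<open>pi / 2\<close> around a full turn, which covers the
  angles \<open>\<theta> + \<epsilon> / 2\<close> and \<open>\<theta> - \<epsilon> / 2\<close> that
  occur on a loop.\<close>

lemma cos_zero_cases:
  assumes "cos y = 0" "- (pi / 2) < y" "y < 5 * pi / 2"
  shows "y = pi / 2 \<or> y = 3 * pi / 2"
proof -
  obtain i where i: "odd i" "y = real_of_int i * (pi / 2)" using assms(1) unfolding cos_zero_iff_int by blast
  have "(-1) * (pi / 2) < real_of_int i * (pi / 2)" "real_of_int i * (pi / 2) < 5 * (pi / 2)"
    using assms(2,3) i(2) by simp_all
  then have "-1 < real_of_int i" "real_of_int i < 5" by (simp_all only: mult_less_cancel_right_pos[of "pi / 2"] pi_half_gt_zero)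
  then have "-1 < i" "i < 5" by linarith+
  then have "i = 1 \<or> i = 3" using i(1) by presburger
  then show ?thesis using i(2) by auto
qed

lemma three_halves_pi: "cos (3 * pi / 2) = 0" "sin (3 * pi / 2) = -1"
  using cos_periodic_pi[of "pi / 2"] sin_periodic_pi[of "pi / 2"] by (simp_all add: field_simps)

lemma cos_zero_iff_cases:
  assumes "- (pi / 2) < y" "y < 5 * pi / 2"
  shows "cos y = 0 \<longleftrightarrow> y = pi / 2 \<or> y = 3 * pi / 2"
  using cos_zero_cases[OF _ assms] three_halves_pi(1) cos_pi_half by blast

text \<open>The upper bounds on \<open>\<rho>\<close> keep a head, in this order, beyond all chords
  except the two of its commutator, inside the unit disc, and inside the sector of half angle
  \<open>2 * \<epsilon>\<close> about its axis; the last one makes \<open>X - 2 * \<rho>\<close>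
  positive, so that the rope runs monotonically. \<open>n \<ge> 4\<close> gives
  \<open>4 * \<epsilon> < pi / 2\<close>.\<close>

locale nooses = identity +
  fixes \<rho> :: real
  assumes n4: "n \<ge> 4"
    and \<rho>: "0 < \<rho>" "\<rho> < X - cos (5 * \<epsilon> / 2)" "\<rho> < 1 - X" "\<rho> < X * sin (2 * \<epsilon>)" "\<rho> < X / 2"
begin

text \<open>On the unit disc this is affine, with image the disc of radius \<open>\<rho>\<close> around \<open>X\<close>; the quadratic term, which is
  \<open>0\<close> to first order at the neck, stretches the rope until it reaches the origin.\<close>

definition F :: "complex \<Rightarrow> complex" where
  "F z = of_real X - of_real \<rho> * z - of_real ((X - 2 * \<rho>) * (max 0 (Re z - 1))\<^sup>2)"

definition F' :: "complex \<Rightarrow> complex \<Rightarrow> complex" where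
  "F' z v = - of_real \<rho> * v - of_real ((X - 2 * \<rho>) * (2 * max 0 (Re z - 1)) * Re v)"

definition G :: "real \<Rightarrow> real" where
  "G s = X - \<rho> * s - (X - 2 * \<rho>) * (s - 1)\<^sup>2"

definition noose :: "nat \<Rightarrow> complex \<Rightarrow> real^3" where
  "noose k z = lift (cis (\<beta> k) * F z)"

lemma X: "0 < X" "X < 1" "2 * \<rho> < X"
  using \<rho> by auto

lemma F_has_derivative: "(F has_derivative F' z) (at z)"
proof -
  have 1: "((\<lambda>z. Re z - 1) has_derivative Re) (at z)" by (auto intro!: derivative_eq_intros)
  have 2: "((\<lambda>t. (max 0 t)\<^sup>2) has_derivative (*) (2 * max 0 (Re z - 1))) (at (Re z - 1))"
    using max_sq_deriv[of "Re z - 1"] by (simp add: has_field_derivative_def)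
  from has_derivative_compose[OF 1 2]
  have 3: "((\<lambda>z. (max 0 (Re z - 1))\<^sup>2) has_derivative (\<lambda>v. 2 * max 0 (Re z - 1) * Re v)) (at z)" .
  have "(F has_derivative (\<lambda>v. 0 - of_real \<rho> * v - of_real ((X - 2 * \<rho>) * (2 * max 0 (Re z - 1) * Re v)))) (at z)"
    unfolding F_def[abs_def]
    by (intro has_derivative_diff has_derivative_const has_derivative_mult_right has_derivative_of_real 3 has_derivative_ident)
  then show ?thesis by (rule has_derivative_eq_rhs) (auto simp: F'_def fun_eq_iff)
qed

text \<open>The minus sign is a half turn: orientation is kept, and the neck becomes the point of
  the head nearest to the centre of the unit disc.\<close>

lemma F_disc: "z \<in> cball 0 1 \<Longrightarrow> F z = of_real X - of_real \<rho> * z"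
  "z \<in> cball 0 1 \<Longrightarrow> F' z v = - of_real \<rho> * v"
  using complex_Re_le_cmod[of z] by (auto simp: F_def F'_def max_def)

lemma F_rope: "1 \<le> s \<Longrightarrow> F (of_real s) = of_real (G s)"
  "1 \<le> s \<Longrightarrow> F' (of_real s) 1 = - of_real (\<rho> + 2 * (X - 2 * \<rho>) * (s - 1))"
  by (auto simp: F_def F'_def G_def max_def algebra_simps)

lemma G_ends [simp]: "G 1 = X - \<rho>" "G 2 = 0"
  by (simp_all add: G_def)

lemma G_less:
  assumes "1 \<le> s" "s < t"
  shows "G t < G s"
proof -
  have "(s - 1)\<^sup>2 \<le> (t - 1)\<^sup>2" using assms by (intro power_mono) auto
  then have "(X - 2 * \<rho>) * (s - 1)\<^sup>2 \<le> (X - 2 * \<rho>) * (t - 1)\<^sup>2" using X(3) by (intro mult_left_mono) auto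
  moreover have "\<rho> * s < \<rho> * t" using assms \<rho>(1) by simp
  ultimately show ?thesis by (simp add: G_def)
qed

lemma G_range:
  assumes "1 \<le> s" "s \<le> 2"
  shows "0 \<le> G s" "G s \<le> X - \<rho>" "1 < s \<Longrightarrow> G s < X - \<rho>" "s < 2 \<Longrightarrow> 0 < G s"
  using G_less[of s 2] G_less[of 1 s] assms by (auto simp: order_le_less)

lemma norm_F_disc:
  assumes "z \<in> cball 0 1"
  shows "cmod (F z) < 1"
proof -
  have "cmod (F z) \<le> X + \<rho> * cmod z"
    unfolding F_disc(1)[OF assms] using norm_triangle_ineq4[of "of_real X" "of_real \<rho> * z"] X(1) \<rho>(1)
    by (simp add: norm_mult)
  also have "\<dots> \<le> X + \<rho> * 1" using assms \<rho>(1) by (intro add_left_mono mult_left_mono) auto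
  finally show ?thesis using \<rho>(3) by simp
qed

lemma norm_F:
  assumes "z \<in> noose_dom"
  shows "cmod (F z) < 1"
proof (cases "z \<in> cball 0 1")
  case False
  then obtain s where "1 \<le> s" "s \<le> 2" "z = of_real s" using assms by (auto simp: noose_dom_def)
  then show ?thesis using G_range[of s] F_rope(1)[of s] X \<rho>(1) by simp
qed (rule norm_F_disc)

lemma norm_rot [simp]: "cmod (cis t * w) = cmod w"
  by (simp add: norm_mult)

lemma cis_cancel [simp]: "cis t * w = cis t * w' \<longleftrightarrow> w = w'"
  by (simp add: cis_neq_zero)

lemma noose_dom_disc: "z \<in> cball 0 1 \<Longrightarrow> z \<in> noose_dom"
  and noose_dom_rope: "1 \<le> s \<Longrightarrow> s \<le> 2 \<Longrightarrow> of_real s \<in> noose_dom"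
  by (auto simp: noose_dom_def)

text \<open>Real values taken on the disc are at least \<open>X - \<rho>\<close>, values on the rope
  at most that, with equality only at the neck; along the rope \<open>G\<close> decreases
  strictly.\<close>

lemma inj_on_F: "inj_on F noose_dom"
proof -
  have 1: "z = of_real s" if z: "z \<in> cball 0 1" and s: "1 \<le> s" "s \<le> 2" and eq: "F z = F (of_real s)" for z s
  proof -
    have "of_real X - of_real \<rho> * z = of_real (G s)" using eq F_disc(1)[OF z] F_rope(1)[OF s(1)] by simp
    then have e: "X - \<rho> * Re z = G s" "Im z = 0" using \<rho>(1) by (auto simp: complex_eq_iff)
    have "Re z \<le> 1" using z complex_Re_le_cmod[of z] by simp
    then have "\<rho> * Re z \<le> \<rho> * 1" using \<rho>(1) by (intro mult_left_mono) auto
    then have "s = 1" using G_range(3)[OF s] s e(1) by fastforce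
    then show ?thesis using e \<rho>(1) by (simp add: complex_eq_iff)
  qed
  show ?thesis
  proof (rule inj_onI)
    fix z z' assume "z \<in> noose_dom" "z' \<in> noose_dom" and eq: "F z = F z'"
    then consider "z \<in> cball 0 1" "z' \<in> cball 0 1" | s where "z \<in> cball 0 1" "1 \<le> s" "s \<le> 2" "z' = of_real s"
      | s where "z' \<in> cball 0 1" "1 \<le> s" "s \<le> 2" "z = of_real s"
      | s t where "1 \<le> s" "s \<le> 2" "z = of_real s" "1 \<le> t" "t \<le> 2" "z' = of_real t"
      by (auto simp: noose_dom_def)
    then show "z = z'"
    proof cases
      case 1
      then show ?thesis using eq F_disc(1)[of z] F_disc(1)[of z'] \<rho>(1) by simp
    next
      case (2 s)
      then show ?thesis using 1[of z s] eq by simp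
    next
      case (3 s)
      then show ?thesis using 1[of z' s] eq by simp
    next
      case (4 s t)
      then have "G s = G t" using eq F_rope(1)[of s] F_rope(1)[of t] by simp
      then show ?thesis using G_less[of s t] G_less[of t s] 4 by (cases s t rule: linorder_cases) auto
    qed
  qed
qed

lemma noose_has_derivative:
  assumes "z \<in> noose_dom"
  shows "(noose k has_derivative (\<lambda>v. emb (cis (\<beta> k) * F' z v)
     (- ((cis (\<beta> k) * F z) \<bullet> (cis (\<beta> k) * F' z v)) / sqrt (1 - (cmod (F z))\<^sup>2)))) (at z)"
proof -
  have 1: "((\<lambda>z. cis (\<beta> k) * F z) has_derivative (\<lambda>v. cis (\<beta> k) * F' z v)) (at z)"
    by (rule has_derivative_mult_right) (rule F_has_derivative)
  have "cmod (cis (\<beta> k) * F z) < 1" using norm_F[OF assms] by simp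
  from has_derivative_compose[OF 1 lift_has_derivative[OF this]]
  show ?thesis unfolding noose_def[abs_def] norm_rot .
qed

lemma Dn_noose:
  assumes "z \<in> noose_dom"
  shows "Dn (noose k) z v = emb (cis (\<beta> k) * F' z v)
     (- ((cis (\<beta> k) * F z) \<bullet> (cis (\<beta> k) * F' z v)) / sqrt (1 - (cmod (F z))\<^sup>2))"
  unfolding Dn_def frechet_derivative_at[OF noose_has_derivative[OF assms], symmetric] ..

lemma noose_tangent:
  assumes "z \<in> noose_dom"
  shows "noose k z \<bullet> Dn (noose k) z v = 0"
  unfolding Dn_noose[OF assms] noose_def lift_def inner_emb norm_rot
  using norm_less_1_sq[OF norm_F[OF assms]] by simp

lemma noose_embedding: "noose_embedding (noose k)"
  unfolding noose_embedding_def
proof (intro conjI ballI)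
  show "inj_on (noose k) noose_dom"
  proof (rule inj_onI)
    fix x y assume xy: "x \<in> noose_dom" "y \<in> noose_dom" and "noose k x = noose k y"
    then have "F x = F y" by (simp add: noose_def)
    then show "x = y" using inj_onD[OF inj_on_F] xy by blast
  qed
  show "noose k ` noose_dom \<subseteq> S2"
  proof
    fix q assume "q \<in> noose k ` noose_dom"
    then obtain z where z: "z \<in> noose_dom" "q = lift (cis (\<beta> k) * F z)" by (auto simp: noose_def)
    then show "q \<in> S2" using norm_F[OF z(1)] lift_S2[of "cis (\<beta> k) * F z"] by simp
  qed
  show "noose k differentiable (at z)" if "z \<in> noose_dom" for z
    using noose_has_derivative[OF that] by (auto simp: differentiable_def)
  show "noose k z \<bullet> cross3 (Dn (noose k) z 1) (Dn (noose k) z \<i>) > 0" if z: "z \<in> cball 0 1" for z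
  proof -
    note d = noose_dom_disc[OF z]
    let ?a = "\<lambda>v. cis (\<beta> k) * F' z v" and ?w = "cis (\<beta> k) * F z"
    let ?b = "\<lambda>v. - (?w \<bullet> ?a v) / sqrt (1 - (cmod (F z))\<^sup>2)"
    have n: "cmod ?w < 1" using norm_F[OF d] by simp
    have "lift ?w \<bullet> emb (?a v) (?b v) = 0" for v
      using noose_tangent[OF d, of k v] unfolding Dn_noose[OF d] noose_def .
    from triple_lift[OF n this this]
    have "lift ?w \<bullet> cross3 (emb (?a 1) (?b 1)) (emb (?a \<i>) (?b \<i>)) = Im (cnj (?a 1) * ?a \<i>) / sqrt (1 - (cmod ?w)\<^sup>2)" .
    \<comment> \<open>The rotation by \<open>\<beta> k\<close> and the half turn drop out of the
      determinant, which leaves \<open>\<rho>\<^sup>2\<close>.\<close>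
    also have "cnj (?a 1) * ?a \<i> = of_real (\<rho>\<^sup>2) * (cnj (cis (\<beta> k)) * cis (\<beta> k)) * \<i>"
      unfolding F_disc(2)[OF z] by (simp add: power2_eq_square)
    also have "cnj (cis (\<beta> k)) * cis (\<beta> k) = 1" by (simp add: cis_cnj cis_mult)
    finally show ?thesis unfolding Dn_noose[OF d] noose_def using norm_less_1_sq[OF n] \<rho>(1) by simp
  qed
  show "Dn (noose k) (of_real s) 1 \<noteq> 0" if s: "s \<in> {1..2}" for s
  proof -
    have d: "of_real s \<in> noose_dom" using s by (auto simp: noose_dom_def)
    have "\<rho> + 2 * (X - 2 * \<rho>) * (s - 1) > 0" using \<rho>(1) X(3) s by (intro add_pos_nonneg) auto
    moreover have "F' (of_real s) 1 = - of_real (\<rho> + 2 * (X - 2 * \<rho>) * (s - 1))"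
      using F_rope(2)[of s] s by simp
    ultimately have "F' (of_real s) 1 \<noteq> 0"
      by (metis neg_equal_0_iff_equal of_real_eq_0_iff less_irrefl)
    then show ?thesis using d by (simp add: Dn_noose cis_neq_zero)
  qed
qed

lemma root_noose: "root (noose k) = lift 0"
  using F_rope(1)[of 2] by (simp add: root_def noose_def)

section \<open>The heads and the commutators\<close>

lemma eps_n: "4 * \<epsilon> < pi / 2" "cos (5 * \<epsilon> / 2) > 0"
proof -
  have "4 * \<epsilon> \<le> real n * \<epsilon>" using n4 eps(1) by (intro mult_right_mono) auto
  then show *: "4 * \<epsilon> < pi / 2" using eps(2) by simp
  show "cos (5 * \<epsilon> / 2) > 0" using * eps(1) by (intro cos_gt_zero_pi) auto
qed

lemma U_core:
  assumes "core_pos E k (U i)" "i < n"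
  shows "core_pos E k i"
proof -
  have k: "k < length E" using assms(1) by (simp add: core_pos_base)
  have b: "base k + 3 < n" by (rule base_less[OF k])
  have UU: "U (base k + 2) = base k" "U (base k + 3) = base k + 1"
    using U(2)[of "base k"] U(2)[of "base k + 1"] U_base[OF k] b by auto
  have "U i = base k \<or> U i = base k + 1 \<or> U i = base k + 2 \<or> U i = base k + 3"
    using assms(1) by (auto simp: core_pos_base)
  then have "U (U i) = base k + 2 \<or> U (U i) = base k + 3 \<or> U (U i) = base k \<or> U (U i) = base k + 1"
    using U_base[OF k] UU by auto
  then show ?thesis using U(2)[OF assms(2)] k by (auto simp: core_pos_base)
qed

text \<open>Measured from the axis in steps of \<open>\<epsilon>\<close>, the core reaches up to
  \<open>3 / 2\<close> on either side, so every other point is at least \<open>5 / 2\<close> steps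
  away.\<close>

lemma far_from_core:
  assumes "i < n" "k < length E" "\<not> core_pos E k i"
  shows "Re (cis (- \<beta> k) * pt i) \<le> cos (5 * \<epsilon> / 2)"
proof -
  let ?d = "\<bar>real i - (real (base k) + 3 / 2)\<bar>"
  have "i < base k \<or> i > base k + 3" using assms by (auto simp: core_pos_base)
  then have "5 / 2 \<le> ?d" by linarith
  then have 1: "5 * \<epsilon> / 2 \<le> ?d * \<epsilon>" using eps(1) by (simp add: field_simps)
  have "?d \<le> real n" using assms(1) base_less[OF assms(2)] by linarith
  from eps_bound[of ?d] this have 2: "?d * \<epsilon> < pi / 2" by simp
  have "Re (cis (- \<beta> k) * pt i) = cos ((real i - (real (base k) + 3 / 2)) * \<epsilon>)"
    unfolding pt_def cis_mult \<beta>_def by (simp add: algebra_simps)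
  also have "\<dots> = cos (?d * \<epsilon>)" by (simp add: abs_if left_diff_distrib) (metis cos_minus minus_diff_eq)
  also have "\<dots> \<le> cos (5 * \<epsilon> / 2)" using 1 2 eps(1) pi_gt_zero by (intro cos_monotone_0_pi_le) linarith+
  finally show ?thesis .
qed

lemma pt_U: "i < n \<Longrightarrow> up i \<Longrightarrow> pt i \<noteq> pt (U i)"
  using pt_inj[of i "U i"] U(1) up_match(1) by metis

text \<open>By convexity a chord with both ends outside the core has axial coordinate at most
  \<open>cos (5 * \<epsilon> / 2)\<close>, whereas the head begins at
  \<open>X - \<rho>\<close>.\<close>

lemma head_strand:
  assumes "k < length E" "(j, \<tau>) \<in> arc_preim (noose k z)" "z \<in> cball 0 1"
  shows "j = base k \<or> j = base k + 1"
proof -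
  let ?w = "cis (\<beta> k) * F z"
  have n: "cmod ?w < 1" using norm_F_disc[OF assms(3)] by simp
  note j = lift_arc_preim[OF n assms(2)[unfolded noose_def]]
  have "core_pos E k j"
  proof (rule ccontr)
    assume c: "\<not> core_pos E k j"
    then have c': "\<not> core_pos E k (U j)" using U_core j(2) by blast
    have "?w \<in> open_segment (pt j) (pt (U j))"
      using open_segment_iff_side[OF n] j(3) pt_U[OF j(2,1)] unfolding pt_def by blast
    then obtain u where u: "0 < u" "u < 1" "?w = (1 - u) *\<^sub>R pt j + u *\<^sub>R pt (U j)" by (auto simp: in_segment)
    have "F z = cis (- \<beta> k) * ?w" by (simp add: cis_mult flip: mult.assoc)
    also have "Re \<dots> = (1 - u) * Re (cis (- \<beta> k) * pt j) + u * Re (cis (- \<beta> k) * pt (U j))"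
      unfolding u(3) by (simp add: algebra_simps)
    also have "\<dots> \<le> (1 - u) * cos (5 * \<epsilon> / 2) + u * cos (5 * \<epsilon> / 2)"
      using far_from_core[OF j(2) assms(1) c] far_from_core[OF U(1)[OF j(2)] assms(1) c'] u
      by (intro add_mono mult_left_mono) auto
    finally have "Re (F z) \<le> cos (5 * \<epsilon> / 2)" by (simp add: algebra_simps)
    moreover have "Re z \<le> 1" using assms(3) complex_Re_le_cmod[of z] by simp
    then have "\<rho> * Re z \<le> \<rho> * 1" using \<rho>(1) by (intro mult_left_mono) auto
    then have "Re (F z) \<ge> X - \<rho>" unfolding F_disc(1)[OF assms(3)] by simp
    ultimately show False using \<rho>(2) by simp
  qed
  then show ?thesis using core_up j(1) by blast
qed

lemma X_cos: "X * cos (\<epsilon> / 2) = cos \<epsilon>"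
  using eps_half by (simp add: X_def)

text \<open>In the coordinate \<open>z\<close> of the head both chords become diameters, because the
  head is centred at their intersection.\<close>

lemma side_disc:
  "side (real (base k) * \<epsilon>) (real (base k + 2) * \<epsilon>) (cis (\<beta> k) * (of_real X - of_real \<rho> * z)) = - \<rho> * Re (z * cis (\<epsilon> / 2))"
  "side (real (base k + 1) * \<epsilon>) (real (base k + 3) * \<epsilon>) (cis (\<beta> k) * (of_real X - of_real \<rho> * z)) = - \<rho> * Re (z * cis (- (\<epsilon> / 2)))"
  unfolding side_A X_cos[symmetric] by (simp_all add: algebra_simps)

lemma head_strand_iff:
  assumes "k < length E" "z \<in> cball 0 1"
  shows "(\<exists>\<tau>. (base k, \<tau>) \<in> arc_preim (noose k z)) \<longleftrightarrow> Re (z * cis (\<epsilon> / 2)) = 0"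
    "(\<exists>\<tau>. (base k + 1, \<tau>) \<in> arc_preim (noose k z)) \<longleftrightarrow> Re (z * cis (- (\<epsilon> / 2))) = 0"
proof -
  let ?w = "cis (\<beta> k) * F z"
  have n: "cmod ?w < 1" using norm_F_disc[OF assms(2)] by simp
  have b: "base k < n" "base k + 1 < n" using base_less[OF assms(1)] by auto
  note s = side_disc[of k z] F_disc(1)[OF assms(2)]
  show "(\<exists>\<tau>. (base k, \<tau>) \<in> arc_preim (noose k z)) \<longleftrightarrow> Re (z * cis (\<epsilon> / 2)) = 0"
    using lift_arc_preim(3)[OF n, of "base k"] arc_preim_lift_exists[OF n b(1) up_base(1)[OF assms(1)]]
    unfolding noose_def U_base[OF assms(1)] s using \<rho>(1) by auto
  show "(\<exists>\<tau>. (base k + 1, \<tau>) \<in> arc_preim (noose k z)) \<longleftrightarrow> Re (z * cis (- (\<epsilon> / 2))) = 0"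
    using lift_arc_preim(3)[OF n, of "base k + 1"] arc_preim_lift_exists[OF n b(2) up_base(2)[OF assms(1)]]
    unfolding noose_def U_base[OF assms(1)] s using \<rho>(1) by auto
qed

lemma head_dimage:
  assumes "k < length E" "z \<in> cball 0 1"
  shows "noose k z \<in> dimage curves \<longleftrightarrow> Re (z * cis (\<epsilon> / 2)) = 0 \<or> Re (z * cis (- (\<epsilon> / 2))) = 0"
  unfolding dimage_curves using head_strand_iff[OF assms] head_strand[OF assms(1) _ assms(2)] by fastforce

lemma cis_disc: "cis \<theta> \<in> cball 0 1"
  by simp

lemma sin_eps: "sin \<epsilon> > 0"
  using eps by (intro sin_gt_zero) auto

lemma loop_velocity_sign:
  assumes "(j, \<tau>) \<in> arc_preim (loop_path (noose k) \<theta>)" "up j"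
  shows "\<exists>d>0. loop_path (noose k) \<theta> \<bullet> cross3 (A' j \<tau>) (loop_vel (noose k) \<theta>)
     = d * Im (cnj (pt (U j) - pt j) * (- (cis (\<beta> k) * (\<i> * cis \<theta>))))"
proof -
  have d: "cis \<theta> \<in> noose_dom" by (rule noose_dom_disc[OF cis_disc])
  have n: "cmod (cis (\<beta> k) * F (cis \<theta>)) < 1" using norm_F[OF d] by simp
  have t: "lift (cis (\<beta> k) * F (cis \<theta>)) \<bullet> Dn (noose k) (cis \<theta>) (\<i> * cis \<theta>) = 0"
    using noose_tangent[OF d] unfolding noose_def .
  from velocity_sign[OF assms(1)[unfolded loop_path_def noose_def] n assms(2) t[unfolded Dn_noose[OF d]]]
  obtain c where "c > 0" "loop_path (noose k) \<theta> \<bullet> cross3 (A' j \<tau>) (loop_vel (noose k) \<theta>)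
     = c * Im (cnj (pt (U j) - pt j) * (cis (\<beta> k) * F' (cis \<theta>) (\<i> * cis \<theta>)))"
    unfolding loop_vel_def Dn_noose[OF d] loop_path_def noose_def[symmetric] by blast
  then show ?thesis using \<rho>(1) unfolding F_disc(2)[OF cis_disc]
    by (intro exI[of _ "c * \<rho>"]) (simp add: algebra_simps)
qed

text \<open>The sine takes opposite values at the two ends of a diameter, which gives the two
  letters of one strand opposite exponents.\<close>

lemma loop_det:
  "Im (cnj (pt (base k + 2) - pt (base k)) * (- (cis (\<beta> k) * (\<i> * cis \<theta>)))) = - 2 * sin \<epsilon> * sin (\<theta> + \<epsilon> / 2)"
  "Im (cnj (pt (base k + 3) - pt (base k + 1)) * (- (cis (\<beta> k) * (\<i> * cis \<theta>)))) = - 2 * sin \<epsilon> * sin (\<theta> - \<epsilon> / 2)"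
proof -
  have m: "cnj (a *\<^sub>R (\<i> * cis x)) * (- (cis y * (\<i> * cis z))) = (- a) *\<^sub>R cis (y + z - x)" for a x y z
  proof -
    have "cnj (a *\<^sub>R (\<i> * cis x)) * (- (cis y * (\<i> * cis z))) = (- a) *\<^sub>R (cis (- x) * (cis y * cis z))"
      by (simp add: cis_cnj complex_eq_iff algebra_simps)
    then show ?thesis by (simp add: cis_mult algebra_simps)
  qed
  have "\<beta> k + \<theta> - (\<beta> k - \<epsilon> / 2) = \<theta> + \<epsilon> / 2" "\<beta> k + \<theta> - (\<beta> k + \<epsilon> / 2) = \<theta> - \<epsilon> / 2" by simp_all
  then show "Im (cnj (pt (base k + 2) - pt (base k)) * (- (cis (\<beta> k) * (\<i> * cis \<theta>)))) = - 2 * sin \<epsilon> * sin (\<theta> + \<epsilon> / 2)"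
    "Im (cnj (pt (base k + 3) - pt (base k + 1)) * (- (cis (\<beta> k) * (\<i> * cis \<theta>)))) = - 2 * sin \<epsilon> * sin (\<theta> - \<epsilon> / 2)"
    unfolding chord_diff m by simp_all
qed

lemma Re_cis_mult: "Re (cis a * cis b) = cos (a + b)"
  by (simp add: cis_mult)

lemma not_both_strands:
  assumes "cos (\<theta> + \<epsilon> / 2) = 0" "cos (\<theta> - \<epsilon> / 2) = 0"
  shows False
proof -
  have "sin (\<theta> + \<epsilon> / 2) * cos (\<theta> - \<epsilon> / 2) - cos (\<theta> + \<epsilon> / 2) * sin (\<theta> - \<epsilon> / 2) = sin ((\<theta> + \<epsilon> / 2) - (\<theta> - \<epsilon> / 2))"
    unfolding sin_diff[symmetric] ..
  then show False using assms sin_eps by simp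
qed

lemma loop_hit:
  assumes k: "k < length E" "E ! k = (a, b, u)"
  shows "cos (\<theta> + \<epsilon> / 2) = 0 \<Longrightarrow> \<exists>\<tau>. arc_preim (loop_path (noose k) \<theta>) = {(base k, \<tau>)} \<and>
      loop_path (noose k) \<theta> \<bullet> cross3 (A' (base k) \<tau>) (loop_vel (noose k) \<theta>) \<noteq> 0 \<and>
      dletter curves (loop_path (noose k) \<theta>) (loop_vel (noose k) \<theta>) = (a, sin (\<theta> + \<epsilon> / 2) < 0)"
    "cos (\<theta> - \<epsilon> / 2) = 0 \<Longrightarrow> \<exists>\<tau>. arc_preim (loop_path (noose k) \<theta>) = {(base k + 1, \<tau>)} \<and>
      loop_path (noose k) \<theta> \<bullet> cross3 (A' (base k + 1) \<tau>) (loop_vel (noose k) \<theta>) \<noteq> 0 \<and>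
      dletter curves (loop_path (noose k) \<theta>) (loop_vel (noose k) \<theta>) = (b, sin (\<theta> - \<epsilon> / 2) < 0)"
proof -
  let ?q = "loop_path (noose k) \<theta>" and ?v = "loop_vel (noose k) \<theta>"
  have iff: "(\<exists>\<tau>. (base k, \<tau>) \<in> arc_preim ?q) \<longleftrightarrow> cos (\<theta> + \<epsilon> / 2) = 0"
    "(\<exists>\<tau>. (base k + 1, \<tau>) \<in> arc_preim ?q) \<longleftrightarrow> cos (\<theta> - \<epsilon> / 2) = 0"
    using head_strand_iff[OF k(1) cis_disc, of \<theta>] unfolding loop_path_def Re_cis_mult by simp_all
  have only: "j = base k \<or> j = base k + 1" if "(j, \<tau>) \<in> arc_preim ?q" for j \<tau>
    using head_strand[OF k(1) that[unfolded loop_path_def] cis_disc] .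
  have lab: "lab (base k) = a" "lab (base k + 1) = b" unfolding lab_def using W_base[OF k] by auto
  {
    assume z: "cos (\<theta> + \<epsilon> / 2) = 0"
    then obtain \<tau> where \<tau>: "(base k, \<tau>) \<in> arc_preim ?q" using iff(1) by blast
    have "arc_preim ?q = {(base k, \<tau>)}"
    proof (intro set_eqI iffI)
      fix p assume p: "p \<in> arc_preim ?q"
      obtain j t where jt: "p = (j, t)" by (cases p)
      have "j = base k" using only[OF p[unfolded jt]] p jt iff(2) z not_both_strands by blast
      then show "p \<in> {(base k, \<tau>)}" using arc_preim_unique[OF \<tau>] p jt by auto
    qed (use \<tau> in auto)
    moreover have "sin (\<theta> + \<epsilon> / 2) \<noteq> 0" using z sin_cos_squared_add[of "\<theta> + \<epsilon> / 2"] by auto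
    moreover from loop_velocity_sign[OF \<tau> up_base(1)[OF k(1)]] obtain d where "d > 0"
      "?q \<bullet> cross3 (A' (base k) \<tau>) ?v = d * (- 2 * sin \<epsilon> * sin (\<theta> + \<epsilon> / 2))"
      unfolding U_base[OF k(1)] loop_det by blast
    ultimately show "\<exists>\<tau>. arc_preim ?q = {(base k, \<tau>)} \<and>
        ?q \<bullet> cross3 (A' (base k) \<tau>) ?v \<noteq> 0 \<and> dletter curves ?q ?v = (a, sin (\<theta> + \<epsilon> / 2) < 0)"
      using sin_eps by (intro exI[of _ \<tau>]) (auto simp: dletter_curves lab lab[unfolded Suc_eq_plus1[symmetric]] mult_less_0_iff zero_less_mult_iff)
  }
  {
    assume z: "cos (\<theta> - \<epsilon> / 2) = 0"
    then obtain \<tau> where \<tau>: "(base k + 1, \<tau>) \<in> arc_preim ?q" using iff(2) by blast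
    have "arc_preim ?q = {(base k + 1, \<tau>)}"
    proof (intro set_eqI iffI)
      fix p assume p: "p \<in> arc_preim ?q"
      obtain j t where jt: "p = (j, t)" by (cases p)
      have "j = base k + 1" using only[OF p[unfolded jt]] p jt iff(1) z not_both_strands by blast
      then show "p \<in> {(base k + 1, \<tau>)}" using arc_preim_unique[OF \<tau>] p jt by auto
    qed (use \<tau> in auto)
    moreover have "sin (\<theta> - \<epsilon> / 2) \<noteq> 0" using z sin_cos_squared_add[of "\<theta> - \<epsilon> / 2"] by auto
    moreover from loop_velocity_sign[OF \<tau> up_base(2)[OF k(1)]] obtain d where "d > 0"
      "?q \<bullet> cross3 (A' (base k + 1) \<tau>) ?v = d * (- 2 * sin \<epsilon> * sin (\<theta> - \<epsilon> / 2))"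
      unfolding U_base[OF k(1)] loop_det by blast
    ultimately show "\<exists>\<tau>. arc_preim ?q = {(base k + 1, \<tau>)} \<and>
        ?q \<bullet> cross3 (A' (base k + 1) \<tau>) ?v \<noteq> 0 \<and> dletter curves ?q ?v = (b, sin (\<theta> - \<epsilon> / 2) < 0)"
      using sin_eps by (intro exI[of _ \<tau>]) (auto simp: dletter_curves lab lab[unfolded Suc_eq_plus1[symmetric]] mult_less_0_iff zero_less_mult_iff)
  }
qed

text \<open>The diameters are tilted by \<open>\<epsilon> / 2\<close> in opposite directions, so the
  loop meets the two strands alternately, as a commutator demands.\<close>

lemma loop_times:
  assumes "k < length E" "0 \<le> \<theta>" "\<theta> \<le> 2 * pi"
  shows "loop_path (noose k) \<theta> \<in> dimage curves \<longleftrightarrow>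
     \<theta> \<in> {pi / 2 - \<epsilon> / 2, pi / 2 + \<epsilon> / 2, 3 * pi / 2 - \<epsilon> / 2, 3 * pi / 2 + \<epsilon> / 2}"
proof -
  have "cos (\<theta> + \<epsilon> / 2) = 0 \<longleftrightarrow> \<theta> + \<epsilon> / 2 = pi / 2 \<or> \<theta> + \<epsilon> / 2 = 3 * pi / 2"
    using assms(2,3) eps_half(1,2) pi_gt_zero by (intro cos_zero_iff_cases) linarith+
  moreover have "cos (\<theta> - \<epsilon> / 2) = 0 \<longleftrightarrow> \<theta> - \<epsilon> / 2 = pi / 2 \<or> \<theta> - \<epsilon> / 2 = 3 * pi / 2"
    using assms(2,3) eps_half(1,2) pi_gt_zero by (intro cos_zero_iff_cases) linarith+
  moreover have "loop_path (noose k) \<theta> \<in> dimage curves \<longleftrightarrow> cos (\<theta> + \<epsilon> / 2) = 0 \<or> cos (\<theta> - \<epsilon> / 2) = 0"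
    using head_dimage[OF assms(1) cis_disc, of \<theta>] unfolding loop_path_def Re_cis_mult by simp
  ultimately show ?thesis by auto
qed

lemma loop_list:
  assumes "k < length E"
  shows "sorted_list_of_set {\<theta> \<in> {0..<2 * pi}. loop_path (noose k) \<theta> \<in> dimage curves}
     = [pi / 2 - \<epsilon> / 2, pi / 2 + \<epsilon> / 2, 3 * pi / 2 - \<epsilon> / 2, 3 * pi / 2 + \<epsilon> / 2]" (is "sorted_list_of_set ?A = ?l")
proof -
  have e: "0 < \<epsilon> / 2" "\<epsilon> / 2 < pi / 2" by (rule eps_half)+
  have sub: "set ?l \<subseteq> {0..<2 * pi}" using e by auto
  then have A: "?A = set ?l" using loop_times[OF assms] by auto
  have "sorted ?l" "distinct ?l" using e by auto
  then show ?thesis unfolding A by (rule sorted_list_of_set.idem_if_sorted_distinct)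
qed

lemma loop_letters:
  assumes k: "k < length E" "E ! k = (a, b, u)"
  shows "dletter curves (loop_path (noose k) (pi / 2 - \<epsilon> / 2)) (loop_vel (noose k) (pi / 2 - \<epsilon> / 2)) = (a, False)"
    "dletter curves (loop_path (noose k) (pi / 2 + \<epsilon> / 2)) (loop_vel (noose k) (pi / 2 + \<epsilon> / 2)) = (b, False)"
    "dletter curves (loop_path (noose k) (3 * pi / 2 - \<epsilon> / 2)) (loop_vel (noose k) (3 * pi / 2 - \<epsilon> / 2)) = (a, True)"
    "dletter curves (loop_path (noose k) (3 * pi / 2 + \<epsilon> / 2)) (loop_vel (noose k) (3 * pi / 2 + \<epsilon> / 2)) = (b, True)"
  using loop_hit(1)[OF k, of "pi / 2 - \<epsilon> / 2"] loop_hit(2)[OF k, of "pi / 2 + \<epsilon> / 2"]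
    loop_hit(1)[OF k, of "3 * pi / 2 - \<epsilon> / 2"] loop_hit(2)[OF k, of "3 * pi / 2 + \<epsilon> / 2"]
  by (auto simp: three_halves_pi)

lemma loop_word:
  assumes k: "k < length E" "E ! k = (a, b, u)"
  shows "loop_word curves (noose k) = [(a, False), (b, False), (a, True), (b, True)]"
  unfolding loop_word_def iword_def loop_list[OF k(1)] by (simp add: loop_letters[OF k])

lemma transverse_loop:
  assumes "k < length E"
  shows "transverse_on curves (loop_path (noose k)) (loop_vel (noose k)) {0..2 * pi}"
proof (rule transverse_on_curves)
  have "{t \<in> {0..2 * pi}. arc_preim (loop_path (noose k) t) \<noteq> {}} \<subseteq>
      {pi / 2 - \<epsilon> / 2, pi / 2 + \<epsilon> / 2, 3 * pi / 2 - \<epsilon> / 2, 3 * pi / 2 + \<epsilon> / 2}"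
    using loop_times[OF assms] unfolding dimage_curves by auto
  then show "finite {t \<in> {0..2 * pi}. arc_preim (loop_path (noose k) t) \<noteq> {}}" by (rule finite_subset) simp
  fix t assume "t \<in> {0..2 * pi}" "arc_preim (loop_path (noose k) t) \<noteq> {}"
  then have "loop_path (noose k) t \<in> dimage curves" by (simp add: dimage_curves)
  then have "cos (t + \<epsilon> / 2) = 0 \<or> cos (t - \<epsilon> / 2) = 0"
    using head_dimage[OF assms cis_disc, of t] unfolding loop_path_def Re_cis_mult by simp
  then show "\<exists>j \<tau>. arc_preim (loop_path (noose k) t) = {(j, \<tau>)} \<and>
      loop_path (noose k) t \<bullet> cross3 (A' j \<tau>) (loop_vel (noose k) t) \<noteq> 0"
    using loop_hit[OF assms, of "fst (E ! k)" "fst (snd (E ! k))" "snd (snd (E ! k))" t] by auto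
qed

end

section \<open>The ropes and the conjugating words\<close>

context nooses
begin

definition conj_len :: "nat \<Rightarrow> nat" where "conj_len k = length (snd (snd (E ! k)))"

lemma block_less: "k < length E \<Longrightarrow> x < 2 * conj_len k + 4 \<Longrightarrow> block_start E k + x < n"
  using block_pos_less[of k E x] by (simp add: n_def W_def conj_len_def block_size_def)

lemma U_mirror:
  assumes "k < length E" "x < conj_len k"
  shows "U (block_start E k + x) = block_start E k + (2 * conj_len k + 3 - x)"
    "U (block_start E k + (2 * conj_len k + 3 - x)) = block_start E k + x"
proof -
  show 1: "U (block_start E k + x) = block_start E k + (2 * conj_len k + 3 - x)"
    using upper_match_eq[OF assms(1), of x] assms(2) by (simp add: block_size_def block_match_def conj_len_def)
  show "U (block_start E k + (2 * conj_len k + 3 - x)) = block_start E k + x"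
    using U(2)[OF block_less[OF assms(1), of x]] assms(2) unfolding 1 by simp
qed

text \<open>Half the angle spanned by the chord from letter \<open>x\<close> to its mirror image;
  this chord meets the axis perpendicularly at distance \<open>cos (depth k x)\<close> from the
  centre.\<close>

definition depth :: "nat \<Rightarrow> nat \<Rightarrow> real" where
  "depth k x = (real (conj_len k) + 3 / 2 - real x) * \<epsilon>"

lemma depth:
  assumes "k < length E" "x < conj_len k"
  shows "5 * \<epsilon> / 2 \<le> depth k x" "depth k x < pi / 2"
proof -
  have "5 / 2 \<le> real (conj_len k) + 3 / 2 - real x" using assms(2) by linarith
  then have "5 / 2 * \<epsilon> \<le> depth k x" unfolding depth_def using eps(1) by (intro mult_right_mono) auto
  then show "5 * \<epsilon> / 2 \<le> depth k x" by simp
  have "\<bar>real (conj_len k) + 3 / 2 - real x\<bar> \<le> real n"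
    using base_less[OF assms(1)] assms(2) unfolding base_def conj_len_def[symmetric] by linarith
  from eps_bound[OF this] show "depth k x < pi / 2" unfolding depth_def by linarith
qed

lemma side_mirror:
  assumes "k < length E" "x < conj_len k" "i = block_start E k + x \<or> i = block_start E k + (2 * conj_len k + 3 - x)"
  shows "side (real i * \<epsilon>) (real (U i) * \<epsilon>) (cis (\<beta> k) * of_real r) = r - cos (depth k x)"
    "pt (U i) - pt i = (2 * sin ((if i = block_start E k + x then 1 else - 1) * depth k x)) *\<^sub>R (\<i> * cis (\<beta> k))"
proof -
  let ?i = "block_start E k + x" and ?j = "block_start E k + (2 * conj_len k + 3 - x)"
  have ne: "?j \<noteq> ?i" using assms(2) by simp
  have r: "real ?j = real (block_start E k) + 2 * real (conj_len k) + 3 - real x"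
    using assms(2) by simp
  have m: "(real ?i * \<epsilon> + real ?j * \<epsilon>) / 2 = \<beta> k" "(real ?j * \<epsilon> - real ?i * \<epsilon>) / 2 = depth k x"
    unfolding r by (simp_all add: \<beta>_def depth_def base_def conj_len_def field_simps)
  then have m': "(real ?j * \<epsilon> + real ?i * \<epsilon>) / 2 = \<beta> k" "(real ?i * \<epsilon> - real ?j * \<epsilon>) / 2 = - depth k x"
    by (simp_all add: add.commute diff_divide_distrib)
  have c: "cis (\<beta> k) * of_real r * cis (- \<beta> k) = of_real r"
    by (simp add: complex_eq_iff) (metis (no_types) distrib_left mult.left_commute mult.right_neutral power2_eq_square sin_cos_squared_add2)
  have s: "side (real ?i * \<epsilon>) (real ?j * \<epsilon>) (cis (\<beta> k) * of_real r) = r - cos (depth k x)"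
    unfolding side_def m minus_divide_left[symmetric] by (simp only: c m(1)) simp
  show "side (real i * \<epsilon>) (real (U i) * \<epsilon>) (cis (\<beta> k) * of_real r) = r - cos (depth k x)"
    using assms(3) U_mirror[OF assms(1,2)] s side_commute[of "real ?i * \<epsilon>" "real ?j * \<epsilon>"] by auto
  show "pt (U i) - pt i = (2 * sin ((if i = ?i then 1 else - 1) * depth k x)) *\<^sub>R (\<i> * cis (\<beta> k))"
    using assms(3) U_mirror[OF assms(1,2)] ne unfolding pt_def cis_diff by (auto simp only: m m' if_True if_False) simp_all
qed

text \<open>Both ends of the chord lie on the same side of the axis, which makes \<open>side\<close>
  negative where the axis meets the circle. It is negative at the centre because the chord spans
  less than a half circle, hence on the whole radius by affinity.\<close>

lemma side_other_block:
  assumes "k < length E" "k' < length E" "k \<noteq> k'" "y < 2 * conj_len k' + 4" "i = block_start E k' + y" "0 \<le> r" "r \<le> 1"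
  shows "side (real i * \<epsilon>) (real (U i) * \<epsilon>) (cis (\<beta> k) * of_real r) < 0"
proof -
  let ?b = "real (base k) + 3 / 2"
  have i: "i < n" using block_less[OF assms(2,4)] assms(5) by simp
  have Ui: "U i = block_start E k' + block_match (conj_len k') y"
    using upper_match_eq[OF assms(2), of y] assms(4,5) by (simp add: block_size_def conj_len_def)
  have bm: "block_match (conj_len k') y < 2 * conj_len k' + 4" by (rule block_match_less[OF assms(4)])
  have "block_start E k + (2 * conj_len k + 4) \<le> block_start E k' \<or> block_start E k' + (2 * conj_len k' + 4) \<le> block_start E k"
    using block_before[of k k' E] block_before[of k' k E] assms(1-3) unfolding block_size_def conj_len_def
    by (cases k k' rule: linorder_cases) auto
  then have "(i \<ge> base k + 4 \<and> U i \<ge> base k + 4) \<or> (i < base k \<and> U i < base k)"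
    using assms(4,5) bm Ui unfolding base_def conj_len_def[symmetric] by linarith
  then have "(?b - real i < 0 \<and> real (U i) - ?b > 0) \<or> (?b - real i > 0 \<and> real (U i) - ?b < 0)"
    by linarith
  then have "(?b - real i) * (real (U i) - ?b) < 0" by (auto simp: mult_less_0_iff)
  moreover have "?b \<le> real n" using base_less[OF assms(1)] by linarith
  ultimately have "sgn (side (real i * \<epsilon>) (real (U i) * \<epsilon>) (cis (\<beta> k))) = -1"
    unfolding \<beta>_def using side_sgn[OF i U(1)[OF i], of ?b] by simp
  then have 1: "side (real i * \<epsilon>) (real (U i) * \<epsilon>) (cis (\<beta> k)) < 0" by (simp add: sgn_if split: if_splits)
  have half: "\<bar>d / 2\<bar> < pi / 2" if "\<bar>d\<bar> < pi / 2" for d :: real using that by simp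
  have "\<bar>real (U i) - real i\<bar> \<le> real n" using i U(1)[OF i] by linarith
  from half[OF eps_bound[OF this]] have "\<bar>(real (U i) * \<epsilon> - real i * \<epsilon>) / 2\<bar> < pi / 2"
    unfolding left_diff_distrib .
  then have "cos ((real (U i) * \<epsilon> - real i * \<epsilon>) / 2) > 0" by (intro cos_gt_zero_pi) (auto simp: abs_less_iff)
  then have 0: "side (real i * \<epsilon>) (real (U i) * \<epsilon>) 0 < 0" by (simp add: side_def)
  have "cis (\<beta> k) * of_real r = (1 - r) *\<^sub>R 0 + r *\<^sub>R cis (\<beta> k)" by (simp add: scaleR_conv_of_real mult.commute)
  then have "side (real i * \<epsilon>) (real (U i) * \<epsilon>) (cis (\<beta> k) * of_real r) =
      (1 - r) * side (real i * \<epsilon>) (real (U i) * \<epsilon>) 0 + r * side (real i * \<epsilon>) (real (U i) * \<epsilon>) (cis (\<beta> k))"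
    by (simp only: side_affine)
  also have "\<dots> < 0"
  proof (cases "r = 0")
    case False
    then have "r * side (real i * \<epsilon>) (real (U i) * \<epsilon>) (cis (\<beta> k)) < 0" using 1 assms(6) by (intro mult_pos_neg) auto
    moreover have "(1 - r) * side (real i * \<epsilon>) (real (U i) * \<epsilon>) 0 \<le> 0" using 0 assms(7) by (intro mult_nonneg_nonpos) auto
    ultimately show ?thesis by linarith
  qed (use 0 in simp)
  finally show ?thesis .
qed

text \<open>Chords of other factors miss the axis, and those of the commutator meet it only at
  \<open>X\<close>, beyond the neck. What remains are the mirror pairs of the conjugating
  words.\<close>

lemma rope_strand:
  assumes k: "k < length E" and r: "0 \<le> r" "r \<le> X - \<rho>" and a: "(j, \<tau>) \<in> arc_preim (lift (cis (\<beta> k) * of_real r))"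
  obtains x where "x < conj_len k" "j = block_start E k + x \<or> j = block_start E k + (2 * conj_len k + 3 - x)" "r = cos (depth k x)"
proof -
  have r1: "r < 1" "r < X" using r X(2) \<rho>(1) by linarith+
  then have "cmod (cis (\<beta> k) * of_real r) < 1" using r by simp
  note j = lift_arc_preim[OF this a]
  obtain k' y where k': "k' < length E" "y < block_size (E ! k')" and jy: "j = block_start E k' + y"
    using j(2) unfolding n_def W_def by (rule block_pos_exhaust)
  then have y: "y < 2 * conj_len k' + 4" by (simp add: block_size_def conj_len_def)
  have kk: "k' = k" using side_other_block[OF k k'(1) _ y jy r(1)] r1(1) j(3) by fastforce
  have "\<not> core_pos E k j"
  proof
    assume "core_pos E k j"
    then have "j = base k \<or> j = base k + 1" using core_up j(1) by blast
    moreover have "r * cos (\<epsilon> / 2) < X * cos (\<epsilon> / 2)" using r1(2) eps_half(3) by simp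
    ultimately show False using j(3) U_base[OF k] side_A[of k "of_real r"] X_cos by auto
  qed
  then have "y < conj_len k \<or> y > conj_len k + 3" using k unfolding jy kk core_pos_def conj_len_def[symmetric] by linarith
  then have "\<exists>x<conj_len k. j = block_start E k + x \<or> j = block_start E k + (2 * conj_len k + 3 - x)"
  proof
    assume "y > conj_len k + 3"
    then show ?thesis using y jy kk by (intro exI[of _ "2 * conj_len k + 3 - y"]) auto
  qed (use jy kk in blast)
  then obtain x where x: "x < conj_len k" "j = block_start E k + x \<or> j = block_start E k + (2 * conj_len k + 3 - x)" by blast
  then show thesis using that[OF x] side_mirror(1)[OF k x, of r] j(3) by simp
qed

text \<open>Time runs from the root to the neck. A solution exists by the intermediate value
  theorem, since the rope covers all distances from \<open>0\<close> to
  \<open>X - \<rho>\<close>.\<close>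

definition rope_time :: "nat \<Rightarrow> nat \<Rightarrow> real" where
  "rope_time k x = (SOME t. 0 < t \<and> t < 1 \<and> G (2 - t) = cos (depth k x))"

lemma cos_depth:
  assumes "k < length E" "x < conj_len k"
  shows "0 < cos (depth k x)" "cos (depth k x) < X - \<rho>"
proof -
  note d = depth[OF assms]
  have "0 < depth k x" using d eps(1) by linarith
  then show "0 < cos (depth k x)" using d by (intro cos_gt_zero) auto
  have "cos (depth k x) \<le> cos (5 * \<epsilon> / 2)" using d eps(1) pi_gt_zero by (intro cos_monotone_0_pi_le) linarith+
  then show "cos (depth k x) < X - \<rho>" using \<rho>(2) by linarith
qed

lemma rope_time:
  assumes "k < length E" "x < conj_len k"
  shows "0 < rope_time k x" "rope_time k x < 1" "G (2 - rope_time k x) = cos (depth k x)"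
proof -
  have "continuous_on {0..1} (\<lambda>t. G (2 - t))" unfolding G_def by (intro continuous_intros)
  then obtain t where t: "0 \<le> t" "t \<le> 1" "G (2 - t) = cos (depth k x)"
    using IVT'[of "\<lambda>t. G (2 - t)" 0 "cos (depth k x)" 1] cos_depth[OF assms] by auto
  moreover have "t \<noteq> 0" "t \<noteq> 1" using t(3) cos_depth[OF assms] by auto
  ultimately have "\<exists>t. 0 < t \<and> t < 1 \<and> G (2 - t) = cos (depth k x)" by (intro exI[of _ t]) auto
  from someI_ex[OF this] show "0 < rope_time k x" "rope_time k x < 1" "G (2 - rope_time k x) = cos (depth k x)"
    unfolding rope_time_def by auto
qed

text \<open>Earlier letters have longer chords, which lie nearer to the centre and are met first by
  a path starting there. This is what puts the letters of a rope in the right order.\<close>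

lemma rope_time_mono:
  assumes "k < length E" "x < y" "y < conj_len k"
  shows "rope_time k x < rope_time k y"
proof (rule ccontr)
  assume "\<not> rope_time k x < rope_time k y"
  then have "G (2 - rope_time k y) \<le> G (2 - rope_time k x)"
    using G_less[of "2 - rope_time k x" "2 - rope_time k y"] rope_time(1,2)[of k x] rope_time(1,2)[of k y] assms
    by (cases "rope_time k x = rope_time k y") auto
  then have "cos (depth k y) \<le> cos (depth k x)" using rope_time(3)[of k x] rope_time(3)[of k y] assms by simp
  moreover have "cos (depth k x) < cos (depth k y)"
  proof (rule cos_monotone_0_pi)
    show "depth k y < depth k x" unfolding depth_def using eps(1) assms(2) by (intro mult_strict_right_mono) auto
    show "0 \<le> depth k y" "depth k x \<le> pi"
      using depth[of k x] depth[of k y] assms eps(1) pi_gt_zero by linarith+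
  qed
  ultimately show False by simp
qed

lemma rope_path_eq:
  assumes "0 \<le> t" "t \<le> 1"
  shows "rope_path (noose k) t = lift (cis (\<beta> k) * of_real (G (2 - t)))"
  unfolding rope_path_def noose_def using F_rope(1)[of "2 - t"] assms by simp

lemma rope_hit:
  assumes k: "k < length E" and t: "0 \<le> t" "t \<le> 1" and a: "arc_preim (rope_path (noose k) t) \<noteq> {}"
  obtains x where "x < conj_len k" "t = rope_time k x"
proof -
  obtain j \<tau> where "(j, \<tau>) \<in> arc_preim (rope_path (noose k) t)" using a by auto
  moreover have "0 \<le> G (2 - t)" "G (2 - t) \<le> X - \<rho>" using G_range[of "2 - t"] t by auto
  ultimately obtain x where x: "x < conj_len k" "G (2 - t) = cos (depth k x)"
    using rope_strand[OF k] unfolding rope_path_eq[OF t] by metis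
  then have eq: "G (2 - t) = G (2 - rope_time k x)" using rope_time(3)[OF k x(1)] by simp
  note rt = rope_time(1,2)[OF k x(1)]
  have "t = rope_time k x"
    using eq G_less[of "2 - t" "2 - rope_time k x"] G_less[of "2 - rope_time k x" "2 - t"] t rt
    by (cases t "rope_time k x" rule: linorder_cases) auto
  then show thesis using that x(1) by blast
qed

text \<open>The arc between a letter and its mirror image is parametrised from the one that goes up.
  Whether this is \<open>x\<close> or the mirror image decides its direction across the axis, hence
  the exponent.\<close>

lemma rope_hit_exists:
  assumes k: "k < length E" and x: "x < conj_len k"
  shows "\<exists>j \<tau>. arc_preim (rope_path (noose k) (rope_time k x)) = {(j, \<tau>)} \<and>
    rope_path (noose k) (rope_time k x) \<bullet> cross3 (A' j \<tau>) (rope_vel (noose k) (rope_time k x)) \<noteq> 0 \<and>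
    dletter curves (rope_path (noose k) (rope_time k x)) (rope_vel (noose k) (rope_time k x)) = W ! (block_start E k + x)"
proof -
  note rt = rope_time[OF k x]
  let ?t = "rope_time k x" and ?i = "block_start E k + x" and ?i' = "block_start E k + (2 * conj_len k + 3 - x)"
  let ?q = "rope_path (noose k) ?t" and ?v = "rope_vel (noose k) ?t"
  define j where "j = (if up ?i then ?i else ?i')"
  have i: "?i < n" "?i' < n" using block_less[OF k, of x] block_less[OF k, of "2 * conj_len k + 3 - x"] x by auto
  have jx: "j = ?i \<or> j = ?i'" and jn: "j < n" using i by (auto simp: j_def)
  have upj: "up j" using U_mirror(1)[OF k x] up_match(1)[OF i(1)] by (auto simp: j_def)
  have q: "?q = lift (cis (\<beta> k) * of_real (cos (depth k x)))" using rope_path_eq[of ?t k] rt by simp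
  have n1: "cmod (cis (\<beta> k) * of_real (cos (depth k x))) < 1"
    using cos_depth[OF k x] X(2) \<rho>(1) by simp
  obtain \<tau> where \<tau>: "(j, \<tau>) \<in> arc_preim ?q"
    using arc_preim_lift_exists[OF n1 jn upj] side_mirror(1)[OF k x jx] unfolding q by auto
  have single: "arc_preim ?q = {(j, \<tau>)}"
  proof (intro set_eqI iffI)
    fix p assume p: "p \<in> arc_preim ?q"
    obtain j' \<tau>' where p': "p = (j', \<tau>')" by (cases p)
    obtain x' where x': "x' < conj_len k" "j' = block_start E k + x' \<or> j' = block_start E k + (2 * conj_len k + 3 - x')"
      "cos (depth k x) = cos (depth k x')"
      using rope_strand[OF k, of "cos (depth k x)" j' \<tau>'] p p' cos_depth[OF k x] unfolding q by (metis less_imp_le)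
    \<comment> \<open>\<open>rope_time\<close> depends on \<open>x\<close> only through
      \<open>cos (depth k x)\<close>, so equal distances give equal times, and strict monotonicity
      then identifies the letters.\<close>
    have "rope_time k x = rope_time k x'" unfolding rope_time_def x'(3) ..
    then have "x' = x" using rope_time_mono[OF k, of x x'] rope_time_mono[OF k, of x' x] x x'(1)
      by (cases x x' rule: linorder_cases) auto
    moreover have "up j'" using lift_arc_preim(1)[OF n1] p p' unfolding q by blast
    ultimately have "j' = j" using x'(2) upj U_mirror(1)[OF k x] up_match(1)[OF i(1)] by (auto simp: j_def split: if_splits)
    then show "p \<in> {(j, \<tau>)}" using arc_preim_unique[OF \<tau>] p p' by auto
  qed (use \<tau> in auto)
  have d: "of_real (2 - ?t) \<in> noose_dom" using rt by (intro noose_dom_rope) auto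
  have F: "F (of_real (2 - ?t)) = of_real (cos (depth k x))" using F_rope(1)[of "2 - ?t"] rt by simp
  define g where "g = \<rho> + 2 * (X - 2 * \<rho>) * (1 - ?t)"
  have g: "g > 0" unfolding g_def using \<rho>(1) X(3) rt by (intro add_pos_nonneg) auto
  have F': "F' (of_real (2 - ?t)) 1 = - of_real g" using F_rope(2)[of "2 - ?t"] rt by (simp add: g_def)
  obtain z where v: "?v = emb (cis (\<beta> k) * of_real g) z"
    unfolding rope_vel_def Dn_noose[OF d] F' minus_emb by simp
  have "?q \<bullet> ?v = 0" using noose_tangent[OF d, of k 1] unfolding rope_vel_def rope_path_def by simp
  then have t0: "lift (cis (\<beta> k) * of_real (cos (depth k x))) \<bullet> emb (cis (\<beta> k) * of_real g) z = 0" unfolding v q .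
  define \<sigma> :: real where "\<sigma> = (if j = ?i then 1 else - 1)"
  from velocity_sign[OF \<tau>[unfolded q] n1 upj t0] obtain c where c: "c > 0"
    "?q \<bullet> cross3 (A' j \<tau>) ?v = c * Im (cnj (pt (U j) - pt j) * (cis (\<beta> k) * of_real g))"
    unfolding v q by blast
  have "cnj (a *\<^sub>R (\<i> * cis y)) * (cis y * of_real g) = - of_real (a * g) * \<i> * (cis (- y) * cis y)" for a y
    by (simp add: cis_cnj scaleR_conv_of_real)
  then have "Im (cnj (a *\<^sub>R (\<i> * cis y)) * (cis y * of_real g)) = - (a * g)" for a y
    by (simp add: cis_mult)
  then have s: "?q \<bullet> cross3 (A' j \<tau>) ?v = - c * (2 * sin (\<sigma> * depth k x) * g)"
    unfolding c(2) side_mirror(2)[OF k x jx] \<sigma>_def by simp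
  have sd: "sin (depth k x) > 0" using depth[OF k x] eps(1) pi_gt_zero by (intro sin_gt_zero) linarith+
  have sig: "\<sigma> = (if up ?i then 1 else - 1)" using x by (auto simp: \<sigma>_def j_def)
  have pos: "?q \<bullet> cross3 (A' j \<tau>) ?v > 0 \<longleftrightarrow> \<not> up ?i" "?q \<bullet> cross3 (A' j \<tau>) ?v \<noteq> 0"
    unfolding s sig using c(1) g sd by (auto simp: zero_less_mult_iff mult_less_0_iff)
  have "lab j = fst (W ! ?i)" using U(3)[OF i(1)] U_mirror(1)[OF k x] by (auto simp: lab_def j_def)
  then have "dletter curves ?q ?v = W ! ?i"
    unfolding dletter_curves[OF single] pos(1) by (simp add: up_def)
  then show ?thesis using single pos(2) by blast
qed

lemma rope_set:
  assumes "k < length E"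
  shows "{t \<in> {0..<1}. rope_path (noose k) t \<in> dimage curves} = rope_time k ` {..<conj_len k}"
    "{t \<in> {0..1}. rope_path (noose k) t \<in> dimage curves} = rope_time k ` {..<conj_len k}"
proof -
  have 1: "t \<in> rope_time k ` {..<conj_len k}" if "0 \<le> t" "t \<le> 1" "rope_path (noose k) t \<in> dimage curves" for t
    using rope_hit[OF assms that(1,2)] that(3) unfolding dimage_curves by (metis imageI lessThan_iff)
  have 2: "0 < t \<and> t < 1 \<and> rope_path (noose k) t \<in> dimage curves" if t: "t \<in> rope_time k ` {..<conj_len k}" for t
  proof -
    obtain x where x: "x < conj_len k" "t = rope_time k x" using t by auto
    then show ?thesis using rope_time(1,2)[OF assms x(1)] rope_hit_exists[OF assms x(1)] unfolding dimage_curves by auto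
  qed
  show "{t \<in> {0..<1}. rope_path (noose k) t \<in> dimage curves} = rope_time k ` {..<conj_len k}"
    "{t \<in> {0..1}. rope_path (noose k) t \<in> dimage curves} = rope_time k ` {..<conj_len k}"
    using 1 2 by (auto simp: less_imp_le)
qed

lemma rope_word:
  assumes k: "k < length E" "E ! k = (a, b, u)"
  shows "rope_word curves (noose k) = winv u"
proof -
  have lu: "conj_len k = length u" using k(2) by (simp add: conj_len_def)
  let ?ts = "map (rope_time k) [0..<conj_len k]"
  have srt: "sorted_wrt (<) ?ts"
    using rope_time_mono[OF k(1)] by (simp add: sorted_wrt_iff_nth_less)
  have "sorted_list_of_set (set ?ts) = ?ts"
    using srt strict_sorted_iff[of ?ts] by (intro sorted_list_of_set.idem_if_sorted_distinct) auto
  then have "sorted_list_of_set (rope_time k ` {..<conj_len k}) = ?ts" by (simp add: atLeast0LessThan)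
  then have "rope_word curves (noose k) =
      map (\<lambda>x. dletter curves (rope_path (noose k) (rope_time k x)) (rope_vel (noose k) (rope_time k x))) [0..<conj_len k]"
    unfolding rope_word_def iword_def rope_set(1)[OF k(1)] by simp
  also have "\<dots> = map (\<lambda>x. winv u ! x) [0..<conj_len k]"
  proof (rule map_cong[OF refl])
    fix x assume "x \<in> set [0..<conj_len k]"
    then have x: "x < conj_len k" by simp
    have "W ! (block_start E k + x) = comm_word (E ! k) ! x"
      unfolding W_def using x by (intro concat_comm_word_nth[OF k(1)]) (simp add: block_size_def conj_len_def)
    also have "\<dots> = winv u ! x" using comm_word_outer(1)[of x u a b] x lu k(2) by simp
    finally show "dletter curves (rope_path (noose k) (rope_time k x)) (rope_vel (noose k) (rope_time k x)) = winv u ! x"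
      using rope_hit_exists[OF k(1) x] by auto
  qed
  also have "\<dots> = winv u" by (metis length_winv lu map_nth)
  finally show ?thesis .
qed

lemma noose_word:
  assumes k: "k < length E"
  shows "noose_word curves (noose k) = comm_word (E ! k)"
proof -
  obtain a b u where e: "E ! k = (a, b, u)" by (cases "E ! k")
  show ?thesis unfolding noose_word_def rope_word[OF k e] loop_word[OF k e] by (simp add: e)
qed

lemma transverse_rope:
  assumes k: "k < length E"
  shows "transverse_on curves (rope_path (noose k)) (rope_vel (noose k)) {0..1}"
proof (rule transverse_on_curves)
  show "finite {t \<in> {0..1}. arc_preim (rope_path (noose k) t) \<noteq> {}}"
    using rope_set(2)[OF k] unfolding dimage_curves by simp
  fix t assume "t \<in> {0..1::real}" "arc_preim (rope_path (noose k) t) \<noteq> {}"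
  then obtain x where "x < conj_len k" "t = rope_time k x" using rope_hit[OF k, of t] by auto
  then show "\<exists>j \<tau>. arc_preim (rope_path (noose k) t) = {(j, \<tau>)} \<and>
      rope_path (noose k) t \<bullet> cross3 (A' j \<tau>) (rope_vel (noose k) t) \<noteq> 0"
    using rope_hit_exists[OF k] by blast
qed

lemma noose_for:
  assumes k: "k < length E"
  shows "noose_for curves (noose k)"
proof -
  have "root (noose k) \<notin> dimage curves"
  proof
    assume "root (noose k) \<in> dimage curves"
    then have "rope_path (noose k) 0 \<in> dimage curves" by (simp add: root_def rope_path_def)
    then have "0 \<in> {t \<in> {0..1}. rope_path (noose k) t \<in> dimage curves}" by simp
    then show False unfolding rope_set(2)[OF k] using rope_time(1)[OF k] by force
  qed
  then show ?thesis unfolding noose_for_def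
    using noose_embedding transverse_loop[OF k] transverse_rope[OF k] by blast
qed

lemma disc_line:
  assumes "z \<in> cball 0 1" "Re (z * cis a) = 0"
  shows "\<exists>s\<in>{0..1}. z = of_real (1 - 2 * s) * (\<i> * cis (- a))"
proof -
  define y where "y = Im (z * cis a)"
  have "\<bar>y\<bar> \<le> cmod (z * cis a)" unfolding y_def by (rule abs_Im_le_cmod)
  also have "\<dots> \<le> 1" using assms(1) by (simp add: norm_mult)
  finally have y: "\<bar>y\<bar> \<le> 1" .
  have "z = (z * cis a) * cis (- a)" by (simp add: cis_mult)
  also have "z * cis a = of_real y * \<i>" using assms(2) by (simp add: complex_eq_iff y_def)
  finally have "z = of_real y * (\<i> * cis (- a))" by (simp only: mult.assoc)
  moreover have "1 - 2 * ((1 - y) / 2) = y" by (simp add: field_simps)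
  ultimately have "z = of_real (1 - 2 * ((1 - y) / 2)) * (\<i> * cis (- a))" by (simp only:)
  then show ?thesis using y by (intro bexI[of _ "(1 - y) / 2"]) auto
qed

lemma proper_noose:
  assumes k: "k < length E"
  shows "proper_noose curves (noose k)"
proof -
  obtain a b u where e: "E ! k = (a, b, u)" by (cases "E ! k")
  \<comment> \<open>The required arcs are the diameters of the head at the two tilts
    \<open>\<epsilon> / 2\<close> and \<open>- \<epsilon> / 2\<close>, which meet in its
    centre.\<close>
  define g where "g x s = noose k (of_real (1 - 2 * s) * (\<i> * cis (- x)))" for x s
  let ?e = "\<epsilon> / 2"
  have z: "of_real (1 - 2 * s) * (\<i> * cis (- x)) \<in> cball 0 1" if "s \<in> {0..1}" for s x :: real
  proof -
    have "\<bar>1 - 2 * s\<bar> \<le> 1" using that by auto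
    then show ?thesis by (simp only: mem_cball dist_0_norm norm_mult norm_of_real) simp
  qed
  have arc: "arc (g x)" for x
    unfolding arc_def
  proof
    have "continuous_on {0..1} (\<lambda>s. lift (cis (\<beta> k) * (of_real X - of_real \<rho> * (of_real (1 - 2 * s) * (\<i> * cis (- x))))))"
      by (rule continuous_on_compose2[OF continuous_on_lift[of UNIV]]) (auto intro!: continuous_intros)
    then show "path (g x)" unfolding path_def
      by (rule continuous_on_eq) (use z in \<open>simp add: g_def noose_def F_disc(1)\<close>)
    show "inj_on (g x) {0..1}"
    proof (rule inj_onI)
      fix s t assume st: "s \<in> {0..1}" "t \<in> {0..1}" and "g x s = g x t"
      then have "F (of_real (1 - 2 * s) * (\<i> * cis (- x))) = F (of_real (1 - 2 * t) * (\<i> * cis (- x)))"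
        by (simp add: g_def noose_def)
      then have "of_real (1 - 2 * s) * (\<i> * cis (- x)) = of_real (1 - 2 * t) * (\<i> * cis (- x))"
        by (rule inj_onD[OF inj_on_F]) (use z st in \<open>auto intro!: noose_dom_disc\<close>)
      then have "of_real (1 - 2 * s) = (of_real (1 - 2 * t) :: complex)" 
        by (simp only: mult_cancel_right mult_eq_0_iff complex_i_not_zero cis_neq_zero simp_thms)
      then show "s = t" by (simp only: of_real_eq_iff)
    qed
  qed
  have re: "Re (of_real r * (\<i> * cis (- x)) * cis x) = 0" for r x
    by (simp add: cis_mult mult.assoc)
  have img: "q \<in> path_image (g x) \<longleftrightarrow> (\<exists>w\<in>cball 0 1. q = noose k w \<and> Re (w * cis x) = 0)" for q x
  proof
    assume "q \<in> path_image (g x)"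
    then obtain s where "s \<in> {0..1}" "q = g x s" by (auto simp: path_image_def)
    then show "\<exists>w\<in>cball 0 1. q = noose k w \<and> Re (w * cis x) = 0"
      using z[of s x] re by (intro bexI[of _ "of_real (1 - 2 * s) * (\<i> * cis (- x))"]) (auto simp: g_def)
  next
    assume "\<exists>w\<in>cball 0 1. q = noose k w \<and> Re (w * cis x) = 0"
    then obtain w where "w \<in> cball 0 1" "q = noose k w" "Re (w * cis x) = 0" by blast
    with disc_line[of w x] show "q \<in> path_image (g x)" by (auto simp: path_image_def g_def)
  qed
  have un: "dimage curves \<inter> head (noose k) = path_image (g ?e) \<union> path_image (g (- ?e))"
    unfolding set_eq_iff Int_iff Un_iff img head_def using head_dimage[OF k] by blast
  have "w = 0" if "Re (w * cis ?e) = 0" "Re (w * cis (- ?e)) = 0" for w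
  proof -
    have "Re w * cos ?e - Im w * sin ?e = 0" "Re w * cos ?e + Im w * sin ?e = 0"
      using that by (simp_all add: cos_minus sin_minus)
    then have "Re w * cos ?e = 0" "Im w * sin ?e = 0" by linarith+
    then show ?thesis using eps_half by (simp add: complex_eq_iff)
  qed
  moreover have "w = w'" if "w \<in> cball 0 1" "w' \<in> cball 0 1" "noose k w = noose k w'" for w w'
    using that inj_onD[OF inj_on_F, of w w'] noose_dom_disc by (simp add: noose_def)
  ultimately have int: "path_image (g ?e) \<inter> path_image (g (- ?e)) = {noose k 0}"
    unfolding set_eq_iff Int_iff img by (metis (no_types, lifting) centre_in_cball mult_zero_left singleton_iff zero_complex.sel(1) zero_le_one)
  have on: "loop_path (noose k) \<theta> \<in> path_image (g x)" if "cos (\<theta> + x) = 0" for \<theta> x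
    unfolding img loop_path_def using that cis_disc[of \<theta>] by (intro bexI[of _ "cis \<theta>"]) (simp_all add: cis_mult)
  let ?q = "loop_path (noose k)"
  have "?q (pi / 2 - ?e) \<in> path_image (g ?e)" "?q (3 * pi / 2 - ?e) \<in> path_image (g ?e)"
    "?q (pi / 2 + ?e) \<in> path_image (g (- ?e))" "?q (3 * pi / 2 + ?e) \<in> path_image (g (- ?e))"
    by (rule on; simp add: three_halves_pi)+
  then show ?thesis
    unfolding proper_noose_def
    using noose_for[OF k] arc[of ?e] arc[of "- ?e"] un int loop_list[OF k]
      loop_letters[OF k e, THEN arg_cong[where f = snd], unfolded snd_conv]
    by blast
qed

section \<open>Disjointness and cyclic order of the nooses\<close>

lemma beta_mono:
  assumes "k < j" "j < length E"
  shows "\<beta> k + 4 * \<epsilon> \<le> \<beta> j"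
proof -
  have "base k + 4 \<le> base j"
    using block_before[of k j E] assms by (simp add: base_def block_size_def)
  then have "real (base k) + 4 \<le> real (base j)" by linarith
  then have "(real (base k) + 3 / 2 + 4) * \<epsilon> \<le> (real (base j) + 3 / 2) * \<epsilon>" using eps(1) by (intro mult_right_mono) auto
  then show ?thesis by (simp add: \<beta>_def distrib_right)
qed

lemma beta_range:
  assumes "k < length E"
  shows "0 \<le> \<beta> k" "\<beta> k < pi / 2"
proof -
  have "\<bar>real (base k) + 3 / 2\<bar> \<le> real n" using base_less[OF assms] by linarith
  from eps_bound[OF this] show "\<beta> k < pi / 2" unfolding \<beta>_def by linarith
  show "0 \<le> \<beta> k" using eps(1) by (simp add: \<beta>_def)
qed

text \<open>The centre of the head has distance \<open>X * sin \<delta> > \<rho>\<close> from each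
  of the two lines at angles \<open>\<delta>\<close> and \<open>- \<delta>\<close>, and the rope
  lies on the axis. The angle \<open>\<delta>\<close> is left free because a ray between two axes
  need not be equally far from both.\<close>

lemma sector:
  assumes "z \<in> noose_dom" "2 * \<epsilon> \<le> \<delta>" "\<delta> \<le> pi / 2"
  shows "F z = 0 \<or> Im (F z * cis \<delta>) > 0" "F z = 0 \<or> Im (F z * cis (- \<delta>)) < 0"
proof -
  have s: "sin (2 * \<epsilon>) \<le> sin \<delta>" using assms eps(1) by (intro sin_monotone_2pi_le) auto
  have s0: "0 < sin (2 * \<epsilon>)" using eps_n(1) eps(1) by (intro sin_gt_zero) auto
  have "F z = 0 \<or> Im (F z * cis \<delta>) > 0 \<and> Im (F z * cis (- \<delta>)) < 0"
  proof (cases "z \<in> cball 0 1")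
    case True
    have "\<bar>Im (z * cis t)\<bar> \<le> 1" for t
      using abs_Im_le_cmod[of "z * cis t"] True by (simp add: norm_mult)
    then have "\<bar>\<rho> * Im (z * cis t)\<bar> \<le> \<rho> * 1" for t unfolding abs_mult using \<rho>(1) by (intro mult_mono) auto
    from this[of \<delta>] this[of "- \<delta>"] have b: "\<rho> * Im (z * cis \<delta>) \<le> \<rho>" "- \<rho> \<le> \<rho> * Im (z * cis (- \<delta>))" by linarith+
    have m: "Im (F z * cis t) = X * sin t - \<rho> * Im (z * cis t)" for t
      unfolding F_disc(1)[OF True] by (simp add: algebra_simps)
    have "\<rho> < X * sin \<delta>" using \<rho>(4) s X(1) by (smt (verit) mult_left_mono)
    then show ?thesis using b unfolding m sin_minus by simp
  next
    case False
    then obtain t where t: "1 \<le> t" "t \<le> 2" "z = of_real t" using assms(1) by (auto simp: noose_dom_def)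
    have "F z = of_real (G t)" using F_rope(1)[OF t(1)] t(3) by simp
    then show ?thesis using G_range(1)[OF t(1,2)] s s0 by (auto simp: order_le_less)
  qed
  then show "F z = 0 \<or> Im (F z * cis \<delta>) > 0" "F z = 0 \<or> Im (F z * cis (- \<delta>)) < 0" by auto
qed

lemma nooses_disjoint:
  assumes "k < j" "j < length E"
  shows "noose_set (noose k) \<inter> noose_set (noose j) = {root (noose k)}"
proof
  show "{root (noose k)} \<subseteq> noose_set (noose k) \<inter> noose_set (noose j)"
    using root_noose[of j] root_noose[of k] noose_dom_rope[of 2] by (auto simp: noose_set_def root_def image_iff intro!: bexI[of _ 2])
  show "noose_set (noose k) \<inter> noose_set (noose j) \<subseteq> {root (noose k)}"
  proof
    fix q assume "q \<in> noose_set (noose k) \<inter> noose_set (noose j)"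
    then obtain z z' where z: "z \<in> noose_dom" "q = noose k z" and z': "z' \<in> noose_dom" "q = noose j z'"
      by (auto simp: noose_set_def)
    then have eq: "cis (\<beta> k) * F z = cis (\<beta> j) * F z'" by (simp add: noose_def)
    \<comment> \<open>The ray at angle \<open>\<mu>\<close> separates the nooses: it lies
      \<open>2 * \<epsilon>\<close> beyond the first axis and, as axes are at least
      \<open>4 * \<epsilon>\<close> apart, at least that much before the second.\<close>
    define \<mu> where "\<mu> = \<beta> k + 2 * \<epsilon>"
    have r: "F z * cis (- (2 * \<epsilon>)) = F z' * cis (\<beta> j - \<mu>)"
    proof -
      have "F z * cis (- (2 * \<epsilon>)) = cis (\<beta> k) * F z * cis (- \<mu>)"
        unfolding \<mu>_def by (simp add: mult.commute mult.left_commute cis_mult)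
      also have "\<dots> = F z' * cis (\<beta> j - \<mu>)" unfolding eq by (simp add: mult.commute mult.left_commute cis_mult)
      finally show ?thesis .
    qed
    have d: "2 * \<epsilon> \<le> \<beta> j - \<mu>" "\<beta> j - \<mu> \<le> pi / 2"
      using beta_mono[OF assms] beta_range[of j] beta_range[of k] assms eps(1) unfolding \<mu>_def by linarith+
    have "F z = 0"
    proof (rule ccontr)
      assume nz: "F z \<noteq> 0"
      then have "F z' \<noteq> 0" using eq by (auto simp: cis_neq_zero)
      then show False
        using sector(2)[OF z(1), of "2 * \<epsilon>"] sector(1)[OF z'(1) d] nz r eps_n(1) eps(1) by force
    qed
    then show "q \<in> {root (noose k)}" using z(2) by (simp add: root_noose noose_def)
  qed
qed

text \<open>At the root \<open>F\<close> vanishes, and with it the vertical component of the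
  derivative.\<close>

lemma rope_dir_noose: "\<exists>c>0. rope_dir (noose k) = c *\<^sub>R emb (cis (\<beta> k)) 0"
proof -
  have d: "2 \<in> noose_dom" using noose_dom_rope[of 2] by simp
  have F: "F 2 = 0" "F' 2 1 = - of_real (\<rho> + 2 * (X - 2 * \<rho>))" using F_rope[of 2] by simp_all
  have "rope_dir (noose k) = (\<rho> + 2 * (X - 2 * \<rho>)) *\<^sub>R emb (cis (\<beta> k)) 0"
    unfolding rope_dir_def Dn_noose[OF d] F minus_emb scaleR_emb
    by (simp add: scaleR_conv_of_real algebra_simps)
  then show ?thesis using \<rho>(1) X(3) by (intro exI[of _ "\<rho> + 2 * (X - 2 * \<rho>)"]) auto
qed

lemma sgn_rope_dir: "sgn (rope_dir (noose k)) = emb (cis (\<beta> k)) 0"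
proof -
  obtain c where c: "c > 0" "rope_dir (noose k) = c *\<^sub>R emb (cis (\<beta> k)) 0" using rope_dir_noose by blast
  have "(norm (emb (cis (\<beta> k)) 0))\<^sup>2 = 1\<^sup>2" by (simp add: norm_emb)
  then have "norm (emb (cis (\<beta> k)) 0) = 1" by (rule power2_eq_imp_eq) auto
  then show ?thesis using c by (simp add: sgn_div_norm)
qed

lemma crossing_head:
  assumes "crossing curves q"
  shows "\<exists>k<length E. q \<in> head (noose k)"
proof -
  have "card (arc_preim q) = 2" using assms by (simp add: crossing_def card_preim)
  then obtain x y where "arc_preim q = {x, y}" "x \<noteq> y" unfolding card_2_iff by blast
  moreover obtain i s j t where "x = (i, s)" "y = (j, t)" by (cases x, cases y)
  ultimately have "(i, s) \<in> arc_preim q" "(j, t) \<in> arc_preim q" "(i, s) \<noteq> (j, t)" by auto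
  then obtain k where "k < length E" "q = lift (cis (\<beta> k) * X)" using double_upper[of i s q j t] by metis
  moreover have "F 0 = X" using F_disc(1)[of 0] by simp
  ultimately show ?thesis unfolding head_def noose_def by (intro exI[of _ k]) (auto intro!: image_eqI[of _ _ 0])
qed

lemma noose_system: "noose_system curves (map noose [0..<length E])"
  unfolding noose_system_def
proof (intro conjI)
  let ?N = "map noose [0..<length E]"
  show "\<forall>k<length ?N. noose_for curves (?N ! k)" using noose_for by simp
  show "\<forall>k<length ?N. \<forall>j<length ?N. root (?N ! k) = root (?N ! j)" by (simp add: root_noose)
  show "\<forall>k<length ?N. \<forall>j<length ?N. k \<noteq> j \<longrightarrow> noose_set (?N ! k) \<inter> noose_set (?N ! j) = {root (?N ! k)}"
  proof (intro allI impI)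
    fix k j assume kj: "k < length ?N" "j < length ?N" "k \<noteq> j"
    then show "noose_set (?N ! k) \<inter> noose_set (?N ! j) = {root (?N ! k)}"
      using nooses_disjoint[of k j] nooses_disjoint[of j k] root_noose
      by (cases k j rule: linorder_cases) (auto simp: Int_commute)
  qed
  show "\<forall>q. crossing curves q \<longrightarrow> (\<exists>k<length ?N. q \<in> head (?N ! k))" using crossing_head by fastforce
  show "\<exists>\<theta>. \<theta> 0 = 0 \<and> (\<forall>k. Suc k < length ?N \<longrightarrow> \<theta> k < \<theta> (Suc k)) \<and>
     (\<forall>k<length ?N. \<theta> k < 2 * pi \<and> sgn (rope_dir (?N ! k)) =
        cos (\<theta> k) *\<^sub>R sgn (rope_dir (?N ! 0)) + sin (\<theta> k) *\<^sub>R cross3 (root (?N ! 0)) (sgn (rope_dir (?N ! 0))))"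
  \<comment> \<open>The angles are those between the axes, all within a quarter circle; at the north
    pole the vector product with the root is multiplication by \<open>\<i>\<close>.\<close>
  proof (intro exI[of _ "\<lambda>k. \<beta> k - \<beta> 0"] conjI allI impI)
    fix k assume "Suc k < length ?N"
    then show "\<beta> k - \<beta> 0 < \<beta> (Suc k) - \<beta> 0" using beta_mono[of k "Suc k"] eps(1) by simp
  next
    fix k assume "k < length ?N"
    then have k: "k < length E" "0 < length E" by auto
    then show "\<beta> k - \<beta> 0 < 2 * pi" using beta_range[of k] beta_range[of 0] pi_gt_zero by linarith
    have "cis (\<beta> k) = cis (\<beta> 0 + (\<beta> k - \<beta> 0))" by simp
    then have "cis (\<beta> k) = cos (\<beta> k - \<beta> 0) *\<^sub>R cis (\<beta> 0) + sin (\<beta> k - \<beta> 0) *\<^sub>R (\<i> * cis (\<beta> 0))"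
      unfolding cis_mult[symmetric] by (simp add: complex_eq_iff mult.commute)
    moreover have "cross3 (lift 0) (emb w 0) = emb (\<i> * w) 0" for w
      by (simp add: lift_def cross3_emb complex_eq_iff)
    ultimately show "sgn (rope_dir (?N ! k)) =
        cos (\<beta> k - \<beta> 0) *\<^sub>R sgn (rope_dir (?N ! 0)) + sin (\<beta> k - \<beta> 0) *\<^sub>R cross3 (root (?N ! 0)) (sgn (rope_dir (?N ! 0)))"
      using k by (simp add: sgn_rope_dir root_noose scaleR_emb add_emb)
  qed simp
qed

lemma proper_noose_system: "proper_noose_system curves (map noose [0..<length E])"
  unfolding proper_noose_system_def using noose_system proper_noose by simp

end

text \<open>All four upper bounds are positive because
  \<open>cos (5 * \<epsilon> / 2) < cos \<epsilon> < X < 1\<close>, where \<open>X\<close> exceeds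
  \<open>cos \<epsilon>\<close> as the quotient by \<open>cos (\<epsilon> / 2) < 1\<close>. Half of
  their minimum is a valid radius.\<close>

lemma (in identity) nooses_exist:
  assumes "E \<noteq> []"
  shows "\<exists>\<rho>. nooses S E V \<rho>"
proof -
  have n4: "n \<ge> 4" using base_less[of 0] assms by simp
  have "4 * \<epsilon> \<le> real n * \<epsilon>" using n4 eps(1) by (intro mult_right_mono) auto
  then have e: "4 * \<epsilon> < pi / 2" using eps(2) by simp
  note h = eps_half
  have X0: "0 < X" unfolding X_def using h e eps(1) by (intro divide_pos_pos cos_gt_zero) auto
  have "cos \<epsilon> < cos (\<epsilon> / 2)" using e eps(1) by (intro cos_monotone_0_pi) auto
  then have X1: "X < 1" unfolding X_def using h by simp
  have "cos (\<epsilon> / 2) < cos 0" using h pi_gt_zero by (intro cos_monotone_0_pi) auto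
  then have "cos \<epsilon> * cos (\<epsilon> / 2) < cos \<epsilon>" using cos_gt_zero[of \<epsilon>] e eps(1) by simp
  then have "cos \<epsilon> < X" unfolding X_def using h(3) by (simp add: field_simps)
  moreover have "cos (5 * \<epsilon> / 2) < cos \<epsilon>" using e eps(1) pi_gt_zero by (intro cos_monotone_0_pi) auto
  ultimately have X2: "cos (5 * \<epsilon> / 2) < X" by simp
  have X3: "0 < X * sin (2 * \<epsilon>)" using X0 e eps(1) by (intro mult_pos_pos sin_gt_zero) auto
  define m where "m = min (min (X - cos (5 * \<epsilon> / 2)) (1 - X)) (min (X * sin (2 * \<epsilon>)) (X / 2))"
  have m: "0 < m" using X0 X1 X2 X3 by (simp add: m_def)
  have "nooses S E V (m / 2)"
  proof unfold_locales
    have "m / 2 < m" using m by simp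
    then show "m / 2 < X - cos (5 * \<epsilon> / 2)" "m / 2 < 1 - X" "m / 2 < X * sin (2 * \<epsilon>)" "m / 2 < X / 2"
      unfolding m_def by linarith+
  qed (use m n4 in auto)
  then show ?thesis ..
qed

theorem theorem3p2:
  fixes S :: "'s set" and E :: "('s \<times> 's \<times> 's letter list) list"
  assumes "S \<noteq> {}" and "elementary_identity S E"
  shows "\<exists>(D :: 's diagram) (N :: (complex \<Rightarrow> real^3) list).
           doodle S D \<and> proper_noose_system D N \<and> length N = length E
           \<and> (\<forall>i < length E. noose_word D (N ! i) = comm_word (E ! i))"
proof (cases "E = []")
  case True
  \<comment> \<open>The empty product is realised by the empty diagram; the construction of heads
    presupposes at least one factor.\<close>
  have "preim ([] :: 's diagram) q = {}" for q by (simp add: preim_def)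
  then have "doodle S []" "proper_noose_system ([] :: 's diagram) []"
    by (auto simp: doodle_def proper_noose_system_def noose_system_def crossing_def)
  then show ?thesis using True by (intro exI[of _ "[]"]) auto
next
  case False
  let ?W = "concat (map comm_word E)"
  have "fred ?W = []" using assms(2) by (simp add: elementary_identity_def)
  then obtain V where V: "matching ?W V" "noncrossing (length ?W) V"
    using dyck_imp_matching fred_Nil_imp_dyck by blast
  have "fst x \<in> S" if x: "x \<in> set ?W" for x
  proof -
    obtain a b u where e: "(a, b, u) \<in> set E" "x \<in> set (comm_word (a, b, u))" using x by auto
    then have "a \<in> S" "b \<in> S" "\<forall>y\<in>set u. fst y \<in> S" using assms(2) by (auto simp: elementary_identity_def)
    then show ?thesis using e(2) by (auto simp: winv_eq)
  qed
  then interpret identity S E V by unfold_locales (use V in auto)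
  obtain \<rho> where "nooses S E V \<rho>" using nooses_exist[OF False] by blast
  then interpret nooses S E V \<rho> .
  show ?thesis
    by (intro exI[of _ curves] exI[of _ "map noose [0..<length E]"] conjI doodle proper_noose_system)
      (simp_all add: noose_word)
qed

end
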